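(* Let $(M,\tau)$ be a tracial $W^\ast$-probability space and let $X_1,\dots,X_n\in M$ be self-adjoint with $\delta^\ast(X_1,\dots,X_n)=n$. Then, for any non-constant self-adjoint non-commutative polynomial $P\in\mathbb{C}\langle Z_1,\dots,Z_n\rangle$, the distribution $\mu_{P(X_1,\dots,X_n)}$ of $P(X_1,\dots,X_n)$ does not have atoms.
   Context: A tracial $W^\ast$-probability space $(M,\tau)$ is a von Neumann algebra $M$ with a faithful normal tracial state $\tau$. For $Y=Y^*\in M$, the distribution $\mu_Y$ is the unique probability measure on $\mathbb{R}$ with $\tau(Y^k)=\int_{\mathbb{R}}t^k\,d\mu_Y(t)$ for $k=0,1,2,\dots$. $L^2(M,\tau)$ is the completion of $M$ for $\langle a,b\rangle=\tau(ab^* )$, with norm $\|\cdot\|_2$; for $\xi\in L^2(M,\tau)$ and $a\in M$, $\tau(\xi a):=\langle\xi,a^*\rangle$. $\mathbb{C}\langle Z_1,\dots,Z_n\rangle$ is the unital $\ast$-algebra of non-commutative polynomials in $n$ self-adjoint formal variables ($Z_i^*=Z_i$); $\partial_j:\mathbb{C}\langle Z_1,\dots,Z_n\rangle\to\mathbb{C}\langle Z_1,\dots,Z_n\rangle^{\otimes2}$ is the linear map with $\partial_jP=\sum_{P=P_1Z_jP_2}P_1\otimes P_2$ on monomials $P$ (sum over all factorizations with monomials $P_1,P_2$). For self-adjoint $X=(X_1,\dots,X_n)$, $P(X)$ is the image of $P$ under the unital homomorphism $\mathrm{ev}_X:Z_i\mapsto X_i$, and $Q(X):=(\mathrm{ev}_X\otimes\mathrm{ev}_X)(Q)$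 for $Q\in\mathbb{C}\langle Z_1,\dots,Z_n\rangle^{\otimes2}$. $\mathbb{C}\langle X_1,\dots,X_n\rangle$ is the range of $\mathrm{ev}_X$, and $L^2(X_1,\dots,X_n,\tau)$ is its closure in $L^2(M,\tau)$. A conjugate system for $(X_1,\dots,X_n)$ is a tuple $(\xi_1,\dots,\xi_n)$ in $L^2(X_1,\dots,X_n,\tau)$ with $(\tau\otimes\tau)((\partial_jP)(X))=\tau(\xi_jP(X))$ for all $P\in\mathbb{C}\langle Z_1,\dots,Z_n\rangle$ and $j=1,\dots,n$; it is unique if it exists. The non-microstates free Fisher information is $\Phi^\ast(X_1,\dots,X_n):=\sum_{j=1}^n\|\xi_j\|_2^2$ if a conjugate system exists, and $:=\infty$ otherwise. After enlarging $(M,\tau)$ if necessary (e.g. replacing it by the free product with $(L(\mathbb{F}_n),\tau_n)$), let $S_1,\dots,S_n\in M$ be normalized semicircular elements (mean $0$, variance $1$) such that $\{X_1,\dots,X_n\},\{S_1\},\dots,\{S_n\}$ are freely independent. The non-microstates free entropy is $$\chi^\ast(X_1,\dots,X_n):=\frac12\int_0^\infty\Big(\frac{n}{1+t}-\Phi^\ast(X_1+\sqrt t S_1,\dots,X_n+\sqrt t S_n)\Big)dt+\frac n2\log(2\pi e),$$ and the non-microstates free entropy dimension is $$\delta^\ast(X_1,\dots,X_n):=n-\liminf_{\epsilon\searrow0}\frac{\chi^\ast(X_1+\sqrt\epsilon S_1,\dots,X_n+\sqrt\epsilon S_n)}{\log(\sqrt\epsilon)}.$$ *)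

theory Defs
  imports "HOL-Probability.Probability" "HOL-Library.Poly_Mapping"
begin

section \<open>Complex Hilbert spaces and bounded operators\<close>

text \<open>A complex Hilbert space is a real Hilbert space with a compatible complex structure. The
  complex inner product is linear in the first argument, and the norm and topology are those of
  the underlying real Hilbert space, whose inner product is its real part.\<close>

class complex_hilbert = real_inner + complete_space +
  fixes scaleC :: "complex \<Rightarrow> 'a \<Rightarrow> 'a" (infixr \<open>*\<^sub>C\<close> 75)
    and cinner :: "'a \<Rightarrow> 'a \<Rightarrow> complex"
  assumes scaleR_scaleC: "r *\<^sub>R x = complex_of_real r *\<^sub>C x"
    and scaleC_add_right: "a *\<^sub>C (x + y) = a *\<^sub>C x + a *\<^sub>C y"
    and scaleC_add_left: "(a + b) *\<^sub>C x = a *\<^sub>C x + b *\<^sub>C x"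
    and scaleC_scaleC: "a *\<^sub>C (b *\<^sub>C x) = (a * b) *\<^sub>C x"
    and cinner_commute: "cinner x y = cnj (cinner y x)"
    and cinner_add_left: "cinner (x + y) z = cinner x z + cinner y z"
    and cinner_scaleC_left: "cinner (a *\<^sub>C x) y = a * cinner x y"
    and inner_eq_Re_cinner: "inner x y = Re (cinner x y)"

type_synonym 'h op = "'h \<Rightarrow>\<^sub>L 'h"

text \<open>The type \<^typ>\<open>'h op\<close> consists of the bounded real-linear maps; the elements of
  $B(H)$ are the complex-linear ones.\<close>

definition bounded_ops :: "'h::complex_hilbert op set" where
  "bounded_ops = {T. \<forall>c x. blinfun_apply T (c *\<^sub>C x) = c *\<^sub>C blinfun_apply T x}"

definition op_scale :: "complex \<Rightarrow> 'h::complex_hilbert op \<Rightarrow> 'h op" where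
  "op_scale c T = Blinfun (\<lambda>x. c *\<^sub>C blinfun_apply T x)"

lemma op_scale_apply [simp]: "blinfun_apply (op_scale c T) x = c *\<^sub>C blinfun_apply T x"
proof -
  have n: "norm (c *\<^sub>C y) = cmod c * norm y" for y :: 'a
  proof -
    have "cinner (c *\<^sub>C y) (c *\<^sub>C y) = c * cnj (c * cnj (cinner y y))"
      by (metis cinner_commute cinner_scaleC_left complex_cnj_mult)
    also have "\<dots> = complex_of_real ((cmod c)\<^sup>2) * cinner y y"
      using complex_norm_square[of c] by (simp add: mult.assoc)
    finally have "inner (c *\<^sub>C y) (c *\<^sub>C y) = (cmod c)\<^sup>2 * inner y y"
      by (simp add: inner_eq_Re_cinner)
    then show ?thesis
      by (simp add: norm_eq_sqrt_inner real_sqrt_mult)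
  qed
  have "bounded_linear (\<lambda>y::'a. c *\<^sub>C y)"
    by (rule bounded_linear_intro[where K = "cmod c"])
      (simp_all add: scaleC_add_right scaleR_scaleC scaleC_scaleC n mult.commute)
  then have "bounded_linear (\<lambda>y. c *\<^sub>C blinfun_apply T y)"
    by (rule bounded_linear_compose) (rule blinfun.bounded_linear_right)
  then show ?thesis
    by (simp add: op_scale_def bounded_linear_Blinfun_apply)
qed

definition op_adj :: "'h::complex_hilbert op \<Rightarrow> 'h op" where
  "op_adj T = (THE S. \<forall>x y. cinner (blinfun_apply T x) y = cinner x (blinfun_apply S y))"

definition op_prod :: "'h::complex_hilbert op list \<Rightarrow> 'h op" where
  "op_prod Ts = foldr (o\<^sub>L) Ts id_blinfun"


section \<open>Tracial \<open>W\<^sup>*\<close>-probability spaces\<close>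

definition commutant :: "'h::complex_hilbert op set \<Rightarrow> 'h op set" where
  "commutant A = {T \<in> bounded_ops. \<forall>S\<in>A. T o\<^sub>L S = S o\<^sub>L T}"

text \<open>A von Neumann algebra on the Hilbert space \<open>'h\<close>: a self-adjoint set of operators that equals
  its bicommutant. (Commutants are unital algebras, so the algebra structure is implied.)\<close>

definition von_neumann_algebra :: "'h::complex_hilbert op set \<Rightarrow> bool" where
  "von_neumann_algebra M \<longleftrightarrow>
     M \<subseteq> bounded_ops \<and> (\<forall>a\<in>M. op_adj a \<in> M) \<and> commutant (commutant M) = M"

definition self_adjoint_in :: "'h::complex_hilbert op set \<Rightarrow> 'h op \<Rightarrow> bool" where
  "self_adjoint_in M a \<longleftrightarrow> a \<in> M \<and> op_adj a = a"

text \<open>The operator order, to be used on self-adjoint operators only (for these the quadratic form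
  is real, hence given by the real inner product).\<close>

definition op_le :: "'h::complex_hilbert op \<Rightarrow> 'h op \<Rightarrow> bool" where
  "op_le a b \<longleftrightarrow> (\<forall>x. inner (blinfun_apply a x) x \<le> inner (blinfun_apply b x) x)"

definition is_op_sup :: "'h::complex_hilbert op set \<Rightarrow> 'h op set \<Rightarrow> 'h op \<Rightarrow> bool" where
  "is_op_sup M D s \<longleftrightarrow> self_adjoint_in M s \<and> (\<forall>d\<in>D. op_le d s) \<and>
     (\<forall>b. self_adjoint_in M b \<and> (\<forall>d\<in>D. op_le d b) \<longrightarrow> op_le s b)"

text \<open>Normality: suprema of bounded upward directed families of self-adjoint elements are
  preserved.\<close>

definition normal_functional :: "'h::complex_hilbert op set \<Rightarrow> ('h op \<Rightarrow> complex) \<Rightarrow> bool" where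
  "normal_functional M \<tau> \<longleftrightarrow>
     (\<forall>D s. D \<noteq> {} \<and> (\<forall>d\<in>D. self_adjoint_in M d) \<and>
        (\<forall>a\<in>D. \<forall>b\<in>D. \<exists>c\<in>D. op_le a c \<and> op_le b c) \<and> is_op_sup M D s \<longrightarrow>
        Re (\<tau> s) = (SUP d\<in>D. Re (\<tau> d)))"

definition tracial_W_space :: "'h::complex_hilbert op set \<Rightarrow> ('h op \<Rightarrow> complex) \<Rightarrow> bool" where
  "tracial_W_space M \<tau> \<longleftrightarrow> von_neumann_algebra M \<and>
     (\<forall>a\<in>M. \<forall>b\<in>M. \<tau> (a + b) = \<tau> a + \<tau> b) \<and>
     (\<forall>c. \<forall>a\<in>M. \<tau> (op_scale c a) = c * \<tau> a) \<and>
     (\<forall>a\<in>M. \<tau> (op_adj a o\<^sub>L a) \<in> \<real>\<^sub>\<ge>\<^sub>0) \<and>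
     \<tau> id_blinfun = 1 \<and>
     (\<forall>a\<in>M. \<forall>b\<in>M. \<tau> (a o\<^sub>L b) = \<tau> (b o\<^sub>L a)) \<and>
     (\<forall>a\<in>M. \<tau> (op_adj a o\<^sub>L a) = 0 \<longrightarrow> a = 0) \<and>
     normal_functional M \<tau>"

text \<open>\<open>(N, \<sigma>)\<close> is an enlargement of \<open>(M, \<tau>)\<close> by means of the trace-preserving unital
  \<open>*\<close>-homomorphism \<open>\<iota>\<close>, which is injective because \<open>\<tau>\<close> is faithful.\<close>

definition enlargement ::
  "'h::complex_hilbert op set \<Rightarrow> ('h op \<Rightarrow> complex) \<Rightarrow>
   'k::complex_hilbert op set \<Rightarrow> ('k op \<Rightarrow> complex) \<Rightarrow> ('h op \<Rightarrow> 'k op) \<Rightarrow> bool" where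
  "enlargement M \<tau> N \<sigma> \<iota> \<longleftrightarrow>
     (\<forall>a\<in>M. \<iota> a \<in> N) \<and>
     (\<forall>a\<in>M. \<forall>b\<in>M. \<iota> (a + b) = \<iota> a + \<iota> b) \<and>
     (\<forall>c. \<forall>a\<in>M. \<iota> (op_scale c a) = op_scale c (\<iota> a)) \<and>
     (\<forall>a\<in>M. \<forall>b\<in>M. \<iota> (a o\<^sub>L b) = \<iota> a o\<^sub>L \<iota> b) \<and>
     (\<forall>a\<in>M. \<iota> (op_adj a) = op_adj (\<iota> a)) \<and>
     \<iota> id_blinfun = id_blinfun \<and>
     (\<forall>a\<in>M. \<sigma> (\<iota> a) = \<tau> a)"

definition has_law :: "('h::complex_hilbert op \<Rightarrow> complex) \<Rightarrow> 'h op \<Rightarrow> real measure \<Rightarrow> bool" where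
  "has_law \<tau> Y \<mu> \<longleftrightarrow> prob_space \<mu> \<and> sets \<mu> = sets borel \<and>
     (\<forall>k. integrable \<mu> (\<lambda>t. t ^ k) \<and>
          \<tau> (op_prod (replicate k Y)) = complex_of_real (\<integral>t. t ^ k \<partial>\<mu>))"

definition law :: "('h::complex_hilbert op \<Rightarrow> complex) \<Rightarrow> 'h op \<Rightarrow> real measure" where
  "law \<tau> Y = (THE \<mu>. has_law \<tau> Y \<mu>)"


section \<open>Non-commutative polynomials\<close>

text \<open>A monomial is a word over the index type \<open>'i\<close>, and a polynomial in the variables \<open>Z\<^sub>i\<close>,
  \<open>i :: 'i\<close>, is a finitely supported family of coefficients of words. The algebraic tensor square
  has the pairs \<open>(u, v)\<close> of words, standing for \<open>u \<otimes> v\<close>, as a basis.\<close>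

type_synonym 'i ncpoly = "'i list \<Rightarrow>\<^sub>0 complex"
type_synonym 'i ncpoly2 = "('i list \<times> 'i list) \<Rightarrow>\<^sub>0 complex"

definition nc_star :: "'i ncpoly \<Rightarrow> 'i ncpoly" where
  "nc_star P = (\<Sum>w\<in>Poly_Mapping.keys P.
     Poly_Mapping.single (rev w) (cnj (Poly_Mapping.lookup P w)))"

definition nc_constant :: "'i ncpoly \<Rightarrow> bool" where
  "nc_constant P \<longleftrightarrow> (\<exists>c. P = Poly_Mapping.single [] c)"

lemma finite_factorizations: "finite {(u, v). w = u @ j # v}"
proof -
  have "{(u, v). w = u @ j # v} \<subseteq> (\<lambda>k. (take k w, drop (Suc k) w)) ` {..length w}"
  proof clarify
    fix u v assume "w = u @ j # v"
    then show "(u, v) \<in> (\<lambda>k. (take k (u @ j # v), drop (Suc k) (u @ j # v))) ` {..length (u @ j # v)}"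
      by (intro image_eqI[where x = "length u"]) auto
  qed
  then show ?thesis
    by (rule finite_subset) simp
qed

definition nc_deriv :: "'i \<Rightarrow> 'i ncpoly \<Rightarrow> 'i ncpoly2" where
  "nc_deriv j P = (\<Sum>w\<in>Poly_Mapping.keys P. \<Sum>(u, v)\<in>{(u, v). w = u @ j # v}.
     Poly_Mapping.single (u, v) (Poly_Mapping.lookup P w))"

definition nc_eval :: "('i \<Rightarrow> 'h::complex_hilbert op) \<Rightarrow> 'i ncpoly \<Rightarrow> 'h op" where
  "nc_eval X P = (\<Sum>w\<in>Poly_Mapping.keys P.
     op_scale (Poly_Mapping.lookup P w) (op_prod (map X w)))"

text \<open>The number \<open>(\<tau> \<otimes> \<tau>)(Q(X))\<close>, that is, the linear extension of
  \<open>u \<otimes> v \<mapsto> \<tau>(u(X)) \<tau>(v(X))\<close>.\<close>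

definition nc_trace2 ::
  "('h::complex_hilbert op \<Rightarrow> complex) \<Rightarrow> ('i \<Rightarrow> 'h op) \<Rightarrow> 'i ncpoly2 \<Rightarrow> complex" where
  "nc_trace2 \<tau> X Q = (\<Sum>(u, v)\<in>Poly_Mapping.keys Q.
     Poly_Mapping.lookup Q (u, v) * \<tau> (op_prod (map X u)) * \<tau> (op_prod (map X v)))"


section \<open>The space \<open>L\<^sup>2\<close> and free Fisher information\<close>

definition norm2 :: "('h::complex_hilbert op \<Rightarrow> complex) \<Rightarrow> 'h op \<Rightarrow> real" where
  "norm2 \<tau> a = sqrt (Re (\<tau> (a o\<^sub>L op_adj a)))"

text \<open>\<open>L\<^sup>2(M, \<tau>)\<close> is the metric completion of \<open>M\<close>, so its elements are represented by
  sequences in \<open>M\<close> that are Cauchy for the 2-norm; the elements of the closure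
  \<open>L\<^sup>2(X\<^sub>1, \<dots>, X\<^sub>n, \<tau>)\<close> are those represented by Cauchy sequences in the range of \<open>nc_eval X\<close>.
  The norm and the pairing \<open>\<tau>(\<xi> a) = \<langle>\<xi>, a\<^sup>*\<rangle>\<close> extend by continuity, and do not depend on the
  representing sequence.\<close>

definition Cauchy2 :: "('h::complex_hilbert op \<Rightarrow> complex) \<Rightarrow> (nat \<Rightarrow> 'h op) \<Rightarrow> bool" where
  "Cauchy2 \<tau> \<xi> \<longleftrightarrow> (\<forall>e>0. \<exists>K. \<forall>k\<ge>K. \<forall>l\<ge>K. norm2 \<tau> (\<xi> k - \<xi> l) < e)"

definition L2_generated ::
  "('h::complex_hilbert op \<Rightarrow> complex) \<Rightarrow> ('i \<Rightarrow> 'h op) \<Rightarrow> (nat \<Rightarrow> 'h op) set" where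
  "L2_generated \<tau> X = {\<xi>. range \<xi> \<subseteq> range (nc_eval X) \<and> Cauchy2 \<tau> \<xi>}"

definition L2_norm :: "('h::complex_hilbert op \<Rightarrow> complex) \<Rightarrow> (nat \<Rightarrow> 'h op) \<Rightarrow> real" where
  "L2_norm \<tau> \<xi> = lim (\<lambda>k. norm2 \<tau> (\<xi> k))"

definition L2_trace ::
  "('h::complex_hilbert op \<Rightarrow> complex) \<Rightarrow> (nat \<Rightarrow> 'h op) \<Rightarrow> 'h op \<Rightarrow> complex" where
  "L2_trace \<tau> \<xi> a = lim (\<lambda>k. \<tau> (\<xi> k o\<^sub>L a))"

definition conjugate_system ::
  "('h::complex_hilbert op \<Rightarrow> complex) \<Rightarrow> ('i::finite \<Rightarrow> 'h op) \<Rightarrow> ('i \<Rightarrow> nat \<Rightarrow> 'h op) \<Rightarrow> bool" where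
  "conjugate_system \<tau> X \<xi> \<longleftrightarrow>
     (\<forall>j. \<xi> j \<in> L2_generated \<tau> X) \<and>
     (\<forall>P j. nc_trace2 \<tau> X (nc_deriv j P) = L2_trace \<tau> (\<xi> j) (nc_eval X P))"

text \<open>A conjugate system is unique as a tuple in \<open>L\<^sup>2\<close>, so the value does not depend on the choice
  of representatives.\<close>

definition free_Fisher ::
  "('h::complex_hilbert op \<Rightarrow> complex) \<Rightarrow> ('i::finite \<Rightarrow> 'h op) \<Rightarrow> ereal" where
  "free_Fisher \<tau> X =
     (if \<exists>\<xi>. conjugate_system \<tau> X \<xi>
      then ereal (\<Sum>j\<in>UNIV. (L2_norm \<tau> ((SOME \<xi>. conjugate_system \<tau> X \<xi>) j))\<^sup>2)
      else \<infinity>)"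


section \<open>Freeness and semicircular elements\<close>

inductive_set unital_algebra :: "'h::complex_hilbert op set \<Rightarrow> 'h op set"
  for G where
    one: "id_blinfun \<in> unital_algebra G"
  | gen: "a \<in> G \<Longrightarrow> a \<in> unital_algebra G"
  | add: "a \<in> unital_algebra G \<Longrightarrow> b \<in> unital_algebra G \<Longrightarrow> a + b \<in> unital_algebra G"
  | scale: "a \<in> unital_algebra G \<Longrightarrow> op_scale c a \<in> unital_algebra G"
  | mult: "a \<in> unital_algebra G \<Longrightarrow> b \<in> unital_algebra G \<Longrightarrow> a o\<^sub>L b \<in> unital_algebra G"

text \<open>Free independence of a family of sets of self-adjoint elements: alternating products of
  centred elements of the generated unital algebras are centred.\<close>

definition freely_independent ::
  "('h::complex_hilbert op \<Rightarrow> complex) \<Rightarrow> ('j \<Rightarrow> 'h op set) \<Rightarrow> bool" where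
  "freely_independent \<tau> A \<longleftrightarrow>
     (\<forall>js as. js \<noteq> [] \<and> length as = length js \<and> distinct_adj js \<and>
        (\<forall>k<length js. as ! k \<in> unital_algebra (A (js ! k)) \<and> \<tau> (as ! k) = 0) \<longrightarrow>
        \<tau> (op_prod as) = 0)"

definition semicircle_law :: "real measure" where
  "semicircle_law = density lborel
     (\<lambda>t. ennreal (indicator {-2..2} t * sqrt (4 - t\<^sup>2) / (2 * pi)))"

definition semicircular ::
  "'h::complex_hilbert op set \<Rightarrow> ('h op \<Rightarrow> complex) \<Rightarrow> 'h op \<Rightarrow> bool" where
  "semicircular M \<tau> S \<longleftrightarrow> self_adjoint_in M S \<and> has_law \<tau> S semicircle_law"

text \<open>The family \<open>{X\<^sub>i | i}, {S\<^sub>1}, \<dots>, {S\<^sub>n}, {S'\<^sub>1}, \<dots>, {S'\<^sub>n}\<close>. Two semicircular families are needed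
  for the free entropy dimension: one perturbs \<open>X\<close> by \<open>\<surd>\<epsilon> S\<close>, the other enters the
  definition of the free entropy of the perturbed tuple, from which it has to be free.\<close>

definition free_semicirculars ::
  "'h::complex_hilbert op set \<Rightarrow> ('h op \<Rightarrow> complex) \<Rightarrow>
   ('i::finite \<Rightarrow> 'h op) \<Rightarrow> ('i \<Rightarrow> 'h op) \<Rightarrow> ('i \<Rightarrow> 'h op) \<Rightarrow> bool" where
  "free_semicirculars M \<tau> X S S' \<longleftrightarrow>
     (\<forall>i. semicircular M \<tau> (S i)) \<and> (\<forall>i. semicircular M \<tau> (S' i)) \<and>
     freely_independent \<tau>
       (case_option (range X) (case_sum (\<lambda>i. {S i}) (\<lambda>i. {S' i})) :: ('i + 'i) option \<Rightarrow> _)"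


section \<open>Free entropy and free entropy dimension\<close>

definition perturb :: "('i \<Rightarrow> 'h::complex_hilbert op) \<Rightarrow> ('i \<Rightarrow> 'h op) \<Rightarrow> real \<Rightarrow> 'i \<Rightarrow> 'h op" where
  "perturb X S t i = X i + sqrt t *\<^sub>R S i"

definition entropy_integrand ::
  "('h::complex_hilbert op \<Rightarrow> complex) \<Rightarrow> ('i::finite \<Rightarrow> 'h op) \<Rightarrow> ('i \<Rightarrow> 'h op) \<Rightarrow> real \<Rightarrow> ereal" where
  "entropy_integrand \<tau> X S t = ereal (real CARD('i) / (1 + t)) - free_Fisher \<tau> (perturb X S t)"

text \<open>\<open>\<chi>\<^sup>*(X)\<close>, computed with the semicircular family \<open>S\<close> (assumed free from \<open>X\<close>). The integral is
  the difference of the integrals of the positive and the negative part, where \<open>e2ennreal\<close>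
  truncates negative values to 0. That of the positive part is finite, so the value lies in
  \<open>[-\<infinity>, \<infinity>)\<close>.\<close>

definition chi_star ::
  "('h::complex_hilbert op \<Rightarrow> complex) \<Rightarrow> ('i::finite \<Rightarrow> 'h op) \<Rightarrow> ('i \<Rightarrow> 'h op) \<Rightarrow> ereal" where
  "chi_star \<tau> X S =
     ereal (1 / 2) *
       (enn2ereal (\<integral>\<^sup>+t\<in>{0<..}. e2ennreal (entropy_integrand \<tau> X S t) \<partial>lborel) -
        enn2ereal (\<integral>\<^sup>+t\<in>{0<..}. e2ennreal (- entropy_integrand \<tau> X S t) \<partial>lborel)) +
     ereal (real CARD('i) / 2 * ln (2 * pi * exp 1))"

definition delta_star ::
  "('h::complex_hilbert op \<Rightarrow> complex) \<Rightarrow>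
   ('i::finite \<Rightarrow> 'h op) \<Rightarrow> ('i \<Rightarrow> 'h op) \<Rightarrow> ('i \<Rightarrow> 'h op) \<Rightarrow> ereal" where
  "delta_star \<tau> X S S' =
     ereal (real CARD('i)) -
     Liminf (at_right 0) (\<lambda>\<epsilon>. chi_star \<tau> (perturb X S \<epsilon>) S' / ereal (ln (sqrt \<epsilon>)))"

end

theory Submission
  imports Defs
begin

text \<open>Suppose first that \<open>X\<close> has a conjugate system \<open>\<xi>\<close>. The Leibniz rule for \<open>\<partial>\<^sub>j (v P w)\<close> together with
  Dabrowski's inequality \<open>\<parallel>(\<tau> \<otimes> id)(\<partial>\<^sub>j b)\<parallel>\<^sub>2 \<le> 2 \<parallel>\<xi>\<^sub>j\<parallel>\<^sub>2 \<parallel>b\<parallel>\<close> bounds the slice of \<open>\<partial>\<^sub>j P\<close> by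
  \<open>v\<close> and \<open>w\<close> by \<open>\<parallel>\<xi>\<^sub>j\<parallel>\<^sub>2\<close> times the sizes of \<open>P w\<close> and \<open>v P\<close>. So if \<open>P(X)\<close> has a kernel, then so
  has the slice \<open>(\<tau>(v \<cdot>) \<otimes> id)(\<partial>\<^sub>j P)\<close>, of smaller degree, where \<open>v\<close> is the projection onto the kernel
  of \<open>P(X)*\<close>; its leading coefficient is that of \<open>P\<close> multiplied by \<open>\<tau>(v) > 0\<close>. After finitely many steps
  a non-zero constant would have a kernel.

  Full free entropy dimension provides \<open>X' = X + \<surd>\<epsilon> S + \<surd>t S'\<close> with \<open>\<epsilon> + t \<rightarrow> 0\<close> and
  \<open>(\<epsilon> + t) \<Phi>\<^sup>*(X') \<rightarrow> 0\<close>. As \<open>\<parallel>X' - X\<parallel> = O(\<surd>(\<epsilon> + t))\<close>, the argument applies to \<open>X'\<close> in the limit,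
  with kernel projections replaced by \<open>u = (1 - T* T / c)\<^sup>k\<close> and \<open>v = (1 - T T* / c)\<^bsup>2k\<^esup>\<close>, where
  \<open>T = P(X')\<close> and \<open>k\<close> is of order \<open>1 / (\<epsilon> + t)\<close>. These are polynomials in \<open>X'\<close>, and their traces are
  related by the trace property alone, so that neither polar decompositions nor conditional
  expectations are needed.\<close>

section \<open>Adjoints\<close>

\<comment> \<open>The conjugate variables of X' may blow up as X' approaches X. Full dimension only
  says that one scale s, of order sqrt (epsilon + t), bounds \<open>norm (X' i - X i)\<close> while
  \<open>\<Xi> * s\<close> tends to 0. Moving an approximate kernel vector from X to X' costs O(s),
  so \<open>T\<close> is small on it only up to O(s). The exponent k is as large as this error
  permits if \<open>B ^ k\<close> is to keep a fixed mass, and at that size the 2-norm of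
  \<open>T * B ^ k\<close> is again O(s). The slice bound multiplies this by \<open>\<Xi>\<close>,
  and the product vanishes in the limit. That bound controls a scalar pairing only, so one argument
  of the pairing is chosen to turn it into the squared 2-norm of the sliced polynomial times
  \<open>B ^ k\<close>. No limit of polynomials is taken: degree, coefficient sum and leading
  coefficient stay bounded, uniformly in the precision, through every slice. As \<open>law\<close>
  is a definite description, the distribution must also be constructed and shown unique: by the
  Hausdorff moment problem and by characteristic functions.\<close>
subclass (in complex_hilbert) banach ..

text \<open>The representing vector minimises \<open>g x = (norm x)\<^sup>2 - 2 * f x\<close>. The
  parallelogram law makes a minimising sequence Cauchy, and perturbing the minimiser along
  \<open>v\<close> forces \<open>f v = inner v z\<close>.\<close>

lemma riesz_representation:
  fixes f :: "'a::{real_inner, complete_space} \<Rightarrow> real"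
  assumes f: "bounded_linear f"
  shows "\<exists>z. \<forall>x. f x = inner x z"
proof -
  interpret f: bounded_linear f by fact
  obtain K where K: "\<And>x. norm (f x) \<le> norm x * K" using f.nonneg_bounded by blast
  define g where "g x = (norm x)\<^sup>2 - 2 * f x" for x
  have gb: "g x \<ge> - K\<^sup>2" for x
  proof -
    have "2 * f x \<le> 2 * (norm x * K)" using K[of x] by (simp add: abs_le_iff)
    also have "\<dots> \<le> (norm x)\<^sup>2 + K\<^sup>2"
      using sum_squares_bound[of "norm x" K] by (simp add: mult.assoc)
    finally show ?thesis by (simp add: g_def)
  qed
  have bdd: "bdd_below (range g)" using gb by (intro bdd_belowI[of _ "- K\<^sup>2"]) auto
  define m where "m = Inf (range g)"
  have m_le: "m \<le> g x" for x unfolding m_def by (rule cInf_lower) (auto simp: bdd)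
  have "\<exists>x. g x < m + 1 / real (Suc n)" for n
  proof -
    have "Inf (range g) < m + 1 / real (Suc n)" by (simp add: m_def)
    then show ?thesis using cInf_lessD[of "range g"] by auto
  qed
  then obtain x where x: "\<And>n. g (x n) < m + 1 / real (Suc n)" by metis
  have par: "(norm (u - v))\<^sup>2 \<le> 2 * g u + 2 * g v - 4 * m" for u v
  proof -
    have "(norm (u - v))\<^sup>2 = 2 * g u + 2 * g v - 4 * g ((1/2) *\<^sub>R (u + v))"
      by (simp add: g_def f.scaleR f.add power2_norm_eq_inner inner_simps algebra_simps inner_commute)
    then show ?thesis using m_le[of "(1/2) *\<^sub>R (u + v)"] by simp
  qed
  have "Cauchy x"
  proof (rule metric_CauchyI)
    fix e :: real assume e: "e > 0"
    obtain M where M: "4 / e\<^sup>2 < real M" using reals_Archimedean2 by blast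
    have "dist (x i) (x j) < e" if ij: "i \<ge> M" "j \<ge> M" for i j
    proof -
      have M0: "real (Suc M) > 4 / e\<^sup>2" using M by simp
      have "1 / real (Suc i) \<le> 1 / real (Suc M)" "1 / real (Suc j) \<le> 1 / real (Suc M)"
        using ij by (simp_all add: frac_le)
      then have "(norm (x i - x j))\<^sup>2 < 4 / real (Suc M)"
        using par[of "x i" "x j"] x[of i] x[of j] by linarith
      also have "\<dots> < e\<^sup>2" using M0 e by (simp add: field_simps)
      finally show ?thesis using e by (simp add: dist_norm power_less_imp_less_base)
    qed
    then show "\<exists>M. \<forall>m\<ge>M. \<forall>n\<ge>M. dist (x m) (x n) < e" by blast
  qed
  then obtain z where z: "x \<longlonglongrightarrow> z" using Cauchy_convergent convergent_def by blast
  have "(\<lambda>n. g (x n)) \<longlonglongrightarrow> g z"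
    unfolding g_def by (intro tendsto_intros z f.tendsto)
  moreover have "(\<lambda>n. m + 1 / real (Suc n)) \<longlonglongrightarrow> m + 0"
    by (intro tendsto_intros LIMSEQ_Suc[OF lim_1_over_n])
  ultimately have gz: "g z \<le> m"
    using LIMSEQ_le[of "\<lambda>n. g (x n)" "g z" "\<lambda>n. m + 1 / real (Suc n)" m] x less_imp_le by auto
  have "f v = inner v z" for v
  proof -
    define d where "d = inner v z - f v"
    define V where "V = (norm v)\<^sup>2"
    have V: "V \<ge> 0" by (simp add: V_def)
    \<comment> \<open>The optimal step would be \<open>d / V\<close>; adding 1 avoids division by 0
      and still changes \<open>g\<close> by \<open>- q\<^sup>2 * (V + 2)\<close>.\<close>
    define q where "q = d / (V + 1)"
    have d: "d = q * (V + 1)" using V by (simp add: q_def)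
    have "g (z + (- q) *\<^sub>R v) = g z + q\<^sup>2 * V - 2 * q * d"
      unfolding g_def d_def V_def power2_norm_eq_inner
      by (simp add: f.diff f.scaleR inner_simps algebra_simps power2_eq_square[of q] inner_commute)
    then have "q\<^sup>2 * V - 2 * q * d \<ge> 0" using gz m_le[of "z + (- q) *\<^sub>R v"] by simp
    then have "q\<^sup>2 * (V + 2) \<le> 0" by (simp add: d algebra_simps power2_eq_square)
    then have "d = 0" using V by (simp add: mult_le_0_iff d)
    then show ?thesis by (simp add: d_def)
  qed
  then show ?thesis by blast
qed

lemma cinner_add_right: "cinner x (y + z) = cinner x y + cinner x z"
  by (metis cinner_add_left cinner_commute complex_cnj_add)

lemma cinner_scaleC_right: "cinner x (c *\<^sub>C y) = cnj c * cinner x y"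
  by (metis cinner_commute cinner_scaleC_left complex_cnj_mult)

lemma inner_minus_i: "inner ((- \<i>) *\<^sub>C x) y = Im (cinner x y)"
  by (simp add: inner_eq_Re_cinner cinner_scaleC_left)

text \<open>The imaginary part of \<open>cinner\<close> is a real inner product with
  \<open>(- \<i>) *\<^sub>C x\<close>, so complex linearity of \<open>f\<close> upgrades a real
  adjoint relation. In this way the real Riesz theorem yields complex adjoints.\<close>

lemma cinner_eqI:
  assumes "\<And>x y. inner (f x) y = inner x (g y)" "\<And>c x. f (c *\<^sub>C x) = c *\<^sub>C f x"
  shows "cinner (f x) y = cinner x (g y)"
proof (rule complex_eqI)
  show "Re (cinner (f x) y) = Re (cinner x (g y))"
    using assms(1) by (simp add: inner_eq_Re_cinner)
  have "Im (cinner (f x) y) = inner (f ((- \<i>) *\<^sub>C x)) y"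
    by (simp only: inner_minus_i[symmetric] assms(2))
  also have "\<dots> = Im (cinner x (g y))" by (simp only: assms(1) inner_minus_i)
  finally show "Im (cinner (f x) y) = Im (cinner x (g y))" .
qed

lemma cinner_right_unique:
  assumes "\<And>x. cinner x y = cinner x z"
  shows "y = z"
proof -
  have "inner (y - z) (y - z) = 0"
    using assms[of "y - z"] by (simp only: inner_diff_right) (simp add: inner_eq_Re_cinner)
  then show ?thesis by simp
qed

lemma bounded_opsD: "T \<in> bounded_ops \<Longrightarrow> blinfun_apply T (c *\<^sub>C x) = c *\<^sub>C blinfun_apply T x"
  by (simp add: bounded_ops_def)

lemma op_adj_ex:
  assumes T: "T \<in> bounded_ops"
  shows "\<exists>S. \<forall>x y. cinner (blinfun_apply T x) y = cinner x (blinfun_apply S y)"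
proof -
  have "\<exists>z. \<forall>x. inner (blinfun_apply T x) y = inner x z" for y
  proof (rule riesz_representation)
    show "bounded_linear (\<lambda>x. inner (blinfun_apply T x) y)"
      by (rule bounded_linear_compose[OF bounded_linear_inner_left blinfun.bounded_linear_right])
  qed
  then obtain s where s: "\<And>x y. inner (blinfun_apply T x) y = inner x (s y)" by metis
  have uniq: "u = v" if "\<And>x. inner x u = inner x v" for u v :: 'a
    using that[of "u - v"] by (metis inner_diff_right inner_eq_zero_iff right_minus_eq)
  have "bounded_linear s"
  proof (rule bounded_linear_intro[where K = "norm T"])
    show "s (x + y) = s x + s y" for x y
      by (rule uniq) (simp add: s[symmetric] inner_add_right)
    show "s (r *\<^sub>R x) = r *\<^sub>R s x" for r x
      by (rule uniq) (simp add: s[symmetric])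
    show "norm (s y) \<le> norm y * norm T" for y
    proof -
      have "norm (s y) * norm (s y) = inner (blinfun_apply T (s y)) y"
        by (simp add: s power2_norm_eq_inner[symmetric] power2_eq_square)
      also have "\<dots> \<le> norm (blinfun_apply T (s y)) * norm y" by (rule norm_cauchy_schwarz)
      also have "\<dots> \<le> norm T * norm (s y) * norm y"
        by (intro mult_right_mono norm_blinfun) auto
      finally have "norm (s y) * norm (s y) \<le> norm (s y) * (norm y * norm T)" by (simp add: ac_simps)
      then show ?thesis by (cases "norm (s y) = 0") auto
    qed
  qed
  then have S: "blinfun_apply (Blinfun s) = s" by (rule bounded_linear_Blinfun_apply)
  have "cinner (blinfun_apply T x) y = cinner x (s y)" for x y
    by (rule cinner_eqI) (simp_all add: s bounded_opsD[OF T])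
  then show ?thesis by (intro exI[of _ "Blinfun s"]) (simp add: S)
qed

lemma op_adj_unique:
  assumes "\<And>x y. cinner (blinfun_apply T x) y = cinner x (blinfun_apply S y)"
  shows "op_adj T = S"
  unfolding op_adj_def
proof (rule the_equality)
  fix S' assume S': "\<forall>x y. cinner (blinfun_apply T x) y = cinner x (blinfun_apply S' y)"
  show "S' = S"
    by (rule blinfun_eqI, rule cinner_right_unique) (metis S' assms)
qed (use assms in auto)

lemma cinner_op_adj:
  assumes "T \<in> bounded_ops"
  shows "cinner (blinfun_apply T x) y = cinner x (blinfun_apply (op_adj T) y)"
  using op_adj_ex[OF assms] op_adj_unique by metis

lemma cinner_op_adj':
  assumes "T \<in> bounded_ops"
  shows "cinner (blinfun_apply (op_adj T) x) y = cinner x (blinfun_apply T y)"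
  by (metis assms cinner_commute cinner_op_adj)

lemma op_adj_op_adj: "T \<in> bounded_ops \<Longrightarrow> op_adj (op_adj T) = T"
  by (rule op_adj_unique) (rule cinner_op_adj')

lemma op_adj_bounded_ops:
  assumes T: "T \<in> bounded_ops"
  shows "op_adj T \<in> bounded_ops"
proof -
  have "blinfun_apply (op_adj T) (c *\<^sub>C x) = c *\<^sub>C blinfun_apply (op_adj T) x" for c x
    by (rule cinner_right_unique) (simp add: cinner_op_adj[OF T, symmetric] cinner_scaleC_right)
  then show ?thesis by (simp add: bounded_ops_def)
qed

lemma op_adj_add: "S \<in> bounded_ops \<Longrightarrow> T \<in> bounded_ops \<Longrightarrow> op_adj (S + T) = op_adj S + op_adj T"
  by (rule op_adj_unique)
    (simp add: blinfun.add_left cinner_add_left cinner_add_right cinner_op_adj)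

lemma op_adj_compose:
  "S \<in> bounded_ops \<Longrightarrow> T \<in> bounded_ops \<Longrightarrow> op_adj (S o\<^sub>L T) = op_adj T o\<^sub>L op_adj S"
  by (rule op_adj_unique) (simp add: cinner_op_adj)

lemma op_adj_scale: "T \<in> bounded_ops \<Longrightarrow> op_adj (op_scale c T) = op_scale (cnj c) (op_adj T)"
  by (rule op_adj_unique) (simp add: cinner_op_adj cinner_scaleC_left cinner_scaleC_right)

lemma op_adj_id: "op_adj id_blinfun = id_blinfun"
  by (rule op_adj_unique) simp

lemma norm_op_adj_le:
  assumes T: "T \<in> bounded_ops"
  shows "norm (op_adj T) \<le> norm T"
proof (rule norm_blinfun_bound)
  fix y
  let ?s = "blinfun_apply (op_adj T) y"
  have "norm ?s * norm ?s = inner ?s ?s" by (simp only: power2_norm_eq_inner[symmetric] power2_eq_square)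
  also have "\<dots> = inner (blinfun_apply T ?s) y" by (simp only: inner_eq_Re_cinner cinner_op_adj[OF T])
  also have "\<dots> \<le> norm (blinfun_apply T ?s) * norm y" by (rule norm_cauchy_schwarz)
  also have "\<dots> \<le> norm T * norm ?s * norm y"
    by (intro mult_right_mono norm_blinfun) auto
  finally have "norm ?s * norm ?s \<le> norm ?s * (norm T * norm y)" by (simp add: ac_simps)
  then show "norm ?s \<le> norm T * norm y" by (cases "norm ?s = 0") auto
qed simp

lemma norm_op_adj: "T \<in> bounded_ops \<Longrightarrow> norm (op_adj T) = norm T"
  by (metis norm_op_adj_le op_adj_bounded_ops op_adj_op_adj order_antisym)

lemma norm_scaleC: "norm (c *\<^sub>C (x::'a::complex_hilbert)) = cmod c * norm x"
proof -
  have "cinner (c *\<^sub>C x) (c *\<^sub>C x) = complex_of_real ((cmod c)\<^sup>2) * cinner x x"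
    using complex_norm_square[of c] by (simp add: cinner_scaleC_left cinner_scaleC_right)
  then have "inner (c *\<^sub>C x) (c *\<^sub>C x) = (cmod c)\<^sup>2 * inner x x"
    by (simp add: inner_eq_Re_cinner)
  then show ?thesis by (simp add: norm_eq_sqrt_inner real_sqrt_mult)
qed

lemma norm_op_scale_le: "norm (op_scale c T) \<le> cmod c * norm T"
  by (rule norm_blinfun_bound)
    (auto simp: norm_scaleC mult.assoc intro!: mult_left_mono norm_blinfun)

lemma scaleR_eq_op_scale: "r *\<^sub>R T = op_scale (of_real r) T"
  by (rule blinfun_eqI) (simp add: blinfun.scaleR_left scaleR_scaleC)

lemma op_scale_add_left: "op_scale (a + b) T = op_scale a T + op_scale b T"
  by (rule blinfun_eqI) (simp add: blinfun.add_left scaleC_add_left)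

lemma op_scale_add_right: "op_scale a (S + T) = op_scale a S + op_scale a T"
  by (rule blinfun_eqI) (simp add: blinfun.add_left scaleC_add_right)

lemma op_scale_op_scale: "op_scale a (op_scale b T) = op_scale (a * b) T"
  by (rule blinfun_eqI) (simp add: scaleC_scaleC)

lemma op_scale_one [simp]: "op_scale 1 T = T"
  by (metis of_real_1 scaleR_eq_op_scale scaleR_one)

lemma op_scale_zero [simp]: "op_scale 0 T = 0"
  by (metis of_real_0 scaleR_eq_op_scale scaleR_zero_left)

lemma op_scale_compose_left: "op_scale c S o\<^sub>L T = op_scale c (S o\<^sub>L T)"
  by (rule blinfun_eqI) simp

lemma op_scale_compose_right: "S \<in> bounded_ops \<Longrightarrow> S o\<^sub>L op_scale c T = op_scale c (S o\<^sub>L T)"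
  by (rule blinfun_eqI) (simp add: bounded_opsD)

lemma compose_id [simp]: "S o\<^sub>L id_blinfun = S" "id_blinfun o\<^sub>L S = S"
  by (auto intro: blinfun_eqI)

lemma compose_assoc: "(R o\<^sub>L S) o\<^sub>L T = R o\<^sub>L (S o\<^sub>L T)"
  by (rule blinfun_eqI) simp

lemmas compose_distribs =
  bounded_bilinear.add_left[OF bounded_bilinear_blinfun_compose]
  bounded_bilinear.add_right[OF bounded_bilinear_blinfun_compose]
  bounded_bilinear.diff_left[OF bounded_bilinear_blinfun_compose]
  bounded_bilinear.diff_right[OF bounded_bilinear_blinfun_compose]
  bounded_bilinear.minus_left[OF bounded_bilinear_blinfun_compose]
  bounded_bilinear.minus_right[OF bounded_bilinear_blinfun_compose]

lemma bounded_ops_intros: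
  "id_blinfun \<in> bounded_ops" "0 \<in> bounded_ops"
  "S \<in> bounded_ops \<Longrightarrow> T \<in> bounded_ops \<Longrightarrow> S + T \<in> bounded_ops"
  "S \<in> bounded_ops \<Longrightarrow> op_scale c S \<in> bounded_ops"
  "S \<in> bounded_ops \<Longrightarrow> T \<in> bounded_ops \<Longrightarrow> S o\<^sub>L T \<in> bounded_ops"
  using op_scale_apply[of 0 "0::'a op"]
  by (auto simp: bounded_ops_def blinfun.add_left scaleC_add_right scaleC_scaleC mult.commute
      norm_scaleC simp flip: norm_eq_zero simp del: norm_eq_zero)

text \<open>The closedness results from here on make the invariant ball in
  \<open>sqrt_one_minus\<close> complete, as Banach's fixed point theorem requires.\<close>

lemma closed_commuting: "closed {T. T o\<^sub>L S = S o\<^sub>L T}"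
proof -
  have "continuous_on UNIV (\<lambda>T. T o\<^sub>L S)" "continuous_on UNIV (\<lambda>T. S o\<^sub>L T)"
    by (intro continuous_intros bounded_linear.continuous_on[OF bounded_bilinear.bounded_linear_left[OF bounded_bilinear_blinfun_compose]]
        bounded_linear.continuous_on[OF bounded_bilinear.bounded_linear_right[OF bounded_bilinear_blinfun_compose]])+
  then show ?thesis by (rule closed_Collect_eq)
qed

lemma bounded_linear_scaleC: "bounded_linear (\<lambda>y::'a::complex_hilbert. c *\<^sub>C y)"
  by (rule bounded_linear_intro[where K = "cmod c"])
      (simp_all add: scaleC_add_right scaleR_scaleC scaleC_scaleC norm_scaleC mult.commute)

lemma closed_bounded_ops: "closed (bounded_ops :: 'h::complex_hilbert op set)"
proof -
  have eq: "bounded_ops = (\<Inter>c. \<Inter>x. {T :: 'h op. blinfun_apply T (c *\<^sub>C x) = c *\<^sub>C blinfun_apply T x})"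
    by (auto simp: bounded_ops_def)
  have cl: "closed {T :: 'h op. blinfun_apply T (c *\<^sub>C x) = c *\<^sub>C blinfun_apply T x}" for c x
    by (intro closed_Collect_eq bounded_linear.continuous_on[OF bounded_linear_scaleC]
        bounded_linear.continuous_on[OF blinfun.bounded_linear_left] continuous_intros)
  show ?thesis unfolding eq by (intro closed_INT ballI cl)
qed

lemma closed_commutant: "closed (commutant A)"
proof -
  have "commutant A = bounded_ops \<inter> (\<Inter>S\<in>A. {T. T o\<^sub>L S = S o\<^sub>L T})"
    by (auto simp: commutant_def)
  then show ?thesis
    by (simp add: closed_Int closed_bounded_ops closed_commuting closed_INT)
qed

lemma closed_self_adjoint: "closed {T \<in> bounded_ops. op_adj T = T}"
proof -
  have eq: "{T \<in> bounded_ops. op_adj T = T} =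
    bounded_ops \<inter> (\<Inter>x. \<Inter>y. {T. inner (blinfun_apply T x) y = inner x (blinfun_apply T y)})"
  proof (intro equalityI subsetI)
    fix T assume "T \<in> {T \<in> bounded_ops. op_adj T = T}"
    then show "T \<in> bounded_ops \<inter> (\<Inter>x. \<Inter>y. {T. inner (blinfun_apply T x) y = inner x (blinfun_apply T y)})"
      using cinner_op_adj[of T] by (auto simp: inner_eq_Re_cinner)
  next
    fix T assume T: "T \<in> bounded_ops \<inter> (\<Inter>x. \<Inter>y. {T. inner (blinfun_apply T x) y = inner x (blinfun_apply T y)})"
    have "op_adj T = T"
      by (rule op_adj_unique, rule cinner_eqI) (use T in \<open>auto simp: bounded_opsD\<close>)
    then show "T \<in> {T \<in> bounded_ops. op_adj T = T}" using T by auto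
  qed
  have cl: "closed {T. inner (blinfun_apply T x) y = inner x (blinfun_apply T y)}" for x y
    by (intro closed_Collect_eq continuous_intros bounded_linear.continuous_on[OF blinfun.bounded_linear_left])
  show ?thesis unfolding eq by (intro closed_Int closed_INT ballI closed_bounded_ops cl)
qed

section \<open>Tracial algebras\<close>

locale tracial =
  fixes N :: "'h::complex_hilbert op set" and \<tau> :: "'h op \<Rightarrow> complex"
  assumes tracial_W: "tracial_W_space N \<tau>"
begin

lemma N_sub: "N \<subseteq> bounded_ops" and N_adj: "a \<in> N \<Longrightarrow> op_adj a \<in> N"
  and N_bicomm: "commutant (commutant N) = N"
  using tracial_W by (auto simp: tracial_W_space_def von_neumann_algebra_def)

lemma N_bounded: "a \<in> N \<Longrightarrow> a \<in> bounded_ops" using N_sub by blast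

lemma N_closed: "closed N" using closed_commutant N_bicomm by metis

lemma N_id: "id_blinfun \<in> N"
  and N_add: "a \<in> N \<Longrightarrow> b \<in> N \<Longrightarrow> a + b \<in> N"
  and N_scale: "a \<in> N \<Longrightarrow> op_scale c a \<in> N"
  and N_mult: "a \<in> N \<Longrightarrow> b \<in> N \<Longrightarrow> a o\<^sub>L b \<in> N"
proof -
  define C where "C = commutant N"
  have C: "C \<subseteq> bounded_ops" by (auto simp: C_def commutant_def)
  have N: "N = commutant C" using N_bicomm by (simp add: C_def)
  show "id_blinfun \<in> N" by (simp add: N commutant_def bounded_ops_intros)
  show "a \<in> N \<Longrightarrow> b \<in> N \<Longrightarrow> a + b \<in> N"
    by (auto simp: N commutant_def bounded_ops_intros compose_distribs)
  show "a \<in> N \<Longrightarrow> op_scale c a \<in> N"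
    using C by (auto simp: N commutant_def bounded_ops_intros op_scale_compose_left op_scale_compose_right)
  show "a \<in> N \<Longrightarrow> b \<in> N \<Longrightarrow> a o\<^sub>L b \<in> N"
    by (auto simp: N commutant_def bounded_ops_intros compose_assoc) (metis compose_assoc)
qed

lemma N_uminus: "a \<in> N \<Longrightarrow> - a \<in> N"
  using N_scale[of a "-1"] scaleR_eq_op_scale[of "-1" a] by simp

lemma N_diff: "a \<in> N \<Longrightarrow> b \<in> N \<Longrightarrow> a - b \<in> N"
  using N_add[OF _ N_uminus, of a b] by simp

lemma N_scaleR: "a \<in> N \<Longrightarrow> r *\<^sub>R a \<in> N"
  by (simp add: scaleR_eq_op_scale N_scale)

lemma N_zero: "0 \<in> N"
  using N_scaleR[OF N_id, of 0] by simp

lemmas N_intros = N_id N_zero N_add N_diff N_uminus N_scale N_scaleR N_mult N_adj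

lemma adj_diff: "a \<in> N \<Longrightarrow> b \<in> N \<Longrightarrow> op_adj (a - b) = op_adj a - op_adj b"
  using op_adj_add[of "a - b" b] by (simp add: N_bounded N_diff)

lemma adj_scaleR: "a \<in> N \<Longrightarrow> op_adj (r *\<^sub>R a) = r *\<^sub>R op_adj a"
  by (simp add: scaleR_eq_op_scale op_adj_scale N_bounded)

lemma adj_mult: "a \<in> N \<Longrightarrow> b \<in> N \<Longrightarrow> op_adj (a o\<^sub>L b) = op_adj b o\<^sub>L op_adj a"
  by (simp add: op_adj_compose N_bounded)

lemma adj_add: "a \<in> N \<Longrightarrow> b \<in> N \<Longrightarrow> op_adj (a + b) = op_adj a + op_adj b"
  by (simp add: op_adj_add N_bounded)

lemma adj_adj: "a \<in> N \<Longrightarrow> op_adj (op_adj a) = a"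
  by (simp add: op_adj_op_adj N_bounded)

lemma norm_adj: "a \<in> N \<Longrightarrow> norm (op_adj a) = norm a"
  by (simp add: norm_op_adj N_bounded)

text \<open>The square root \<open>1 - y\<close> of \<open>1 - x\<close> is found by solving \<open>y = (x + y\<^sup>2) / 2\<close>, a contraction on
  the ball of radius \<open>norm x\<close>.\<close>

lemma sqrt_one_minus:
  assumes x: "x \<in> N" "op_adj x = x" and nx: "norm x < 1"
  shows "\<exists>z\<in>N. op_adj z = z \<and> id_blinfun - x = z o\<^sub>L z"
proof -
  define s where "s = {y \<in> N. op_adj y = y \<and> norm y \<le> norm x}"
  define f where "f y = (1/2) *\<^sub>R (x + (y o\<^sub>L y))" for y
  have "s = N \<inter> {T \<in> bounded_ops. op_adj T = T} \<inter> cball 0 (norm x)"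
    using N_sub by (auto simp: s_def)
  then have "closed s" by (simp add: closed_Int closed_self_adjoint N_closed)
  note cs = complete_eq_closed[THEN iffD2, OF this]
  have ne: "s \<noteq> {}" using x by (auto simp: s_def)
  have maps: "f ` s \<subseteq> s"
  proof
    fix z assume "z \<in> f ` s"
    then obtain y where y: "y \<in> N" "op_adj y = y" "norm y \<le> norm x" and z: "z = f y"
      by (auto simp: s_def)
    have "norm (y o\<^sub>L y) \<le> norm y * norm y" by (rule norm_blinfun_compose)
    also have "\<dots> \<le> norm x * 1" using y nx by (intro mult_mono) auto
    finally have "norm (x + (y o\<^sub>L y)) \<le> 2 * norm x"
      using norm_triangle_ineq[of x "y o\<^sub>L y"] by simp
    then show "z \<in> s"
      using y x by (simp add: s_def z f_def N_intros adj_add adj_scaleR adj_mult)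
  qed
  have contr: "dist (f y) (f z) \<le> norm x * dist y z" if "y \<in> s" "z \<in> s" for y z
  proof -
    have "f y - f z = (1/2) *\<^sub>R ((y o\<^sub>L (y - z)) + ((y - z) o\<^sub>L z))"
      by (simp add: f_def compose_distribs algebra_simps)
    then have "dist (f y) (f z) \<le> (1/2) * (norm (y o\<^sub>L (y - z)) + norm ((y - z) o\<^sub>L z))"
      using norm_triangle_ineq[of "y o\<^sub>L (y - z)" "(y - z) o\<^sub>L z"] by (simp add: dist_norm)
    also have "\<dots> \<le> (1/2) * (norm y * norm (y - z) + norm (y - z) * norm z)"
      by (intro mult_left_mono add_mono norm_blinfun_compose) auto
    also have "\<dots> \<le> (1/2) * (norm x * norm (y - z) + norm (y - z) * norm x)"
      using that by (intro mult_left_mono add_mono mult_right_mono) (auto simp: s_def)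
    finally show ?thesis by (simp add: dist_norm)
  qed
  from Banach_fix[OF cs ne norm_ge_zero nx maps] contr
  obtain y where y: "y \<in> s" "f y = y" by blast
  have "2 *\<^sub>R y = 2 *\<^sub>R f y" by (simp only: y)
  then have y2: "2 *\<^sub>R y = x + (y o\<^sub>L y)" by (simp add: f_def)
  have "id_blinfun - x = (id_blinfun - y) o\<^sub>L (id_blinfun - y)"
    using y2 by (simp add: compose_distribs algebra_simps scaleR_2)
  moreover have "id_blinfun - y \<in> N" "op_adj (id_blinfun - y) = id_blinfun - y"
    using y by (auto simp: s_def N_intros adj_diff op_adj_id)
  ultimately show ?thesis by blast
qed

lemma tau_add: "a \<in> N \<Longrightarrow> b \<in> N \<Longrightarrow> \<tau> (a + b) = \<tau> a + \<tau> b"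
  and tau_scale: "a \<in> N \<Longrightarrow> \<tau> (op_scale c a) = c * \<tau> a"
  and tau_pos: "a \<in> N \<Longrightarrow> \<tau> (op_adj a o\<^sub>L a) \<in> \<real>\<^sub>\<ge>\<^sub>0"
  and tau_id: "\<tau> id_blinfun = 1"
  and tau_comm: "a \<in> N \<Longrightarrow> b \<in> N \<Longrightarrow> \<tau> (a o\<^sub>L b) = \<tau> (b o\<^sub>L a)"
  using tracial_W by (auto simp: tracial_W_space_def)

lemma tau_uminus: "a \<in> N \<Longrightarrow> \<tau> (- a) = - \<tau> a"
  using tau_scale[of a "-1"] scaleR_eq_op_scale[of "-1" a] by simp

lemma tau_diff: "a \<in> N \<Longrightarrow> b \<in> N \<Longrightarrow> \<tau> (a - b) = \<tau> a - \<tau> b"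
  using tau_add[of a "- b"] tau_uminus[of b] by (simp add: N_uminus)

lemma tau_scaleR: "a \<in> N \<Longrightarrow> \<tau> (r *\<^sub>R a) = of_real r * \<tau> a"
  by (simp add: scaleR_eq_op_scale tau_scale)

lemma tau_pos_Re: "a \<in> N \<Longrightarrow> 0 \<le> Re (\<tau> (op_adj a o\<^sub>L a))"
  and tau_pos_Im: "a \<in> N \<Longrightarrow> Im (\<tau> (op_adj a o\<^sub>L a)) = 0"
  using tau_pos[of a] by (auto simp: complex_nonneg_Reals_iff)

text \<open>Polarisation: positivity at \<open>id_blinfun + b\<close> makes
  \<open>\<tau> b + \<tau> (op_adj b)\<close> real, and the choices \<open>b = a\<close> and
  \<open>b = op_scale \<i> a\<close> determine both parts of the value.\<close>

lemma tau_adj: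
  assumes a: "a \<in> N"
  shows "\<tau> (op_adj a) = cnj (\<tau> a)"
proof -
  have *: "Im (\<tau> b + \<tau> (op_adj b)) = 0" if b: "b \<in> N" for b
  proof -
    have "op_adj (id_blinfun + b) o\<^sub>L (id_blinfun + b) =
       ((id_blinfun + b) + op_adj b) + (op_adj b o\<^sub>L b)"
      using b by (simp add: adj_add N_intros op_adj_id compose_distribs algebra_simps)
    then have "\<tau> (op_adj (id_blinfun + b) o\<^sub>L (id_blinfun + b)) =
        1 + \<tau> b + \<tau> (op_adj b) + \<tau> (op_adj b o\<^sub>L b)"
      using b by (simp add: tau_add N_intros tau_id)
    then show ?thesis
      using tau_pos_Im[of "id_blinfun + b"] tau_pos_Im[of b] b by (simp add: N_intros)
  qed
  have "Im (\<tau> a + \<tau> (op_adj a)) = 0" by (rule *[OF a])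
  moreover have "Im (\<i> * \<tau> a - \<i> * \<tau> (op_adj a)) = 0"
    using *[of "op_scale \<i> a"] a by (simp add: N_intros tau_scale op_adj_scale N_bounded)
  ultimately show ?thesis by (simp add: complex_eq_iff)
qed

text \<open>For \<open>r > norm x\<close> the element \<open>id_blinfun - (1/r) *\<^sub>R x\<close>
  is a square \<open>z o\<^sub>L z\<close>, so positivity of the trace at
  \<open>z o\<^sub>L b\<close> gives the bound with \<open>r\<close>; then \<open>r\<close>
  decreases to \<open>norm x\<close>.\<close>

lemma tau_sandwich:
  assumes x: "x \<in> N" "op_adj x = x" and b: "b \<in> N"
  shows "Re (\<tau> (op_adj b o\<^sub>L (x o\<^sub>L b))) \<le> norm x * Re (\<tau> (op_adj b o\<^sub>L b))"
proof -
  have *: "Re (\<tau> (op_adj b o\<^sub>L (x o\<^sub>L b))) \<le> r * Re (\<tau> (op_adj b o\<^sub>L b))" if r: "r > norm x" for r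
  proof -
    have r0: "r > 0" using r norm_ge_zero[of x] by linarith
    obtain z where z: "z \<in> N" "op_adj z = z" "id_blinfun - (1/r) *\<^sub>R x = z o\<^sub>L z"
      using sqrt_one_minus[of "(1/r) *\<^sub>R x"] x r r0 by (auto simp: N_intros adj_scaleR field_simps)
    have "op_adj (z o\<^sub>L b) o\<^sub>L (z o\<^sub>L b) = op_adj b o\<^sub>L ((z o\<^sub>L z) o\<^sub>L b)"
      using z b by (simp add: adj_mult compose_assoc)
    also have "\<dots> = (op_adj b o\<^sub>L b) - (1/r) *\<^sub>R (op_adj b o\<^sub>L (x o\<^sub>L b))"
      by (simp add: z(3)[symmetric] compose_distribs blinfun.scaleR_left blinfun.scaleR_right
          bounded_bilinear.scaleR_left[OF bounded_bilinear_blinfun_compose]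
          bounded_bilinear.scaleR_right[OF bounded_bilinear_blinfun_compose])
    finally have "\<tau> (op_adj (z o\<^sub>L b) o\<^sub>L (z o\<^sub>L b)) =
        \<tau> (op_adj b o\<^sub>L b) - of_real (1/r) * \<tau> (op_adj b o\<^sub>L (x o\<^sub>L b))"
      using b x by (simp add: tau_diff tau_scaleR N_intros)
    then have "0 \<le> Re (\<tau> (op_adj b o\<^sub>L b)) - (1/r) * Re (\<tau> (op_adj b o\<^sub>L (x o\<^sub>L b)))"
      using tau_pos_Re[of "z o\<^sub>L b"] z b by (simp add: N_intros)
    then show ?thesis using r0 by (simp add: field_simps)
  qed
  have "((\<lambda>r. r * Re (\<tau> (op_adj b o\<^sub>L b))) \<longlongrightarrow> norm x * Re (\<tau> (op_adj b o\<^sub>L b))) (at_right (norm x))"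
    by (intro tendsto_intros)
  moreover have "eventually (\<lambda>r. Re (\<tau> (op_adj b o\<^sub>L (x o\<^sub>L b))) \<le> r * Re (\<tau> (op_adj b o\<^sub>L b))) (at_right (norm x))"
    using * by (auto simp: eventually_at_right_field intro!: exI[of _ "norm x + 1"])
  ultimately show ?thesis
    by (intro tendsto_lowerbound[of _ _ "at_right (norm x)"]) auto
qed

lemma tau_compose_bound:
  assumes a: "a \<in> N" and b: "b \<in> N"
  shows "Re (\<tau> (op_adj (a o\<^sub>L b) o\<^sub>L (a o\<^sub>L b))) \<le> (norm a)\<^sup>2 * Re (\<tau> (op_adj b o\<^sub>L b))"
proof -
  let ?x = "op_adj a o\<^sub>L a"
  have "Re (\<tau> (op_adj (a o\<^sub>L b) o\<^sub>L (a o\<^sub>L b))) = Re (\<tau> (op_adj b o\<^sub>L (?x o\<^sub>L b)))"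
    using a b by (simp add: adj_mult compose_assoc)
  also have "\<dots> \<le> norm ?x * Re (\<tau> (op_adj b o\<^sub>L b))"
    using a b by (intro tau_sandwich) (auto simp: N_intros adj_mult adj_adj)
  also have "\<dots> \<le> (norm a)\<^sup>2 * Re (\<tau> (op_adj b o\<^sub>L b))"
    using norm_blinfun_compose[of "op_adj a" a] a b
    by (intro mult_right_mono tau_pos_Re) (auto simp: norm_adj power2_eq_square)
  finally show ?thesis .
qed

end

section \<open>The algebra of non-commutative polynomials\<close>

text \<open>Concatenation makes the words a monoid, and thereby the polynomials a ring with the
  convolution product.\<close>

instantiation list :: (type) monoid_add
begin

definition zero_list :: "'a list" where "0 = []"

definition plus_list :: "'a list \<Rightarrow> 'a list \<Rightarrow> 'a list" where "u + v = u @ v"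

instance by standard (simp_all add: zero_list_def plus_list_def)

end

abbreviation single :: "'a \<Rightarrow> 'b::zero \<Rightarrow> 'a \<Rightarrow>\<^sub>0 'b" where
  "single \<equiv> Poly_Mapping.single"

abbreviation lookup :: "('a \<Rightarrow>\<^sub>0 'b::zero) \<Rightarrow> 'a \<Rightarrow> 'b" where
  "lookup \<equiv> Poly_Mapping.lookup"

abbreviation keys :: "('a \<Rightarrow>\<^sub>0 'b::zero) \<Rightarrow> 'a set" where
  "keys \<equiv> Poly_Mapping.keys"

abbreviation word :: "'i list \<Rightarrow> 'i ncpoly" where
  "word w \<equiv> single w 1"

definition cst :: "complex \<Rightarrow> 'i ncpoly" where
  "cst c = single [] c"

lemma poly_mapping_induct [case_names single add]:
  fixes P :: "'a \<Rightarrow>\<^sub>0 'b::comm_monoid_add"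
  assumes s: "\<And>w c. Q (single w c)" and a: "\<And>P P'. Q P \<Longrightarrow> Q P' \<Longrightarrow> Q (P + P')"
  shows "Q P"
proof -
  have z: "Q 0" using s[of undefined 0] by simp
  have "P = (\<Sum>k\<in>keys P. single k (lookup P k))"
    by (rule poly_mapping_eqI)
      (auto simp: lookup_sum lookup_single when_def sum.delta in_keys_iff)
  moreover have "Q (\<Sum>k\<in>K. single k (lookup P k))" if "finite K" for K
    using that by (induction K rule: finite_induct) (auto intro: s a z)
  ultimately show ?thesis by (metis finite_keys)
qed

text \<open>Cancellation can make the keys of \<open>P + Q\<close> smaller than the union of the
  keys; as \<open>h k 0 = 0\<close>, all three sums may run over the union.\<close>

lemma sum_keys_add:
  assumes "\<And>k. h k 0 = 0" "\<And>k a b. h k (a + b) = h k a + h k b"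
  shows "(\<Sum>k\<in>keys (P + Q). h k (lookup (P + Q) k)) =
    (\<Sum>k\<in>keys P. h k (lookup P k)) +
    (\<Sum>k\<in>keys Q. h k (lookup Q k))"
proof -
  let ?K = "keys P \<union> keys Q"
  have e: "(\<Sum>k\<in>keys R. h k (lookup R k)) = (\<Sum>k\<in>?K. h k (lookup R k))"
    if "keys R \<subseteq> ?K" for R
    using that by (intro sum.mono_neutral_left) (auto simp: in_keys_iff assms)
  show ?thesis
    by (simp only: e[OF Poly_Mapping.keys_add] e[OF Un_upper1] e[OF Un_upper2])
      (simp add: lookup_add assms sum.distrib)
qed

lemma sum_keys_single:
  assumes "h k 0 = 0"
  shows "(\<Sum>l\<in>keys (single k c). h l (lookup (single k c) l)) = h k c"
  by (cases "c = 0") (simp_all add: assms)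

lemma single_times: "single v a * single w b = single (v @ w) (a * b)"
  for v w :: "'i list"
  by (simp add: mult_single plus_list_def)

lemma cst_commute: "cst c * P = P * cst c"
  by (induction P rule: poly_mapping_induct)
    (simp_all add: cst_def single_times mult.commute algebra_simps)

lemma word_Nil: "word [] = 1"
  using single_one[where ?'a = "'a list"] by (simp only: zero_list_def)

lemma cst_mult: "cst a * cst b = cst (a * b)"
  and cst_add: "cst (a + b) = cst a + cst b"
  and cst_minus: "cst (- a) = - cst a"
  and cst_1: "cst 1 = 1"
  and cst_0: "cst 0 = 0"
  by (simp_all add: cst_def single_times single_add single_uminus word_Nil)

lemma single_eq_cst_word: "single w c = cst c * word w"
  by (simp add: cst_def single_times)

lemma word_mult: "word u * word v = word (u @ v)"
  by (simp add: single_times)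

lemma lookup_cst_mult: "lookup (cst c * P) w = c * lookup P w"
  by (induction P rule: poly_mapping_induct)
    (auto simp: cst_def single_times lookup_single when_def lookup_add algebra_simps)

lemma nc_star_add: "nc_star (P + Q) = nc_star P + nc_star Q"
  unfolding nc_star_def
  by (rule sum_keys_add[where h = "\<lambda>w c. single (rev w) (cnj c)"]) (simp_all add: single_add)

lemma nc_star_single: "nc_star (single w c) = single (rev w) (cnj c)"
  unfolding nc_star_def
  by (rule sum_keys_single[where h = "\<lambda>w c. single (rev w) (cnj c)"]) simp

lemma nc_star_star [simp]: "nc_star (nc_star P) = P"
  by (induction P rule: poly_mapping_induct) (simp_all add: nc_star_add nc_star_single)

lemma nc_star_mult: "nc_star (P * Q) = nc_star Q * nc_star P"
proof (induction P rule: poly_mapping_induct)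
  case (single v a)
  show ?case
    by (induction Q rule: poly_mapping_induct)
      (simp_all add: nc_star_add nc_star_single single_times distrib_left distrib_right mult.commute)
next
  case (add P P')
  then show ?case by (simp add: nc_star_add distrib_left distrib_right)
qed

lemma nc_star_cst: "nc_star (cst c) = cst (cnj c)"
  by (simp add: cst_def nc_star_single)

lemma nc_star_1 [simp]: "nc_star 1 = 1"
  using nc_star_cst[of 1] by (simp add: cst_1)

lemma nc_star_0 [simp]: "nc_star 0 = 0"
  using nc_star_cst[of 0] by (simp add: cst_0)

lemma nc_star_minus: "nc_star (- P) = - nc_star P"
  using nc_star_add[of P "- P"] by (simp add: eq_neg_iff_add_eq_0 add.commute)

lemma nc_star_diff: "nc_star (P - Q) = nc_star P - nc_star Q"
  using nc_star_add[of P "- Q"] by (simp add: nc_star_minus)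

lemma nc_star_power: "nc_star (P ^ k) = nc_star P ^ k"
  by (induction k) (simp_all add: nc_star_mult power_commutes)

lemma nc_eval_add: "nc_eval X (P + Q) = nc_eval X P + nc_eval X Q"
  unfolding nc_eval_def
  by (rule sum_keys_add[where h = "\<lambda>w c. op_scale c (op_prod (map X w))"]) (simp_all add: op_scale_add_left)

lemma nc_eval_single: "nc_eval X (single w c) = op_scale c (op_prod (map X w))"
  unfolding nc_eval_def
  by (rule sum_keys_single[where h = "\<lambda>w c. op_scale c (op_prod (map X w))"]) simp

lemma op_prod_Nil: "op_prod [] = id_blinfun"
  and op_prod_Cons: "op_prod (a # as) = a o\<^sub>L op_prod as"
  by (simp_all add: op_prod_def)

lemma op_prod_append: "op_prod (as @ bs) = op_prod as o\<^sub>L op_prod bs"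
  by (induction as) (simp_all add: op_prod_Nil op_prod_Cons compose_assoc)

lemma op_prod_bounded_ops: "set as \<subseteq> bounded_ops \<Longrightarrow> op_prod as \<in> bounded_ops"
  by (induction as) (simp_all add: op_prod_Nil op_prod_Cons bounded_ops_intros)

lemma nc_eval_mult:
  assumes "\<And>i. X i \<in> bounded_ops"
  shows "nc_eval X (P * Q) = nc_eval X P o\<^sub>L nc_eval X Q"
proof (induction P rule: poly_mapping_induct)
  case (single v a)
  have b: "op_prod (map X w) \<in> bounded_ops" for w
    by (rule op_prod_bounded_ops) (use assms in auto)
  show ?case
    by (induction Q rule: poly_mapping_induct)
      (simp_all add: nc_eval_add nc_eval_single single_times distrib_left compose_distribs
        op_prod_append op_scale_compose_left op_scale_compose_right b op_scale_op_scale)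
next
  case (add P P')
  then show ?case by (simp add: nc_eval_add distrib_right compose_distribs)
qed

lemma nc_eval_1 [simp]: "nc_eval X 1 = id_blinfun"
  using nc_eval_single[of X "[]" 1] by (simp add: op_prod_Nil word_Nil)

lemma nc_eval_cst: "nc_eval X (cst c) = op_scale c id_blinfun"
  by (simp add: cst_def nc_eval_single op_prod_Nil)

lemma nc_eval_0 [simp]: "nc_eval X 0 = 0"
  by (simp add: nc_eval_def)

lemma nc_eval_minus: "nc_eval X (- P) = - nc_eval X P"
  using nc_eval_add[of X P "- P"] by (simp add: eq_neg_iff_add_eq_0 add.commute)

lemma nc_eval_diff: "nc_eval X (P - Q) = nc_eval X P - nc_eval X Q"
  using nc_eval_add[of X P "- Q"] by (simp add: nc_eval_minus)

lemma nc_eval_word: "nc_eval X (word [i]) = X i"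
  by (simp add: nc_eval_single op_prod_Cons op_prod_Nil)

section \<open>Trace and norms of polynomials evaluated at a self-adjoint tuple\<close>

locale tracial_tuple = tracial N \<tau>
  for N :: "'h::complex_hilbert op set" and \<tau> +
  fixes X :: "'i \<Rightarrow> 'h op"
  assumes X_sa: "self_adjoint_in N (X i)"
begin

abbreviation ev :: "'i ncpoly \<Rightarrow> 'h op" where "ev \<equiv> nc_eval X"

text \<open>Trace, operator norm and 2-norm are pulled back to formal polynomials, where ring
  simplification is available. Since \<open>ev\<close> may have a kernel, the norms become
  seminorms.\<close>

definition \<phi> :: "'i ncpoly \<Rightarrow> complex" where "\<phi> P = \<tau> (ev P)"

definition nm :: "'i ncpoly \<Rightarrow> real" where "nm P = norm (ev P)"

definition n2 :: "'i ncpoly \<Rightarrow> real" where "n2 P = norm2 \<tau> (ev P)"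

lemma X_N: "X i \<in> N" and X_adj: "op_adj (X i) = X i"
  using X_sa[of i] by (auto simp: self_adjoint_in_def)

lemma X_bounded: "X i \<in> bounded_ops"
  by (simp add: X_N N_bounded)

lemma op_prod_N: "op_prod (map X w) \<in> N"
  by (induction w) (simp_all add: op_prod_Nil op_prod_Cons N_intros X_N)

lemma ev_N [simp]: "ev P \<in> N"
  by (induction P rule: poly_mapping_induct) (simp_all add: nc_eval_single nc_eval_add N_intros op_prod_N)

lemma ev_mult: "ev (P * Q) = ev P o\<^sub>L ev Q"
  by (rule nc_eval_mult) (rule X_bounded)

lemma ev_star: "ev (nc_star P) = op_adj (ev P)"
proof (induction P rule: poly_mapping_induct)
  case (single w c)
  have "op_adj (op_prod (map X w)) = op_prod (map X (rev w))"
    by (induction w)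
      (simp_all add: op_prod_Nil op_prod_Cons op_prod_append op_adj_id adj_mult X_N X_adj op_prod_N)
  then show ?case
    by (simp add: nc_star_single nc_eval_single op_adj_scale N_bounded op_prod_N)
qed (simp add: nc_star_add nc_eval_add adj_add)

lemma phi_add: "\<phi> (P + Q) = \<phi> P + \<phi> Q"
  and phi_diff: "\<phi> (P - Q) = \<phi> P - \<phi> Q"
  and phi_0: "\<phi> 0 = 0"
  and phi_1: "\<phi> 1 = 1"
  and phi_comm: "\<phi> (P * Q) = \<phi> (Q * P)"
  and phi_star: "\<phi> (nc_star P) = cnj (\<phi> P)"
  and phi_cst: "\<phi> (cst c * P) = c * \<phi> P"
  using tau_diff[of 0 0]
  by (simp_all add: \<phi>_def nc_eval_add nc_eval_diff nc_eval_minus tau_add tau_diff tau_uminus tau_id N_zero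
      ev_mult tau_comm ev_star tau_adj nc_eval_cst op_scale_compose_left tau_scale)

lemma n2_sq: "(n2 P)\<^sup>2 = Re (\<phi> (nc_star P * P))"
  using tau_pos_Re[of "ev P"]
  by (simp add: n2_def norm2_def \<phi>_def ev_mult ev_star tau_comm[of "ev P" "op_adj (ev P)"] N_adj)

lemma phi_star_mult: "\<phi> (nc_star P * P) = of_real ((n2 P)\<^sup>2)"
  using tau_pos_Im[of "ev P"] n2_sq[of P]
  by (simp add: complex_eq_iff) (simp add: \<phi>_def ev_mult ev_star)

lemma n2_nonneg [simp]: "0 \<le> n2 P"
  using tau_pos_Re[of "ev P"]
  by (simp add: n2_def norm2_def tau_comm[of "ev P" "op_adj (ev P)"] N_adj)

lemma n2_star [simp]: "n2 (nc_star P) = n2 P"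
  by (rule power2_eq_imp_eq) (simp_all add: n2_sq phi_comm)

lemma n2_0 [simp]: "n2 0 = 0"
  by (rule power2_eq_imp_eq) (simp_all add: n2_sq phi_0)

lemma n2_1 [simp]: "n2 1 = 1"
  by (rule power2_eq_imp_eq) (simp_all add: n2_sq phi_1)

text \<open>Non-negativity of the squared 2-norm of \<open>P - cst c * Q\<close>, a quadratic in the
  real parameter \<open>t\<close>; putting the conjugate pairing into \<open>c\<close> makes both
  cross terms real and equal.\<close>

lemma cauchy_schwarz: "cmod (\<phi> (nc_star P * Q)) \<le> n2 P * n2 Q"
proof -
  let ?B = "\<phi> (nc_star P * Q)"
  have QP: "\<phi> (nc_star Q * P) = cnj ?B"
    using phi_star[of "nc_star P * Q"] by (simp add: nc_star_mult)
  have ge: "0 \<le> (n2 P)\<^sup>2 - 2 * t * (cmod ?B)\<^sup>2 + t\<^sup>2 * (cmod ?B)\<^sup>2 * (n2 Q)\<^sup>2" for t :: real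
  proof -
    define c where "c = of_real t * cnj ?B"
    have "nc_star (P - cst c * Q) * (P - cst c * Q) =
      nc_star P * P - cst c * (nc_star P * Q) - cst (cnj c) * (nc_star Q * P) + cst (cnj c) * (cst c * (nc_star Q * Q))"
      by (simp add: nc_star_diff nc_star_mult nc_star_cst algebra_simps)
        (metis (no_types, lifting) cst_commute mult.assoc)
    then have "\<phi> (nc_star (P - cst c * Q) * (P - cst c * Q)) =
       of_real ((n2 P)\<^sup>2) - c * ?B - cnj c * cnj ?B + cnj c * c * of_real ((n2 Q)\<^sup>2)"
      by (simp add: phi_add phi_diff phi_cst QP phi_star_mult del: of_real_power)
    moreover have "c * ?B = of_real (t * (cmod ?B)\<^sup>2)" "cnj c * cnj ?B = of_real (t * (cmod ?B)\<^sup>2)"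
      "cnj c * c = of_real (t\<^sup>2 * (cmod ?B)\<^sup>2)"
      by (simp_all only: c_def complex_cnj_mult complex_cnj_cnj complex_cnj_complex_of_real of_real_mult complex_norm_square)
        (simp_all add: power2_eq_square algebra_simps)
    ultimately have "Re (\<phi> (nc_star (P - cst c * Q) * (P - cst c * Q))) =
       (n2 P)\<^sup>2 - t * (cmod ?B)\<^sup>2 - t * (cmod ?B)\<^sup>2 + t\<^sup>2 * (cmod ?B)\<^sup>2 * (n2 Q)\<^sup>2"
      by (simp only: of_real_mult[symmetric] of_real_diff[symmetric] of_real_add[symmetric] Re_complex_of_real)
    then show ?thesis using n2_sq[of "P - cst c * Q"] zero_le_power2[of "n2 (P - cst c * Q)"] by linarith
  qed
  have "(cmod ?B)\<^sup>2 \<le> (n2 P)\<^sup>2 * (n2 Q)\<^sup>2"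
  proof (cases "n2 Q = 0")
    case True
    have "cmod ?B = 0"
    proof (rule ccontr)
      assume "cmod ?B \<noteq> 0"
      then show False
        \<comment> \<open>As \<open>n2 Q = 0\<close>, the quadratic takes the value -1 at this
          \<open>t\<close>.\<close>
        using ge[of "((n2 P)\<^sup>2 + 1) / (2 * (cmod ?B)\<^sup>2)"] True by simp
    qed
    then show ?thesis by simp
  next
    case False
    then have "0 \<le> (n2 P)\<^sup>2 - (cmod ?B)\<^sup>2 / (n2 Q)\<^sup>2"
      using ge[of "1 / (n2 Q)\<^sup>2"] by (simp add: power2_eq_square field_simps)
    then show ?thesis using False by (simp add: field_simps)
  qed
  then show ?thesis
    by (metis abs_le_square_iff abs_of_nonneg mult_nonneg_nonneg n2_nonneg norm_ge_zero power_mult_distrib)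
qed

lemma phi_mult_le: "cmod (\<phi> (P * Q)) \<le> n2 P * n2 Q"
  using cauchy_schwarz[of "nc_star P" Q] by simp

lemma phi_le_n2: "cmod (\<phi> P) \<le> n2 P"
  using phi_mult_le[of P 1] by simp

lemma n2_triangle: "n2 (P + Q) \<le> n2 P + n2 Q"
proof -
  have "(n2 (P + Q))\<^sup>2 = (n2 P)\<^sup>2 + Re (\<phi> (nc_star P * Q)) + Re (\<phi> (nc_star Q * P)) + (n2 Q)\<^sup>2"
    by (simp add: n2_sq nc_star_add distrib_left distrib_right phi_add)
  also have "\<dots> \<le> (n2 P)\<^sup>2 + n2 P * n2 Q + n2 Q * n2 P + (n2 Q)\<^sup>2"
    using cauchy_schwarz[of P Q] cauchy_schwarz[of Q P]
      complex_Re_le_cmod[of "\<phi> (nc_star P * Q)"] complex_Re_le_cmod[of "\<phi> (nc_star Q * P)"] by linarith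
  also have "\<dots> = (n2 P + n2 Q)\<^sup>2" by (simp add: power2_eq_square algebra_simps)
  finally show ?thesis by (rule power2_le_imp_le) simp
qed

lemma n2_cst: "n2 (cst c * P) = cmod c * n2 P"
proof (rule power2_eq_imp_eq)
  have "nc_star (cst c * P) * (cst c * P) = cst (cnj c) * (cst c * (nc_star P * P))"
    by (simp add: nc_star_mult nc_star_cst) (metis (no_types, lifting) cst_commute mult.assoc)
  then have "\<phi> (nc_star (cst c * P) * (cst c * P)) = (cnj c * c) * of_real ((n2 P)\<^sup>2)"
    by (simp add: phi_cst phi_star_mult)
  also have "cnj c * c = of_real ((cmod c)\<^sup>2)" by (simp only: complex_norm_square mult.commute)
  finally show "(n2 (cst c * P))\<^sup>2 = (cmod c * n2 P)\<^sup>2"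
    by (simp only: n2_sq[of "cst c * P"] of_real_mult[symmetric] Re_complex_of_real power_mult_distrib)
qed simp_all

lemma n2_minus [simp]: "n2 (- P) = n2 P"
  using n2_cst[of "-1" P] by (simp add: cst_minus cst_1)

lemma n2_diff_le: "n2 (P - Q) \<le> n2 P + n2 Q"
  using n2_triangle[of P "- Q"] by simp

lemma n2_lipschitz: "\<bar>n2 P - n2 Q\<bar> \<le> n2 (P - Q)"
  using n2_triangle[of "P - Q" Q] n2_triangle[of "Q - P" P] n2_minus[of "P - Q"] by (simp add: abs_le_iff)

lemma n2_mult_le: "n2 (P * Q) \<le> nm P * n2 Q"
proof (rule power2_le_imp_le)
  show "(n2 (P * Q))\<^sup>2 \<le> (nm P * n2 Q)\<^sup>2"
    using tau_compose_bound[of "ev P" "ev Q"]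
    by (simp add: n2_sq power_mult_distrib nm_def \<phi>_def ev_mult ev_star)
qed (simp add: nm_def)

lemma nm_nonneg [simp]: "0 \<le> nm P"
  by (simp add: nm_def)

lemma nm_star [simp]: "nm (nc_star P) = nm P"
  by (simp add: nm_def ev_star norm_adj)

text \<open>Adjoints exchange the two factors, and by the trace property, in the form
  \<open>n2_star\<close>, they preserve the 2-norm.\<close>

lemma n2_mult_le': "n2 (P * Q) \<le> n2 P * nm Q"
  using n2_mult_le[of "nc_star Q" "nc_star P"] by (simp add: nc_star_mult[symmetric] mult.commute)

lemma n2_le_nm: "n2 P \<le> nm P"
  using n2_mult_le[of P 1] by simp

lemma nm_mult_le: "nm (P * Q) \<le> nm P * nm Q"
  by (simp add: nm_def ev_mult norm_blinfun_compose)

lemma nm_1: "nm 1 \<le> 1"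
  by (simp add: nm_def norm_blinfun_id_le)

lemma nm_power_le: "nm (P ^ k) \<le> nm P ^ k"
proof (induction k)
  case (Suc k)
  show ?case using nm_mult_le[of P "P ^ k"] mult_left_mono[OF Suc, of "nm P"] by simp
qed (simp add: nm_1)

end

text \<open>Statements about operators are reduced to statements about polynomials in their real and
  imaginary parts.\<close>

lemma (in tracial) generic_tuple:
  assumes a: "\<And>k::nat. a k \<in> N"
  shows "\<exists>Y :: nat \<Rightarrow> 'h op. tracial_tuple N \<tau> Y \<and> (\<forall>k. \<exists>P. a k = nc_eval Y P)"
proof -
  define Y where "Y k = (if even k then (1/2) *\<^sub>R (a (k div 2) + op_adj (a (k div 2)))
    else op_scale (- \<i> / 2) (a (k div 2) - op_adj (a (k div 2))))" for k
  have "self_adjoint_in N (Y k)" for k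
    using a[of "k div 2"]
    by (simp add: self_adjoint_in_def Y_def N_intros adj_scaleR adj_add adj_adj op_adj_scale N_bounded adj_diff
        add.commute)
      (simp add: scaleR_eq_op_scale[of "-1", simplified] op_scale_op_scale op_scale_add_right
        diff_conv_add_uminus[of _ "op_adj _"] diff_conv_add_uminus[of "op_adj _"] del: add_uminus_conv_diff)
  then have "tracial_tuple N \<tau> Y"
    by (intro tracial_tuple.intro tracial_axioms tracial_tuple_axioms.intro)
  moreover have "a k = nc_eval Y (word [2 * k] + cst \<i> * word [2 * k + 1])" for k
  proof -
    interpret Y: tracial_tuple N \<tau> Y by fact
    have "nc_eval Y (word [2 * k] + cst \<i> * word [2 * k + 1]) = Y (2 * k) + op_scale \<i> (Y (2 * k + 1))"
      by (simp add: nc_eval_add Y.ev_mult nc_eval_cst nc_eval_word op_scale_compose_left)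
    also have "\<dots> = (1/2) *\<^sub>R (a k + op_adj (a k)) + (1/2) *\<^sub>R (a k - op_adj (a k))"
      by (simp add: Y_def op_scale_op_scale scaleR_eq_op_scale)
    also have "\<dots> = (1/2 + 1/2) *\<^sub>R a k"
      by (simp only: scaleR_add_right scaleR_diff_right scaleR_add_left) simp
    finally show ?thesis by simp
  qed
  ultimately show ?thesis by blast
qed

section \<open>Slices of the free difference quotient\<close>

definition facs :: "'i \<Rightarrow> 'i list \<Rightarrow> ('i list \<times> 'i list) set" where
  "facs j w = {(u, v). w = u @ j # v}"

lemma cst_left_commute: "P * (cst c * Q) = cst c * (P * Q)"
  by (metis cst_commute mult.assoc)

text \<open>With \<open>\<partial>\<^sub>j P = \<Sum> u \<otimes> v\<close> and functionals \<open>f\<close>, \<open>g\<close> given by their values on words, these are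
  \<open>f(P)\<close>, \<open>(f \<otimes> id)(\<partial>\<^sub>j P)\<close>, \<open>(id \<otimes> g)(\<partial>\<^sub>j P)\<close> and \<open>(f \<otimes> g)(\<partial>\<^sub>j P)\<close>.\<close>

definition nc_lin :: "('i list \<Rightarrow> complex) \<Rightarrow> 'i ncpoly \<Rightarrow> complex" where
  "nc_lin f P = (\<Sum>w\<in>keys P. lookup P w * f w)"

definition lslice :: "'i \<Rightarrow> ('i list \<Rightarrow> complex) \<Rightarrow> 'i ncpoly \<Rightarrow> 'i ncpoly" where
  "lslice j f P = (\<Sum>w\<in>keys P. \<Sum>(u, v)\<in>facs j w.
     cst (lookup P w * f u) * word v)"

definition rslice :: "'i \<Rightarrow> ('i list \<Rightarrow> complex) \<Rightarrow> 'i ncpoly \<Rightarrow> 'i ncpoly" where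
  "rslice j g P = (\<Sum>w\<in>keys P. \<Sum>(u, v)\<in>facs j w.
     cst (lookup P w * g v) * word u)"

definition dslice :: "'i \<Rightarrow> ('i list \<Rightarrow> complex) \<Rightarrow> ('i list \<Rightarrow> complex) \<Rightarrow> 'i ncpoly \<Rightarrow> complex" where
  "dslice j f g P = (\<Sum>w\<in>keys P. \<Sum>(u, v)\<in>facs j w. lookup P w * f u * g v)"

lemma finite_facs [simp]: "finite (facs j w)"
  unfolding facs_def by (rule finite_factorizations)

lemma facs_Nil [simp]: "facs j [] = {}"
  by (simp add: facs_def)

lemma sum_facs_Cons:
  fixes h :: "'i list \<Rightarrow> 'i list \<Rightarrow> 'b::comm_monoid_add"
  shows "(\<Sum>(u, v)\<in>facs j (i # w). h u v) =
    (if i = j then h [] w else 0) + (\<Sum>(u, v)\<in>facs j w. h (i # u) v)"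
proof -
  let ?c = "\<lambda>(u, v). (i # u, v)"
  have eq: "facs j (i # w) = (if i = j then {([], w)} else {}) \<union> ?c ` facs j w"
    by (auto simp: facs_def Cons_eq_append_conv image_iff)
  have inj: "inj_on ?c (facs j w)" by (auto simp: inj_on_def)
  have "(\<Sum>(u, v)\<in>facs j (i # w). h u v) =
     (\<Sum>(u, v)\<in>(if i = j then {([], w)} else {}). h u v) + (\<Sum>(u, v)\<in>?c ` facs j w. h u v)"
    unfolding eq by (rule sum.union_disjoint) auto
  moreover have "(\<Sum>(u, v)\<in>?c ` facs j w. h u v) = (\<Sum>(u, v)\<in>facs j w. h (i # u) v)"
    by (subst sum.reindex[OF inj]) (simp add: case_prod_beta)
  ultimately show ?thesis by simp
qed

lemma nc_lin_add: "nc_lin f (P + Q) = nc_lin f P + nc_lin f Q"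
  unfolding nc_lin_def by (rule sum_keys_add) (simp_all add: algebra_simps)

lemma lslice_add: "lslice j f (P + Q) = lslice j f P + lslice j f Q"
  unfolding lslice_def
  by (rule sum_keys_add[where h = "\<lambda>w c. \<Sum>(u, v)\<in>facs j w. cst (c * f u) * word v"])
    (simp_all add: algebra_simps cst_0 cst_add sum.distrib case_prod_beta)

lemma rslice_add: "rslice j f (P + Q) = rslice j f P + rslice j f Q"
  unfolding rslice_def
  by (rule sum_keys_add[where h = "\<lambda>w c. \<Sum>(u, v)\<in>facs j w. cst (c * f v) * word u"])
    (simp_all add: algebra_simps cst_0 cst_add sum.distrib case_prod_beta)

lemma dslice_add: "dslice j f g (P + Q) = dslice j f g P + dslice j f g Q"
  unfolding dslice_def
  by (rule sum_keys_add[where h = "\<lambda>w c. \<Sum>(u, v)\<in>facs j w. c * f u * g v"])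
    (simp_all add: algebra_simps sum.distrib case_prod_beta)

lemma nc_lin_single: "nc_lin f (single w c) = c * f w"
  unfolding nc_lin_def by (rule sum_keys_single) simp

lemma lslice_single': "lslice j f (single w c) = (\<Sum>(u, v)\<in>facs j w. cst (c * f u) * word v)"
  unfolding lslice_def
  by (rule sum_keys_single[where h = "\<lambda>w c. \<Sum>(u, v)\<in>facs j w. cst (c * f u) * word v"]) (simp add: cst_0)

lemma rslice_single': "rslice j f (single w c) = (\<Sum>(u, v)\<in>facs j w. cst (c * f v) * word u)"
  unfolding rslice_def
  by (rule sum_keys_single[where h = "\<lambda>w c. \<Sum>(u, v)\<in>facs j w. cst (c * f v) * word u"]) (simp add: cst_0)

lemma dslice_single': "dslice j f g (single w c) = (\<Sum>(u, v)\<in>facs j w. c * f u * g v)"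
  unfolding dslice_def
  by (rule sum_keys_single[where h = "\<lambda>w c. \<Sum>(u, v)\<in>facs j w. c * f u * g v"]) simp

lemma lslice_single: "lslice j f (single w c) = cst c * lslice j f (word w)"
  and rslice_single: "rslice j f (single w c) = cst c * rslice j f (word w)"
  and dslice_single: "dslice j f g (single w c) = c * dslice j f g (word w)"
  by (simp_all add: lslice_single' rslice_single' dslice_single' sum_distrib_left case_prod_beta
      cst_mult[symmetric] mult.assoc)

lemma lslice_0 [simp]: "lslice j f 0 = 0" and rslice_0 [simp]: "rslice j f 0 = 0"
  and dslice_0 [simp]: "dslice j f g 0 = 0"  and nc_lin_0 [simp]: "nc_lin f 0 = 0"
  by (simp_all add: lslice_def rslice_def dslice_def nc_lin_def)

lemma lslice_Nil: "lslice j f (word []) = 0"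
  and rslice_Nil: "rslice j f (word []) = 0"
  and dslice_Nil: "dslice j f g (word []) = 0"
  by (simp_all add: lslice_single' rslice_single' dslice_single')

lemma lslice_Cons: "lslice j f (word (i # w)) =
    (if i = j then cst (f []) * word w else 0) + lslice j (\<lambda>u. f (i # u)) (word w)"
  by (simp add: lslice_single' sum_facs_Cons)

lemma rslice_Cons: "rslice j f (word (i # w)) =
    (if i = j then cst (f w) else 0) + word [i] * rslice j f (word w)"
  unfolding rslice_single' sum_facs_Cons
  by (simp add: sum_distrib_left case_prod_beta word_Nil)
    (simp add: cst_left_commute single_times)

lemma dslice_Cons: "dslice j f g (word (i # w)) =
    (if i = j then f [] * g w else 0) + dslice j (\<lambda>u. f (i # u)) g (word w)"
  by (simp add: dslice_single' sum_facs_Cons)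

lemma single_cst_mult: "cst a * single w c = single w (a * c)"
  by (simp add: cst_def single_times)

lemma nc_lin_cst: "nc_lin f (cst c * P) = c * nc_lin f P"
  by (induction P rule: poly_mapping_induct)
    (simp_all add: single_cst_mult nc_lin_single nc_lin_add distrib_left)

lemma lslice_cst: "lslice j f (cst c * P) = cst c * lslice j f P"
proof (induction P rule: poly_mapping_induct)
  case (single w d)
  show ?case
    by (simp add: single_cst_mult lslice_single[of _ _ _ "c * d"] lslice_single[of _ _ _ d] cst_mult[symmetric] mult.assoc)
qed (simp add: lslice_add distrib_left)

lemma dslice_cst: "dslice j f g (cst c * P) = c * dslice j f g P"
proof (induction P rule: poly_mapping_induct)
  case (single w d)
  show ?case
    by (simp add: single_cst_mult dslice_single[of _ _ _ _ "c * d"] dslice_single[of _ _ _ _ d] mult.assoc)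
qed (simp add: dslice_add distrib_left)

lemma nc_lin_lslice: "nc_lin g (lslice j f P) = dslice j f g P"
proof (induction P rule: poly_mapping_induct)
  case (single w c)
  have "nc_lin g (lslice j f (word w)) = dslice j f g (word w)" for f
    by (induction w arbitrary: f)
      (simp_all add: lslice_Nil dslice_Nil lslice_Cons dslice_Cons nc_lin_add nc_lin_cst nc_lin_single)
  then show ?case
    by (simp add: lslice_single[of _ _ _ c] dslice_single[of _ _ _ _ c] nc_lin_cst)
qed (simp add: lslice_add dslice_add nc_lin_add)

lemma nc_lin_Cons: "nc_lin f (word [i] * P) = nc_lin (\<lambda>u. f (i # u)) P"
  by (induction P rule: poly_mapping_induct)
    (simp_all add: single_times nc_lin_single nc_lin_add distrib_left)

lemma nc_lin_const: "nc_lin f (cst c) = c * f []"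
  by (simp add: cst_def nc_lin_single)

lemma nc_lin_rslice: "nc_lin f (rslice j g P) = dslice j f g P"
proof (induction P rule: poly_mapping_induct)
  case (single w c)
  have "nc_lin f (rslice j g (word w)) = dslice j f g (word w)" for f
    by (induction w arbitrary: f)
      (simp_all add: rslice_Nil dslice_Nil rslice_Cons dslice_Cons nc_lin_add nc_lin_Cons nc_lin_const)
  then show ?case
    by (simp add: rslice_single[of _ _ _ c] dslice_single[of _ _ _ _ c] nc_lin_cst)
qed (simp add: rslice_add dslice_add nc_lin_add)

lemma dslice_mult_Cons: "dslice j f g (word [i] * P) =
    (if i = j then f [] * nc_lin g P else 0) + dslice j (\<lambda>u. f (i # u)) g P"
proof (induction P rule: poly_mapping_induct)
  case (single w c)
  show ?case
    by (simp add: single_times nc_lin_single dslice_single[of _ _ _ _ c] dslice_Cons algebra_simps)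
qed (auto simp: dslice_add nc_lin_add distrib_left)

lemma dslice_const: "dslice j f g (cst c) = 0"
  by (simp add: cst_def dslice_single')

text \<open>Coassociativity: both sides are \<open>(h \<otimes> f \<otimes> g)\<close> of the second order difference quotient.\<close>

lemma dslice_lslice: "dslice j f g (lslice j h P) = dslice j h f (rslice j g P)"
proof (induction P rule: poly_mapping_induct)
  case (single w c)
  have "dslice j f g (lslice j h (word w)) = dslice j h f (rslice j g (word w))" for h
    by (induction w arbitrary: h)
      (simp_all add: lslice_Nil rslice_Nil lslice_Cons rslice_Cons dslice_add dslice_cst dslice_const
        dslice_mult_Cons nc_lin_rslice)
  then show ?case
    by (simp add: lslice_single[of _ _ _ c] rslice_single[of _ _ _ c] dslice_cst)
qed (simp add: lslice_add rslice_add dslice_add)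

text \<open>Translates the conjugate relation into slices. \<open>nc_trace2\<close> is additive, so
  the double sum in \<open>nc_deriv\<close> can be evaluated term by term.\<close>

lemma nc_trace2_deriv: "nc_trace2 \<tau> X (nc_deriv j P) =
   dslice j (\<lambda>u. \<tau> (op_prod (map X u))) (\<lambda>v. \<tau> (op_prod (map X v))) P"
proof -
  define h where "h uv c = c * \<tau> (op_prod (map X (fst uv))) * \<tau> (op_prod (map X (snd uv)))" for uv c
  have t: "nc_trace2 \<tau> X Q = (\<Sum>k\<in>keys Q. h k (lookup Q k))" for Q
    by (simp add: nc_trace2_def h_def case_prod_beta)
  have add: "nc_trace2 \<tau> X (Q + R) = nc_trace2 \<tau> X Q + nc_trace2 \<tau> X R" for Q R
    unfolding t by (rule sum_keys_add) (simp_all add: h_def algebra_simps)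
  have sing: "nc_trace2 \<tau> X (single k c) = h k c" for k c
    unfolding t by (rule sum_keys_single) (simp add: h_def)
  have zero: "nc_trace2 \<tau> X 0 = 0" by (simp add: nc_trace2_def)
  have sum_pairs: "nc_trace2 \<tau> X (sum f A) = (\<Sum>a\<in>A. nc_trace2 \<tau> X (f a))" for f and A :: "('i list \<times> 'i list) set"
    by (induction A rule: infinite_finite_induct) (simp_all add: zero add)
  have sum_words: "nc_trace2 \<tau> X (sum f A) = (\<Sum>a\<in>A. nc_trace2 \<tau> X (f a))" for f and A :: "'i list set"
    by (induction A rule: infinite_finite_induct) (simp_all add: zero add)
  show ?thesis
    by (simp add: nc_deriv_def dslice_def facs_def[symmetric] sum_pairs sum_words case_prod_beta sing) (simp add: h_def)
qed

text \<open>The involution reverses words and hence swaps the two legs of the difference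
  quotient.\<close>

lemma nc_star_lslice: "nc_star (lslice j f P) = rslice j (\<lambda>w. cnj (f (rev w))) (nc_star P)"
proof (induction P rule: poly_mapping_induct)
  case (single w c)
  have ss: "nc_star (sum h A) = (\<Sum>a\<in>A. nc_star (h a))" for h :: "'a list \<times> 'a list \<Rightarrow> 'a ncpoly" and A
    by (induction A rule: infinite_finite_induct) (simp_all add: nc_star_add)
  have bij: "bij_betw (\<lambda>(u, v). (rev v, rev u)) (facs j w) (facs j (rev w))"
    by (rule bij_betw_byWitness[where f' = "\<lambda>(u, v). (rev v, rev u)"])
      (auto simp: facs_def rev_swap)
  show ?case
    unfolding lslice_single' nc_star_single rslice_single' ss
    by (subst sum.reindex_bij_betw[OF bij, symmetric])
      (simp add: case_prod_beta nc_star_mult nc_star_cst nc_star_single cst_commute)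
qed (simp add: lslice_add nc_star_add rslice_add)

context tracial_tuple
begin

text \<open>\<open>F a\<close> and \<open>G b\<close> are the functionals
  \<open>\<tau>(a \<cdot>)\<close> and \<open>\<tau>(\<cdot> b)\<close> on words, intended for the
  left and the right leg. The trace property identifies them (\<open>G_eq_F\<close>), which lets an
  argument change legs.\<close>

definition F :: "'i ncpoly \<Rightarrow> 'i list \<Rightarrow> complex" where "F a w = \<phi> (a * word w)"

definition G :: "'i ncpoly \<Rightarrow> 'i list \<Rightarrow> complex" where "G b w = \<phi> (word w * b)"

lemma nc_lin_F: "nc_lin (F a) P = \<phi> (a * P)"
proof (induction P rule: poly_mapping_induct)
  case (single w c)
  have "a * single w c = cst c * (a * word w)"
    by (simp only: single_eq_cst_word[of w c]) (metis cst_commute mult.assoc)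
  then show ?case by (simp add: nc_lin_single F_def phi_cst)
qed (simp add: nc_lin_add distrib_left phi_add)

lemma nc_lin_G: "nc_lin (G b) P = \<phi> (P * b)"
proof (induction P rule: poly_mapping_induct)
  case (single w c)
  have "single w c * b = cst c * (word w * b)"
    by (simp only: single_eq_cst_word[of w c] mult.assoc)
  then show ?case by (simp add: nc_lin_single G_def phi_cst)
qed (simp add: nc_lin_add distrib_right phi_add)

lemma G_eq_F: "G b = F b"
  by (simp add: fun_eq_iff G_def F_def phi_comm)

lemma phi_lslice: "\<phi> (lslice j f P * b) = dslice j f (G b) P"
  by (simp add: nc_lin_lslice[symmetric] nc_lin_G)

lemma phi_rslice: "\<phi> (a * rslice j g P) = dslice j (F a) g P"
  by (simp add: nc_lin_rslice[symmetric] nc_lin_F)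

text \<open>The Leibniz rule \<open>\<partial>(P Q) = \<partial>P (1 \<otimes> Q) + (P \<otimes> 1)
  \<partial>Q\<close>: in the second term \<open>P\<close> sits in the left leg and is absorbed by
  the functional.\<close>

lemma lslice_mult: "lslice j (F a) (P * Q) = lslice j (F a) P * Q + lslice j (F (a * P)) Q"
proof (induction P rule: poly_mapping_induct)
  case (single v c)
  have F_single: "F (a * single v c) = (\<lambda>w. c * F a (v @ w))"
  proof
    fix w
    have "a * single v c * word w = cst c * (a * word (v @ w))"
      by (simp only: single_eq_cst_word[of v c] mult.assoc word_mult[symmetric]) (metis cst_commute mult.assoc)
    then show "F (a * single v c) w = c * F a (v @ w)" by (simp add: F_def phi_cst)
  qed
  have lin: "lslice j (\<lambda>w. c * f w) R = cst c * lslice j f R" for f R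
    by (simp add: lslice_def sum_distrib_left case_prod_beta mult.assoc[symmetric] cst_mult) (simp add: ac_simps)
  have *: "lslice j f (word v * word w) = lslice j f (word v) * word w + lslice j (\<lambda>u. f (v @ u)) (word w)" for f w
  proof (induction v arbitrary: f)
    case Nil
    then show ?case by (simp add: word_mult lslice_Nil)
  next
    case (Cons i v)
    then show ?case by (cases "i = j") (simp_all add: word_mult lslice_Cons distrib_right mult.assoc)
  qed
  show ?case
  proof (induction Q rule: poly_mapping_induct)
    case (single w d)
    have "single v c * single w d = cst (c * d) * (word v * word w)"
      by (simp add: single_times single_cst_mult)
    then have "lslice j (F a) (single v c * single w d) =
      cst (c * d) * (lslice j (F a) (word v) * word w + lslice j (\<lambda>u. F a (v @ u)) (word w))"
      by (simp only: lslice_cst *)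
    also have "\<dots> = cst c * lslice j (F a) (word v) * (cst d * word w) + cst c * (cst d * lslice j (\<lambda>u. F a (v @ u)) (word w))"
      by (simp add: cst_mult[symmetric] distrib_left mult.assoc cst_left_commute[of "lslice j (F a) (word v)"])
    also have "\<dots> = lslice j (F a) (single v c) * single w d
       + lslice j (F (a * single v c)) (single w d)"
      by (simp only: F_single lin lslice_single[of _ _ _ c] lslice_single[of _ _ _ d] single_eq_cst_word[of w d, symmetric] cst_left_commute[of "cst c" d])
    finally show ?case .
  qed (simp add: lslice_add algebra_simps)
next
  case (add P P')
  have "F (a * (P + P')) = (\<lambda>w. F (a * P) w + F (a * P') w)"
    by (simp add: fun_eq_iff F_def algebra_simps phi_add)
  moreover have "lslice j (\<lambda>w. f w + g w) Q = lslice j f Q + lslice j g Q" for f g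
    by (simp add: lslice_def algebra_simps cst_add sum.distrib case_prod_beta)
  ultimately show ?case using add by (simp add: lslice_add algebra_simps)
qed

lemma dslice_mult: "dslice j (F a) (G b) (P * Q) = dslice j (F a) (G (Q * b)) P + dslice j (F (a * P)) (G b) Q"
  by (simp add: phi_lslice[symmetric] lslice_mult distrib_right phi_add mult.assoc)

lemma star_lslice: "nc_star (lslice j (F a) P) = rslice j (G (nc_star a)) (nc_star P)"
proof -
  have "(\<lambda>w. cnj (F a (rev w))) = G (nc_star a)"
    by (rule ext) (simp add: F_def G_def phi_star[symmetric] nc_star_mult nc_star_single)
  then show ?thesis by (simp add: nc_star_lslice)
qed

text \<open>A crude bound whose constant depends on \<open>P\<close>; it feeds only the growth
  estimate \<open>L_power_growth\<close>, where any constant will do.\<close>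

lemma n2_lslice_le: "\<exists>C\<ge>0. \<forall>a. n2 (lslice j (F a) P) \<le> C * n2 a"
proof (induction P rule: poly_mapping_induct)
  case (single w c)
  have ns: "n2 (sum f A) \<le> (\<Sum>x\<in>A. n2 (f x))" for f :: "'i list \<times> 'i list \<Rightarrow> 'i ncpoly" and A
    by (induction A rule: infinite_finite_induct) (auto intro: order_trans[OF n2_triangle])
  define C where "C = (\<Sum>x\<in>facs j w. cmod c * n2 (word (fst x)) * n2 (word (snd x)))"
  have "n2 (lslice j (F a) (single w c)) \<le> C * n2 a" for a
  proof -
    have "n2 (lslice j (F a) (single w c)) \<le>
       (\<Sum>x\<in>facs j w. n2 (cst (c * F a (fst x)) * word (snd x)))"
      unfolding lslice_single' by (rule order_trans[OF ns]) (simp add: case_prod_beta)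
    also have "\<dots> \<le> (\<Sum>x\<in>facs j w. cmod c * n2 (word (fst x)) * n2 (word (snd x)) * n2 a)"
    proof (rule sum_mono)
      fix x :: "'i list \<times> 'i list"
      have "cmod (F a (fst x)) \<le> n2 a * n2 (word (fst x))" unfolding F_def by (rule phi_mult_le)
      then have "cmod c * cmod (F a (fst x)) * n2 (word (snd x)) \<le> cmod c * (n2 a * n2 (word (fst x))) * n2 (word (snd x))"
        by (intro mult_right_mono mult_left_mono) auto
      then show "n2 (cst (c * F a (fst x)) * word (snd x)) \<le> cmod c * n2 (word (fst x)) * n2 (word (snd x)) * n2 a"
        by (simp add: n2_cst norm_mult ac_simps)
    qed
    finally show ?thesis by (simp add: C_def sum_distrib_right)
  qed
  moreover have "C \<ge> 0" unfolding C_def by (intro sum_nonneg mult_nonneg_nonneg) auto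
  ultimately show ?case by blast
next
  case (add P P')
  then obtain C C' where C: "C \<ge> 0" "C' \<ge> 0" "\<And>a. n2 (lslice j (F a) P) \<le> C * n2 a" "\<And>a. n2 (lslice j (F a) P') \<le> C' * n2 a"
    by auto
  have "n2 (lslice j (F a) (P + P')) \<le> (C + C') * n2 a" for a
    using n2_triangle[of "lslice j (F a) P" "lslice j (F a) P'"] C(3)[of a] C(4)[of a]
    by (simp add: lslice_add algebra_simps)
  then show ?case using C by (intro exI[of _ "C + C'"]) auto
qed

end

section \<open>Dabrowski's inequality\<close>

text \<open>The conjugate variable \<open>\<xi>\<^sub>j\<close> is represented by polynomials
  \<open>x k\<close>, Cauchy for the 2-norm, and \<open>\<Xi>\<close> is its norm. Every use of
  \<open>\<xi>\<^sub>j\<close> is a limit in \<open>k\<close>, so the completion never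
  appears.\<close>

locale conjugate_variable = tracial_tuple N \<tau> X
  for N :: "'h::complex_hilbert op set" and \<tau> and X :: "'i \<Rightarrow> 'h op" +
  fixes j :: 'i and x :: "nat \<Rightarrow> 'i ncpoly" and \<Xi> :: real
  assumes x_pairing: "(\<lambda>k. \<phi> (x k * P)) \<longlonglongrightarrow> dslice j (F 1) (G 1) P"
    and x_Cauchy: "\<And>e. e > 0 \<Longrightarrow> \<exists>K. \<forall>k\<ge>K. \<forall>l\<ge>K. n2 (x k - x l) < e"
    and x_norm: "(\<lambda>k. n2 (x k)) \<longlonglongrightarrow> \<Xi>"
begin

text \<open>\<open>T\<close> is \<open>(\<tau> \<otimes> \<tau>)(\<partial>\<^sub>j P)\<close>, the
  pairing with the conjugate variable; \<open>L\<close> below is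
  \<open>(\<tau> \<otimes> id)(\<partial>\<^sub>j P)\<close>.\<close>

abbreviation T :: "'i ncpoly \<Rightarrow> complex" where "T P \<equiv> dslice j (F 1) (G 1) P"

abbreviation L :: "'i ncpoly \<Rightarrow> 'i ncpoly" where "L P \<equiv> lslice j (F 1) P"

text \<open>The involution swaps the legs, and both carry the same functional. It follows that the
  conjugate variable behaves like a self-adjoint element, which is
  \<open>x_pairing_star\<close>.\<close>

lemma T_star: "T (nc_star P) = cnj (T P)"
proof -
  have "T P = \<phi> (L P)" using phi_lslice[of j "F 1" P 1] by simp
  then have "cnj (T P) = \<phi> (nc_star (L P))" by (simp add: phi_star)
  also have "\<dots> = T (nc_star P)" using phi_rslice[of 1 j "G 1" "nc_star P"] by (simp add: star_lslice)
  finally show ?thesis by simp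
qed

lemma x_pairing_star: "(\<lambda>k. \<phi> (nc_star (x k) * P)) \<longlonglongrightarrow> T P"
proof -
  have "\<phi> (nc_star (x k) * P) = cnj (\<phi> (x k * nc_star P))" for k
    by (simp add: phi_star[symmetric] nc_star_mult phi_comm)
  then show ?thesis
    using tendsto_cnj[OF x_pairing[of "nc_star P"]] by (simp add: T_star)
qed

lemma Xi_nonneg: "0 \<le> \<Xi>"
  by (rule LIMSEQ_le_const[OF x_norm]) simp

text \<open>The Leibniz rule splits \<open>L (b * nc_star b)\<close>. Coassociativity moves the
  second slice onto \<open>nc_star (L b)\<close>, where the Leibniz rule, read backwards, recognises
  the conjugate of the first term up to \<open>\<phi> (nc_star (L b) * L b)\<close>. This is the
  cancellation behind \<open>etanorm_sq_le\<close>.\<close>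

lemma L_star_identity:
  "T (L (b * nc_star b)) = T (L b * nc_star b) + cnj (T (L b * nc_star b)) - \<phi> (nc_star (L b) * L b)"
proof -
  have 1: "T (L (b * nc_star b)) = T (L b * nc_star b) + T (lslice j (F b) (nc_star b))"
    using lslice_mult[of j 1 b "nc_star b"] by (simp add: dslice_add)
  have "T (lslice j (F b) (nc_star b)) = dslice j (F b) (F 1) (rslice j (G 1) (nc_star b))"
    by (rule dslice_lslice)
  also have "\<dots> = dslice j (F b) (G 1) (nc_star (L b))"
    using star_lslice[of j 1 b] by (simp add: G_eq_F)
  finally have 2: "T (lslice j (F b) (nc_star b)) = dslice j (F b) (G 1) (nc_star (L b))" .
  have "cnj (T (L b * nc_star b)) = T (b * nc_star (L b))"
    by (simp add: T_star[symmetric] nc_star_mult)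
  also have "\<dots> = \<phi> (L b * nc_star (L b)) + dslice j (F b) (G 1) (nc_star (L b))"
    by (simp add: dslice_mult phi_lslice)
  finally show ?thesis by (simp add: 1 2 phi_comm)
qed

text \<open>The vectors \<open>\<eta> k b\<close> converge to \<open>\<partial>\<^sub>j*(b \<otimes> 1)\<close>.\<close>

definition \<eta> :: "nat \<Rightarrow> 'i ncpoly \<Rightarrow> 'i ncpoly" where "\<eta> k b = x k * b - L b"

definition \<eta>norm :: "'i ncpoly \<Rightarrow> real" where "\<eta>norm b = lim (\<lambda>k. n2 (\<eta> k b))"

lemma eta_tendsto: "(\<lambda>k. n2 (\<eta> k b)) \<longlonglongrightarrow> \<eta>norm b"
proof -
  have "Cauchy (\<lambda>k. n2 (\<eta> k b))"
  proof (rule metric_CauchyI)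
    fix e :: real assume e: "e > 0"
    have pos: "nm b + 1 > 0" using nm_nonneg[of b] by linarith
    obtain K where K: "\<And>k l. k \<ge> K \<Longrightarrow> l \<ge> K \<Longrightarrow> n2 (x k - x l) < e / (nm b + 1)"
      using x_Cauchy[of "e / (nm b + 1)"] e pos by auto
    have "dist (n2 (\<eta> k b)) (n2 (\<eta> l b)) < e" if "k \<ge> K" "l \<ge> K" for k l
    proof -
      have "dist (n2 (\<eta> k b)) (n2 (\<eta> l b)) \<le> n2 (\<eta> k b - \<eta> l b)"
        by (simp add: dist_real_def n2_lipschitz)
      also have "\<eta> k b - \<eta> l b = (x k - x l) * b" by (simp add: \<eta>_def algebra_simps)
      also have "n2 ((x k - x l) * b) \<le> n2 (x k - x l) * nm b" by (rule n2_mult_le')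
      also have "\<dots> \<le> n2 (x k - x l) * (nm b + 1)" by (rule mult_left_mono) auto
      also have "\<dots> < e" using K[OF that] pos by (simp add: field_simps)
      finally show ?thesis .
    qed
    then show "\<exists>M. \<forall>m\<ge>M. \<forall>n\<ge>M. dist (n2 (\<eta> m b)) (n2 (\<eta> n b)) < e" by blast
  qed
  then show ?thesis unfolding \<eta>norm_def by (simp add: Cauchy_convergent convergent_LIMSEQ_iff[symmetric])
qed

text \<open>By Cauchy-Schwarz, since in the limit \<open>\<parallel>\<eta>\<^sub>b\<parallel>\<^sup>2 = \<langle>\<eta>\<^bsub>b b*\<^esub>, \<xi>\<rangle>\<close>.\<close>

lemma etanorm_sq_le: "(\<eta>norm b)\<^sup>2 \<le> \<Xi> * \<eta>norm (b * nc_star b)"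
proof -
  let ?h = "b * nc_star b"
  \<comment> \<open>The terms quadratic in \<open>x k\<close> cancel exactly by the trace property.
    What remains is at most linear in \<open>x k\<close>, so the pairing limits suffice to compute
    it.\<close>
  define err where "err k = (n2 (\<eta> k b))\<^sup>2 - Re (\<phi> (nc_star (x k) * \<eta> k ?h))" for k
  let ?E = "\<lambda>k. - \<phi> (nc_star (x k) * (L b * nc_star b)) - cnj (\<phi> (nc_star (x k) * (L b * nc_star b)))
      + \<phi> (nc_star (L b) * L b) + \<phi> (nc_star (x k) * L ?h)"
  have e: "err k = Re (?E k)" for k
  proof -
    have "\<phi> (nc_star (\<eta> k b) * \<eta> k b) = \<phi> (nc_star b * (nc_star (x k) * x k * b)) - \<phi> (nc_star b * (nc_star (x k) * L b))
       - \<phi> (nc_star (L b) * (x k * b)) + \<phi> (nc_star (L b) * L b)"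
      by (simp add: \<eta>_def nc_star_diff nc_star_mult phi_diff phi_add algebra_simps)
    also have "\<phi> (nc_star b * (nc_star (x k) * x k * b)) = \<phi> (nc_star (x k) * (x k * ?h))"
      by (subst phi_comm) (simp add: mult.assoc)
    also have "\<phi> (nc_star b * (nc_star (x k) * L b)) = \<phi> (nc_star (x k) * (L b * nc_star b))"
      by (subst phi_comm) (simp add: mult.assoc)
    also have "\<phi> (nc_star (L b) * (x k * b)) = cnj (\<phi> (nc_star b * (nc_star (x k) * L b)))"
      by (simp add: phi_star[symmetric] nc_star_mult mult.assoc)
    also have "\<phi> (nc_star b * (nc_star (x k) * L b)) = \<phi> (nc_star (x k) * (L b * nc_star b))"
      by (subst phi_comm) (simp add: mult.assoc)
    finally show ?thesis
      by (simp add: err_def n2_sq) (simp add: \<eta>_def phi_diff right_diff_distrib)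
  qed
  have "?E \<longlonglongrightarrow>
      - T (L b * nc_star b) - cnj (T (L b * nc_star b)) + \<phi> (nc_star (L b) * L b) + T (L ?h)"
    by (intro tendsto_intros x_pairing_star)
  also have "- T (L b * nc_star b) - cnj (T (L b * nc_star b)) + \<phi> (nc_star (L b) * L b) + T (L ?h) = 0"
    by (simp add: L_star_identity)
  finally have "?E \<longlonglongrightarrow> 0" .
  from tendsto_Re[OF this] have err0: "err \<longlonglongrightarrow> 0"
    by (simp only: e[symmetric]) simp
  have le: "(n2 (\<eta> k b))\<^sup>2 - err k \<le> n2 (x k) * n2 (\<eta> k ?h)" for k
    using cauchy_schwarz[of "x k" "\<eta> k ?h"] complex_Re_le_cmod[of "\<phi> (nc_star (x k) * \<eta> k ?h)"]
    by (simp add: err_def)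
  have "(\<lambda>k. (n2 (\<eta> k b))\<^sup>2 - err k) \<longlonglongrightarrow> (\<eta>norm b)\<^sup>2 - 0"
    by (intro tendsto_intros eta_tendsto err0)
  moreover have "(\<lambda>k. n2 (x k) * n2 (\<eta> k ?h)) \<longlonglongrightarrow> \<Xi> * \<eta>norm ?h"
    by (intro tendsto_intros eta_tendsto x_norm)
  ultimately show ?thesis using LIMSEQ_le le by fastforce
qed

lemma etanorm_le: "\<eta>norm b \<le> \<Xi> * nm b + n2 (L b)"
proof (rule LIMSEQ_le[OF eta_tendsto])
  show "(\<lambda>k. n2 (x k) * nm b + n2 (L b)) \<longlonglongrightarrow> \<Xi> * nm b + n2 (L b)"
    by (intro tendsto_intros x_norm)
  have "n2 (\<eta> k b) \<le> n2 (x k) * nm b + n2 (L b)" for k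
    using n2_diff_le[of "x k * b" "L b"] n2_mult_le'[of "x k" b] by (simp add: \<eta>_def)
  then show "\<exists>N. \<forall>n\<ge>N. n2 (\<eta> n b) \<le> n2 (x n) * nm b + n2 (L b)" by blast
qed

lemma n2_L_le: "n2 (L b) \<le> \<eta>norm b + \<Xi> * nm b"
proof (rule LIMSEQ_le_const)
  show "(\<lambda>k. n2 (\<eta> k b) + n2 (x k) * nm b) \<longlonglongrightarrow> \<eta>norm b + \<Xi> * nm b"
    by (intro tendsto_intros x_norm eta_tendsto)
  have "n2 (L b) \<le> n2 (\<eta> k b) + n2 (x k) * nm b" for k
    using n2_diff_le[of "x k * b" "\<eta> k b"] n2_mult_le'[of "x k" b] by (simp add: \<eta>_def)
  then show "\<exists>N. \<forall>k\<ge>N. n2 (L b) \<le> n2 (\<eta> k b) + n2 (x k) * nm b" by blast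
qed

text \<open>Each further factor adds one Leibniz term, so beyond \<open>r ^ m\<close> the growth is
  only linear in \<open>m\<close>. The dependence of \<open>C\<close> on \<open>h\<close> is
  harmless, since only the exponential rate matters.\<close>

lemma L_power_growth:
  assumes r: "r > 0" "nm h \<le> r"
  shows "\<exists>C\<ge>0. \<forall>m. n2 (L (h ^ m)) \<le> real m * C * r ^ m"
proof -
  obtain C where C: "C \<ge> 0" "\<And>a. n2 (lslice j (F a) h) \<le> C * n2 a" using n2_lslice_le by blast
  have n: "nm (h ^ m) \<le> r ^ m" for m
    by (rule order_trans[OF nm_power_le]) (intro power_mono r nm_nonneg)
  have "n2 (L (h ^ m)) \<le> real m * (C / r) * r ^ m" for m
  proof (induction m)
    case 0
    then show ?case using lslice_Nil[of j "F 1"] by (simp add: word_Nil)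
  next
    case (Suc m)
    have "L (h ^ Suc m) = L (h ^ m) * h + lslice j (F (h ^ m)) h"
      using lslice_mult[of j 1 "h ^ m" h] by (simp add: power_commutes)
    then have "n2 (L (h ^ Suc m)) \<le> n2 (L (h ^ m)) * nm h + C * n2 (h ^ m)"
      using n2_triangle[of "L (h ^ m) * h" "lslice j (F (h ^ m)) h"] n2_mult_le'[of "L (h ^ m)" h] C(2)[of "h ^ m"]
      by simp
    also have "\<dots> \<le> (real m * (C / r) * r ^ m) * r + C * r ^ m"
      using Suc r C n[of m] n2_le_nm[of "h ^ m"] by (intro add_mono mult_mono) auto
    also have "\<dots> = real (Suc m) * (C / r) * r ^ Suc m"
      using r by (simp add: field_simps)
    finally show ?case .
  qed
  then show ?thesis using C r by (intro exI[of _ "C / r"]) auto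
qed

text \<open>A spectral radius argument. If \<open>\<eta>norm h\<close> were
  \<open>q * \<Xi> * r\<close> with \<open>q > 1\<close>, iterating \<open>etanorm_sq_le\<close>
  along \<open>h ^ 2 ^ n\<close> would force growth like \<open>q ^ 2 ^ n * r ^ 2 ^ n\<close>,
  against the bound \<open>(\<Xi> + 2 ^ n * C) * r ^ 2 ^ n\<close> from
  \<open>L_power_growth\<close>.\<close>

lemma etanorm_self_adjoint_le:
  assumes h: "nc_star h = h" and r: "r > 0" "nm h \<le> r"
  shows "\<eta>norm h \<le> \<Xi> * r"
proof (rule ccontr)
  assume "\<not> \<eta>norm h \<le> \<Xi> * r"
  then have gt: "\<Xi> * r < \<eta>norm h" by simp
  then have eta0: "\<eta>norm h > 0" using Xi_nonneg r by (smt (verit) mult_nonneg_nonneg)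
  have Xi0: "\<Xi> > 0"
  proof (rule ccontr)
    assume "\<not> \<Xi> > 0"
    then have "\<Xi> = 0" using Xi_nonneg by simp
    then have "(\<eta>norm h)\<^sup>2 \<le> 0" using etanorm_sq_le[of h] by simp
    then show False using eta0 by simp
  qed
  define q where "q = \<eta>norm h / (\<Xi> * r)"
  have q: "q > 1" using gt Xi0 r by (simp add: q_def)
  have low: "q ^ 2 ^ n * \<Xi> * r ^ 2 ^ n \<le> \<eta>norm (h ^ 2 ^ n)" for n
  proof (induction n)
    case 0
    show ?case using Xi0 r by (simp add: q_def)
  next
    case (Suc n)
    have "(q ^ 2 ^ n * \<Xi> * r ^ 2 ^ n)\<^sup>2 \<le> (\<eta>norm (h ^ 2 ^ n))\<^sup>2"
      using Suc q Xi0 r by (intro power_mono) auto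
    also have "\<dots> \<le> \<Xi> * \<eta>norm (h ^ 2 ^ n * nc_star (h ^ 2 ^ n))" by (rule etanorm_sq_le)
    also have "h ^ 2 ^ n * nc_star (h ^ 2 ^ n) = h ^ 2 ^ Suc n"
      by (simp add: nc_star_power h power_add[symmetric] mult_2[symmetric])
    finally have "\<Xi> * (q ^ 2 ^ Suc n * \<Xi> * r ^ 2 ^ Suc n) \<le> \<Xi> * \<eta>norm (h ^ 2 ^ Suc n)"
      by (simp add: power_even_eq power_mult_distrib power2_eq_square ac_simps)
    then show ?case using Xi0 by simp
  qed
  obtain C where C: "C \<ge> 0" "\<And>m. n2 (L (h ^ m)) \<le> real m * C * r ^ m"
    using L_power_growth[OF r] by blast
  have up: "\<eta>norm (h ^ m) \<le> (\<Xi> + real m * C) * r ^ m" for m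
  proof -
    have "nm (h ^ m) \<le> r ^ m"
      by (rule order_trans[OF nm_power_le]) (intro power_mono r nm_nonneg)
    then have "\<Xi> * nm (h ^ m) \<le> \<Xi> * r ^ m" using Xi_nonneg by (rule mult_left_mono)
    then show ?thesis using etanorm_le[of "h ^ m"] C(2)[of m] by (simp add: algebra_simps)
  qed
  have key: "\<Xi> \<le> \<Xi> * (1/q) ^ 2 ^ n + C * (real (2 ^ n) * (1/q) ^ 2 ^ n)" for n
  proof -
    have "q ^ 2 ^ n * \<Xi> * r ^ 2 ^ n \<le> (\<Xi> + real (2 ^ n) * C) * r ^ 2 ^ n"
      using low[of n] up[of "2 ^ n"] by linarith
    then have "q ^ 2 ^ n * \<Xi> \<le> \<Xi> + real (2 ^ n) * C" using r by simp
    then show ?thesis using q by (simp add: power_one_over field_simps)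
  qed
  have lim: "(\<lambda>m. \<Xi> * (1/q) ^ m + C * (real m * (1/q) ^ m)) \<longlonglongrightarrow> \<Xi> * 0 + C * 0"
    using q by (intro tendsto_intros LIMSEQ_power_zero powser_times_n_limit_0) auto
  have sub: "strict_mono (\<lambda>n::nat. 2 ^ n :: nat)" by (simp add: strict_mono_def)
  have "(\<lambda>n. \<Xi> * (1/q) ^ 2 ^ n + C * (real (2 ^ n) * (1/q) ^ 2 ^ n)) \<longlonglongrightarrow> 0"
    using LIMSEQ_subseq_LIMSEQ[OF lim sub] by (simp add: o_def)
  then have "\<Xi> \<le> 0" by (rule LIMSEQ_le_const) (use key in blast)
  then show False using Xi0 by simp
qed

text \<open>Dabrowski's inequality. One more use of \<open>etanorm_sq_le\<close> reduces
  \<open>b\<close> to the self-adjoint \<open>b * nc_star b\<close> and gives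
  \<open>\<eta>norm b \<le> \<Xi> * r\<close>; the second \<open>\<Xi> * r\<close> pays for
  \<open>x k * b\<close> in \<open>L b = x k * b - \<eta> k b\<close>.\<close>

lemma n2_L_bound:
  assumes r: "r > 0" "nm b \<le> r"
  shows "n2 (L b) \<le> 2 * \<Xi> * r"
proof -
  have "nm (b * nc_star b) \<le> nm b * nm b" using nm_mult_le[of b "nc_star b"] by simp
  also have "\<dots> \<le> r * r" using r by (intro mult_mono) auto
  finally have "\<eta>norm (b * nc_star b) \<le> \<Xi> * (r * r)"
    using r by (intro etanorm_self_adjoint_le) (auto simp: nc_star_mult)
  then have "\<Xi> * \<eta>norm (b * nc_star b) \<le> \<Xi> * (\<Xi> * (r * r))" using Xi_nonneg by (rule mult_left_mono)
  then have "(\<eta>norm b)\<^sup>2 \<le> (\<Xi> * r)\<^sup>2" using etanorm_sq_le[of b] by (simp add: power2_eq_square ac_simps)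
  then have "\<eta>norm b \<le> \<Xi> * r" by (rule power2_le_imp_le) (use Xi_nonneg r in simp)
  moreover have "\<Xi> * nm b \<le> \<Xi> * r" using Xi_nonneg r by (intro mult_left_mono) auto
  ultimately show ?thesis using n2_L_le[of b] by simp
qed

text \<open>The Leibniz rule applied to \<open>v P w\<close> isolates the slice of \<open>\<partial>\<^sub>j P\<close> by \<open>v\<close> and \<open>w\<close>; the other
  three terms are small as soon as \<open>P w\<close> and \<open>v P\<close> are.\<close>

lemma slice_bound:
  assumes v: "r > 0" "nm v \<le> r" and w: "s > 0" "nm w \<le> s"
  shows "cmod (dslice j (F v) (G w) P) \<le> \<Xi> * (3 * r * n2 (P * w) + 2 * s * n2 (v * P))"
proof -
  have R: "rslice j (G 1) w = nc_star (L (nc_star w))" using star_lslice[of j 1 "nc_star w"] by simp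
  have "T (v * P * w) = \<phi> (L v * (P * w)) + dslice j (F v) (G 1) (P * w)"
    using dslice_mult[of j 1 1 v "P * w"] by (simp add: phi_lslice mult.assoc)
  also have "dslice j (F v) (G 1) (P * w) = dslice j (F v) (G w) P + \<phi> (v * P * nc_star (L (nc_star w)))"
    using dslice_mult[of j v 1 P w] by (simp add: phi_rslice R[symmetric])
  finally have "dslice j (F v) (G w) P = T (v * P * w) - \<phi> (L v * (P * w)) - \<phi> (v * P * nc_star (L (nc_star w)))"
    by simp
  \<comment> \<open>The first term costs \<open>\<Xi> * r\<close> by Cauchy-Schwarz against
    \<open>x k\<close>, the others \<open>2 * \<Xi> * r\<close> and \<open>2 * \<Xi> * s\<close> by
    \<open>n2_L_bound\<close>; hence the constants 3 and 2.\<close>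
  then have 0: "cmod (dslice j (F v) (G w) P) \<le>
      cmod (T (v * P * w)) + cmod (\<phi> (L v * (P * w))) + cmod (\<phi> (v * P * nc_star (L (nc_star w))))"
    using norm_triangle_ineq4[of "T (v * P * w) - \<phi> (L v * (P * w))" "\<phi> (v * P * nc_star (L (nc_star w)))"]
      norm_triangle_ineq4[of "T (v * P * w)" "\<phi> (L v * (P * w))"] by simp
  have "cmod (T (v * P * w)) \<le> \<Xi> * (r * n2 (P * w))"
  proof (rule LIMSEQ_le[OF tendsto_norm[OF x_pairing]])
    show "(\<lambda>k. n2 (x k) * (r * n2 (P * w))) \<longlonglongrightarrow> \<Xi> * (r * n2 (P * w))"
      by (intro tendsto_intros x_norm)
    have "cmod (\<phi> (x k * (v * P * w))) \<le> n2 (x k) * (r * n2 (P * w))" for k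
    proof -
      have "n2 (v * P * w) \<le> nm v * n2 (P * w)" using n2_mult_le[of v "P * w"] by (simp add: mult.assoc)
      also have "\<dots> \<le> r * n2 (P * w)" using v by (intro mult_right_mono) auto
      finally have "n2 (x k) * n2 (v * P * w) \<le> n2 (x k) * (r * n2 (P * w))" by (rule mult_left_mono) simp
      then show ?thesis using phi_mult_le[of "x k" "v * P * w"] by linarith
    qed
    then show "\<exists>N. \<forall>n\<ge>N. cmod (\<phi> (x n * (v * P * w))) \<le> n2 (x n) * (r * n2 (P * w))" by blast
  qed
  moreover have "cmod (\<phi> (L v * (P * w))) \<le> 2 * \<Xi> * r * n2 (P * w)"
    by (rule order_trans[OF phi_mult_le]) (intro mult_right_mono n2_L_bound v n2_nonneg)
  moreover have "cmod (\<phi> (v * P * nc_star (L (nc_star w)))) \<le> n2 (v * P) * (2 * \<Xi> * s)"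
  proof (rule order_trans[OF phi_mult_le])
    have "n2 (nc_star (L (nc_star w))) \<le> 2 * \<Xi> * s"
      using n2_L_bound[of s "nc_star w"] w by simp
    then show "n2 (v * P) * n2 (nc_star (L (nc_star w))) \<le> n2 (v * P) * (2 * \<Xi> * s)"
      by (rule mult_left_mono) simp
  qed
  ultimately show ?thesis using 0 by (simp add: algebra_simps)
qed

end

section \<open>Approximate kernels\<close>

text \<open>Expand the square: as \<open>op_adj S\<close> is a contraction, the cross term
  \<open>- 2 * (norm (S x))\<^sup>2\<close> absorbs the last term.\<close>

lemma norm_id_minus_adj_le:
  assumes S: "S \<in> bounded_ops" and n: "norm S \<le> 1"
  shows "norm (id_blinfun - (op_adj S o\<^sub>L S)) \<le> 1"
proof (rule norm_blinfun_bound)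
  fix x
  let ?S = "blinfun_apply S" and ?A = "blinfun_apply (op_adj S)"
  have 1: "inner (?A (?S x)) x = (norm (?S x))\<^sup>2"
    by (simp only: power2_norm_eq_inner inner_eq_Re_cinner cinner_op_adj'[OF S])
  have "norm (?A (?S x)) \<le> norm (op_adj S) * norm (?S x)" by (rule norm_blinfun)
  also have "\<dots> \<le> 1 * norm (?S x)" using n by (intro mult_right_mono) (auto simp: norm_op_adj S)
  finally have 2: "(norm (?A (?S x)))\<^sup>2 \<le> (norm (?S x))\<^sup>2" by (simp add: power_mono)
  have "(norm (x - ?A (?S x)))\<^sup>2 = (norm x)\<^sup>2 - 2 * inner (?A (?S x)) x + (norm (?A (?S x)))\<^sup>2"
    by (simp add: power2_norm_eq_inner inner_diff_left inner_diff_right inner_commute)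
  also have "\<dots> \<le> (norm x)\<^sup>2" using 1 2 zero_le_power2[of "norm (?S x)"] by linarith
  finally have "norm (x - ?A (?S x)) \<le> norm x" by (rule power2_le_imp_le) simp
  then show "norm (blinfun_apply (id_blinfun - (op_adj S o\<^sub>L S)) x) \<le> 1 * norm x"
    by (simp add: blinfun.diff_left)
qed simp

context tracial_tuple
begin

lemma ev_power: "ev (P ^ k) = op_prod (replicate k (ev P))"
  by (induction k) (simp_all add: op_prod_Nil op_prod_Cons ev_mult)

text \<open>If \<open>(nm T)\<^sup>2 \<le> c\<close>, then \<open>ev (gap c T)\<close> lies between
  0 and 1 and its powers decrease towards the projection onto the kernel of \<open>ev T\<close>;
  \<open>gap'\<close> does the same for the adjoint.\<close>

definition gap :: "real \<Rightarrow> 'i ncpoly \<Rightarrow> 'i ncpoly" where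
  "gap c T = 1 - cst (of_real (1/c)) * (nc_star T * T)"

definition gap' :: "real \<Rightarrow> 'i ncpoly \<Rightarrow> 'i ncpoly" where
  "gap' c T = 1 - cst (of_real (1/c)) * (T * nc_star T)"

lemma gap_star_eq: "gap c (nc_star T) = gap' c T"
  by (simp add: gap_def gap'_def)

lemma star_gap: "nc_star (gap c T) = gap c T"
  by (simp add: gap_def nc_star_diff nc_star_mult nc_star_cst cst_commute)

lemma star_gap_power: "nc_star (gap c T ^ k) = gap c T ^ k"
  by (simp add: nc_star_power star_gap)

lemma intertwine: "T * gap c T ^ k = gap' c T ^ k * T"
proof (induction k)
  case (Suc k)
  have 1: "T * gap c T = gap' c T * T"
    by (simp add: gap_def gap'_def algebra_simps cst_left_commute)
  have "T * gap c T ^ Suc k = gap' c T * (T * gap c T ^ k)"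
    by (simp add: mult.assoc[symmetric] 1)
  then show ?case by (simp add: Suc mult.assoc)
qed simp

lemma intertwine': "gap c T ^ k * nc_star T = nc_star T * gap' c T ^ k"
  using intertwine[of "nc_star T" c k] by (simp add: gap_star_eq[symmetric])

lemma ev_gap: "ev (gap c T) = id_blinfun - (1/c) *\<^sub>R (op_adj (ev T) o\<^sub>L ev T)"
  by (simp add: gap_def nc_eval_diff ev_mult nc_eval_cst ev_star op_scale_compose_left scaleR_eq_op_scale)

lemma nm_gap:
  assumes c: "c > 0" "(nm T)\<^sup>2 \<le> c"
  shows "nm (gap c T) \<le> 1"
proof -
  define S where "S = (1 / sqrt c) *\<^sub>R ev T"
  have "nm T \<le> sqrt c" using c by (simp add: real_le_rsqrt)
  then have "norm S \<le> 1" using c by (simp add: S_def nm_def field_simps)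
  moreover have "op_adj S o\<^sub>L S = (1/c) *\<^sub>R (op_adj (ev T) o\<^sub>L ev T)"
    using c by (simp add: S_def adj_scaleR bounded_bilinear.scaleR_left[OF bounded_bilinear_blinfun_compose]
        bounded_bilinear.scaleR_right[OF bounded_bilinear_blinfun_compose])
  ultimately show ?thesis
    using norm_id_minus_adj_le[of S] by (simp add: nm_def ev_gap S_def N_bounded N_scaleR)
qed

lemma nm_gap_power:
  assumes c: "c > 0" "(nm T)\<^sup>2 \<le> c"
  shows "nm (gap c T ^ k) \<le> 1" "nm (gap' c T ^ k) \<le> 1"
proof -
  have "nm (gap c T) ^ k \<le> 1" "nm (gap' c T) ^ k \<le> 1"
    using nm_gap[of c T] nm_gap[of c "nc_star T"] c by (auto simp: gap_star_eq intro!: power_le_one)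
  then show "nm (gap c T ^ k) \<le> 1" "nm (gap' c T ^ k) \<le> 1"
    using nm_power_le order_trans by blast+
qed

lemma gap_Suc: "gap c T ^ Suc k = gap c T ^ k - cst (of_real (1/c)) * (gap c T ^ k * (nc_star T * T))"
  by (simp only: power_Suc2) (simp add: gap_def right_diff_distrib cst_left_commute)

text \<open>Even powers are squares, and odd powers sandwich a single \<open>gap c T\<close>, whose
  positivity is the inequality \<open>n2 (T * z) \<le> nm T * n2 z\<close>.\<close>

lemma gap_nonneg:
  assumes c: "c > 0" "(nm T)\<^sup>2 \<le> c"
  shows "0 \<le> Re (\<phi> (nc_star y * gap c T ^ k * y))"
proof -
  have odd1: "0 \<le> Re (\<phi> (nc_star z * gap c T * z))" for z
  proof -
    have "nc_star z * gap c T * z = nc_star z * z - cst (of_real (1/c)) * (nc_star (T * z) * (T * z))"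
      by (simp add: gap_def nc_star_mult algebra_simps cst_left_commute)
    then have "Re (\<phi> (nc_star z * gap c T * z)) = (n2 z)\<^sup>2 - (1/c) * (n2 (T * z))\<^sup>2"
      by (simp add: phi_diff phi_cst phi_star_mult del: of_real_power of_real_divide)
    moreover have "(n2 (T * z))\<^sup>2 \<le> c * (n2 z)\<^sup>2"
    proof -
      have "(n2 (T * z))\<^sup>2 \<le> (nm T * n2 z)\<^sup>2" by (intro power_mono n2_mult_le n2_nonneg)
      also have "\<dots> \<le> c * (n2 z)\<^sup>2" using c by (simp add: power_mult_distrib mult_right_mono)
      finally show ?thesis .
    qed
    then have "(1/c) * (n2 (T * z))\<^sup>2 \<le> (n2 z)\<^sup>2" using c by (simp add: field_simps)
    ultimately show ?thesis by linarith
  qed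
  have sq: "nc_star (gap c T ^ l * y) = nc_star y * gap c T ^ l" for l
    by (simp add: nc_star_mult star_gap_power)
  show ?thesis
  proof (cases "even k")
    case True
    then obtain l where k: "k = l + l" by (auto elim: evenE simp: mult_2)
    have "nc_star y * gap c T ^ k * y = nc_star (gap c T ^ l * y) * (gap c T ^ l * y)"
      by (simp add: sq k power_add mult.assoc)
    then show ?thesis by (simp add: phi_star_mult del: of_real_power)
  next
    case False
    then obtain l where k: "k = Suc (l + l)" by (auto elim: oddE simp: mult_2)
    have "nc_star y * gap c T ^ k * y = nc_star (gap c T ^ l * y) * gap c T * (gap c T ^ l * y)"
      by (simp add: sq k power_add power_commutes mult.assoc)
    then show ?thesis by (simp add: odd1)
  qed
qed

lemma Re_phi_cst: "Re (\<phi> (cst (of_real r) * P)) = r * Re (\<phi> P)"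
  by (simp add: phi_cst)

text \<open>The numbers \<open>\<tau>(T* T B\<^sup>i)\<close>, \<open>B = 1 - T* T / c\<close>, decrease in \<open>i\<close>, and their sum telescopes
  to at most \<open>c\<close>.\<close>

lemma n2_gap_power:
  assumes c: "c > 0" "(nm T)\<^sup>2 \<le> c"
  shows "real (Suc (2 * k)) * (n2 (T * gap c T ^ k))\<^sup>2 \<le> c"
proof -
  define A where "A = nc_star T * T"
  define a where "a i = Re (\<phi> (gap c T ^ i * A))" for i
  have starA: "nc_star A = A" by (simp add: A_def nc_star_mult)
  have dec1: "a (Suc i) \<le> a i" for i
  proof -
    have "gap c T ^ Suc i * A = gap c T ^ i * A - cst (of_real (1/c)) * (gap c T ^ i * A * A)"
      by (simp only: gap_Suc A_def[symmetric]) (simp add: algebra_simps)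
    then have "a (Suc i) = a i - (1/c) * Re (\<phi> (gap c T ^ i * A * A))"
      unfolding a_def by (simp only: phi_diff minus_complex.sel Re_phi_cst)
    also have "\<phi> (gap c T ^ i * A * A) = \<phi> (nc_star A * gap c T ^ i * A)"
      by (subst phi_comm) (simp add: starA mult.assoc)
    finally show ?thesis using gap_nonneg[OF c, of A i] c by simp
  qed
  have dec: "a n \<le> a i" if "i \<le> n" for i n
    using that dec1 by (rule lift_Suc_antimono_le[rotated])
  have tel: "Re (\<phi> (gap c T ^ n)) = 1 - (1/c) * (\<Sum>i<n. a i)" for n
  proof (induction n)
    case (Suc n)
    have "Re (\<phi> (gap c T ^ Suc n)) = Re (\<phi> (gap c T ^ n)) - (1/c) * a n"
      unfolding a_def A_def by (simp only: gap_Suc phi_diff minus_complex.sel Re_phi_cst)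
    then show ?case by (simp add: Suc distrib_left)
  qed (simp add: phi_1)
  have "real (Suc (2 * k)) * a (2 * k) = (\<Sum>i<Suc (2 * k). a (2 * k))" by simp
  also have "\<dots> \<le> (\<Sum>i<Suc (2 * k). a i)" by (intro sum_mono dec) simp
  also have "\<dots> \<le> c"
  proof -
    have "0 \<le> Re (\<phi> (gap c T ^ Suc (2 * k)))" using gap_nonneg[OF c, of 1 "Suc (2 * k)"] by simp
    then have "(1/c) * (\<Sum>i<Suc (2 * k). a i) \<le> 1" using tel[of "Suc (2 * k)"] by linarith
    then show ?thesis using c by (simp add: field_simps del: sum.lessThan_Suc)
  qed
  also have "a (2 * k) = (n2 (T * gap c T ^ k))\<^sup>2"
  proof -
    have "\<phi> (nc_star (T * gap c T ^ k) * (T * gap c T ^ k)) = \<phi> (gap c T ^ k * (nc_star T * T * gap c T ^ k))"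
      by (simp add: nc_star_mult star_gap_power mult.assoc)
    also have "\<dots> = \<phi> (A * (gap c T ^ k * gap c T ^ k))"
      by (simp only: phi_comm[of "gap c T ^ k"] A_def mult.assoc)
    also have "\<dots> = \<phi> (gap c T ^ (2 * k) * A)"
      by (simp only: phi_comm[of A] mult_2 power_add)
    finally show ?thesis by (simp add: n2_sq a_def)
  qed
  finally show ?thesis .
qed

text \<open>An approximate form of the fact that the kernels of an operator and of its adjoint have
  equal dimension. It expresses the trace of \<open>v\<close> by \<open>u\<close>, and with it the
  leading coefficient of the slice.\<close>

lemma phi_gap_power: "\<phi> (gap' c T ^ k) = \<phi> (gap c T ^ k)"
proof (induction k)
  case (Suc k)
  have "gap' c T ^ Suc k = gap' c T ^ k - cst (of_real (1/c)) * (gap' c T ^ k * (T * nc_star T))"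
    using gap_Suc[of c "nc_star T" k] by (simp add: gap_star_eq)
  moreover have "\<phi> (gap' c T ^ k * (T * nc_star T)) = \<phi> (gap c T ^ k * (nc_star T * T))"
    by (metis intertwine mult.assoc phi_comm)
  ultimately show ?case using Suc by (simp only: gap_Suc phi_diff phi_cst)
qed simp

lemma phi_gap_power_sq: "\<phi> (gap c T ^ (2 * k)) = of_real ((n2 (gap c T ^ k))\<^sup>2)"
  using phi_star_mult[of "gap c T ^ k"] by (simp add: star_gap_power mult_2 power_add del: of_real_power)

text \<open>Each factor \<open>gap c T\<close> lowers the pairing of \<open>p\<close> with
  \<open>gap c T ^ n * p\<close> by at most \<open>(n2 (T * p))\<^sup>2 / c\<close>, so
  \<open>k\<close> factors leave half of \<open>(n2 p)\<^sup>2\<close>. Cauchy-Schwarz then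
  transfers the mass from \<open>p\<close> to \<open>gap c T ^ k\<close>, a polynomial in
  \<open>T\<close> and its adjoint.\<close>

lemma gap_power_lower:
  assumes c: "c > 0" "(nm T)\<^sup>2 \<le> c" and p: "nm p \<le> 1"
    and k: "real k * (n2 (T * p))\<^sup>2 \<le> c / 2 * (n2 p)\<^sup>2"
  shows "n2 p / 2 \<le> n2 (gap c T ^ k)"
proof -
  have tel: "(n2 p)\<^sup>2 - Re (\<phi> (nc_star p * gap c T ^ n * p)) \<le> real n / c * (n2 (T * p))\<^sup>2" for n
  proof (induction n)
    case 0
    then show ?case by (simp add: phi_star_mult del: of_real_power)
  next
    case (Suc n)
    have e: "gap c T ^ n * (nc_star T * (T * p)) = nc_star T * (gap' c T ^ n * (T * p))"
      by (simp only: mult.assoc[symmetric] intertwine')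
    have "nc_star p * gap c T ^ Suc n * p = nc_star p * gap c T ^ n * p
        - cst (of_real (1/c)) * (nc_star (T * p) * (gap' c T ^ n * (T * p)))"
      unfolding gap_Suc
      by (simp add: nc_star_mult right_diff_distrib left_diff_distrib cst_left_commute mult.assoc e)
    then have "Re (\<phi> (nc_star p * gap c T ^ Suc n * p)) =
        Re (\<phi> (nc_star p * gap c T ^ n * p)) - (1/c) * Re (\<phi> (nc_star (T * p) * (gap' c T ^ n * (T * p))))"
      by (simp only: phi_diff minus_complex.sel Re_phi_cst)
    moreover have "Re (\<phi> (nc_star (T * p) * (gap' c T ^ n * (T * p)))) \<le> (n2 (T * p))\<^sup>2"
    proof -
      have "n2 (gap' c T ^ n * (T * p)) \<le> nm (gap' c T ^ n) * n2 (T * p)" by (rule n2_mult_le)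
      also have "\<dots> \<le> 1 * n2 (T * p)" using nm_gap_power(2)[OF c] by (intro mult_right_mono) auto
      finally have "n2 (T * p) * n2 (gap' c T ^ n * (T * p)) \<le> n2 (T * p) * n2 (T * p)"
        by (intro mult_left_mono) auto
      then show ?thesis
        using cauchy_schwarz[of "T * p" "gap' c T ^ n * (T * p)"]
          complex_Re_le_cmod[of "\<phi> (nc_star (T * p) * (gap' c T ^ n * (T * p)))"]
        by (simp add: power2_eq_square)
    qed
    then have "(1/c) * Re (\<phi> (nc_star (T * p) * (gap' c T ^ n * (T * p)))) \<le> (1/c) * (n2 (T * p))\<^sup>2"
      using c by (intro mult_left_mono) auto
    ultimately show ?case using Suc by (simp add: add_divide_distrib distrib_right)
  qed
  have "real k / c * (n2 (T * p))\<^sup>2 \<le> (n2 p)\<^sup>2 / 2" using k c by (simp add: field_simps)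
  then have "(n2 p)\<^sup>2 / 2 \<le> Re (\<phi> (nc_star p * gap c T ^ k * p))" using tel[of k] by linarith
  also have "\<phi> (nc_star p * gap c T ^ k * p) = \<phi> (gap c T ^ k * (p * nc_star p))"
    by (metis mult.assoc phi_comm)
  also have "Re \<dots> \<le> n2 (gap c T ^ k) * n2 (p * nc_star p)"
    using phi_mult_le[of "gap c T ^ k" "p * nc_star p"] complex_Re_le_cmod order_trans by blast
  also have "\<dots> \<le> n2 (gap c T ^ k) * (1 * n2 p)"
  proof (rule mult_left_mono)
    show "n2 (p * nc_star p) \<le> 1 * n2 p"
      using n2_mult_le[of p "nc_star p"] mult_right_mono[OF p, of "n2 p"] by simp
  qed simp
  finally have "n2 p * (n2 p / 2) \<le> n2 p * n2 (gap c T ^ k)" by (simp add: power2_eq_square ac_simps)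
  then show ?thesis by (cases "n2 p = 0") (auto simp: order_less_le)
qed

end

context tracial
begin

text \<open>The vectors in \<open>near_kernel\<close> are arbitrary elements of \<open>N\<close>,
  not polynomials in the given tuple, so the estimates are transferred to operators through
  \<open>generic_tuple\<close>.\<close>

lemma norm2_triangle: "a \<in> N \<Longrightarrow> b \<in> N \<Longrightarrow> norm2 \<tau> (a + b) \<le> norm2 \<tau> a + norm2 \<tau> b"
  and norm2_mult_le: "a \<in> N \<Longrightarrow> b \<in> N \<Longrightarrow> norm2 \<tau> (a o\<^sub>L b) \<le> norm a * norm2 \<tau> b"
  and norm2_nonneg: "a \<in> N \<Longrightarrow> 0 \<le> norm2 \<tau> a"
  and norm2_scale: "a \<in> N \<Longrightarrow> norm2 \<tau> (op_scale z a) = cmod z * norm2 \<tau> a"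
  and norm2_uminus: "a \<in> N \<Longrightarrow> norm2 \<tau> (- a) = norm2 \<tau> a"
  and norm2_sq: "a \<in> N \<Longrightarrow> (norm2 \<tau> a)\<^sup>2 = Re (\<tau> (op_adj a o\<^sub>L a))"
  and norm2_le_norm: "a \<in> N \<Longrightarrow> norm2 \<tau> a \<le> norm a"
  and norm2_gap: "a \<in> N \<Longrightarrow> b \<in> N \<Longrightarrow> c > 0 \<Longrightarrow> (norm a)\<^sup>2 \<le> c \<Longrightarrow> norm b \<le> 1 \<Longrightarrow>
     real k * (norm2 \<tau> (a o\<^sub>L b))\<^sup>2 \<le> c / 2 * (norm2 \<tau> b)\<^sup>2 \<Longrightarrow>
     norm2 \<tau> b / 2 \<le> norm2 \<tau> (op_prod (replicate k (id_blinfun - (1/c) *\<^sub>R (op_adj a o\<^sub>L a))))"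
proof -
  have *: "\<exists>Y P Q. tracial_tuple N \<tau> (Y :: nat \<Rightarrow> 'h op) \<and> a = nc_eval Y P \<and> b = nc_eval Y Q"
    if "a \<in> N" "b \<in> N" for a b
    using generic_tuple[of "\<lambda>k. if k = 0 then a else b"] that
    by (smt (verit) zero_neq_one)
  {
    assume "a \<in> N" "b \<in> N"
    then obtain Y :: "nat \<Rightarrow> 'h op" and P Q where Y: "tracial_tuple N \<tau> Y" and e: "a = nc_eval Y P" "b = nc_eval Y Q"
      using * by blast
    interpret Y: tracial_tuple N \<tau> Y by fact
    show "norm2 \<tau> (a + b) \<le> norm2 \<tau> a + norm2 \<tau> b"
      using Y.n2_triangle[of P Q] by (simp add: e Y.n2_def nc_eval_add)
    show "norm2 \<tau> (a o\<^sub>L b) \<le> norm a * norm2 \<tau> b"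
      using Y.n2_mult_le[of P Q] by (simp add: e Y.n2_def Y.nm_def Y.ev_mult)
    show "norm2 \<tau> b / 2 \<le> norm2 \<tau> (op_prod (replicate k (id_blinfun - (1/c) *\<^sub>R (op_adj a o\<^sub>L a))))"
      if "c > 0" "(norm a)\<^sup>2 \<le> c" "norm b \<le> 1" "real k * (norm2 \<tau> (a o\<^sub>L b))\<^sup>2 \<le> c / 2 * (norm2 \<tau> b)\<^sup>2"
      using Y.gap_power_lower[of c P Q k] that
      by (simp add: e Y.n2_def Y.nm_def Y.ev_mult Y.ev_power Y.ev_gap)
  }
  {
    assume "a \<in> N"
    then obtain Y :: "nat \<Rightarrow> 'h op" and P where Y: "tracial_tuple N \<tau> Y" and e: "a = nc_eval Y P"
      using *[of a a] by blast
    interpret Y: tracial_tuple N \<tau> Y by fact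
    show "0 \<le> norm2 \<tau> a" using Y.n2_nonneg[of P] by (simp add: e Y.n2_def)
    show "norm2 \<tau> (op_scale z a) = cmod z * norm2 \<tau> a"
      using Y.n2_cst[of z P] by (simp add: e Y.n2_def Y.ev_mult nc_eval_cst op_scale_compose_left)
    show "norm2 \<tau> (- a) = norm2 \<tau> a" using Y.n2_minus[of P] by (simp add: e Y.n2_def nc_eval_minus)
    show "(norm2 \<tau> a)\<^sup>2 = Re (\<tau> (op_adj a o\<^sub>L a))"
      using Y.n2_sq[of P] by (simp add: e Y.n2_def Y.\<phi>_def Y.ev_mult Y.ev_star)
    show "norm2 \<tau> a \<le> norm a" using Y.n2_le_nm[of P] by (simp add: e Y.n2_def Y.nm_def)
  }
qed

lemma norm2_diff_le: "a \<in> N \<Longrightarrow> b \<in> N \<Longrightarrow> norm2 \<tau> (a - b) \<le> norm2 \<tau> a + norm2 \<tau> b"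
  using norm2_triangle[of a "- b"] by (simp add: norm2_uminus N_uminus)

end

section \<open>Reduction of the degree\<close>

definition cnorm :: "'i ncpoly \<Rightarrow> real" where
  "cnorm P = (\<Sum>w\<in>keys P. cmod (lookup P w))"

lemma cnorm_nonneg: "0 \<le> cnorm P"
  by (simp add: cnorm_def sum_nonneg)

lemma cnorm_single: "cnorm (single w c) = cmod c"
  unfolding cnorm_def by (rule sum_keys_single[where h = "\<lambda>w c. cmod c"]) simp

lemma cnorm_add_le: "cnorm (P + Q) \<le> cnorm P + cnorm Q"
proof -
  let ?K = "keys P \<union> keys Q"
  have e: "cnorm R = (\<Sum>k\<in>?K. cmod (lookup R k))" if "keys R \<subseteq> ?K" for R
    unfolding cnorm_def using that by (intro sum.mono_neutral_left) (auto simp: in_keys_iff)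
  show ?thesis
    by (simp only: e[OF Poly_Mapping.keys_add] e[OF Un_upper1] e[OF Un_upper2] sum.distrib[symmetric])
      (simp add: lookup_add sum_mono norm_triangle_ineq)
qed

lemma cnorm_sum_le: "cnorm (sum h A) \<le> (\<Sum>a\<in>A. cnorm (h a))"
proof (induction A rule: infinite_finite_induct)
  case (insert a A)
  then show ?case using cnorm_add_le[of "h a" "sum h A"] by simp
qed (simp_all add: cnorm_def)

lemma card_facs: "card (facs j w) \<le> length w"
proof -
  have "facs j w \<subseteq> (\<lambda>k. (take k w, drop (Suc k) w)) ` {..<length w}"
  proof clarify
    fix u v assume "(u, v) \<in> facs j w"
    then show "(u, v) \<in> (\<lambda>k. (take k w, drop (Suc k) w)) ` {..<length w}"
      by (intro image_eqI[where x = "length u"]) (auto simp: facs_def)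
  qed
  then have "card (facs j w) \<le> card ((\<lambda>k. (take k w, drop (Suc k) w)) ` {..<length w})"
    by (rule card_mono[rotated]) simp
  also have "\<dots> \<le> length w" using card_image_le[of "{..<length w}"] by fastforce
  finally show ?thesis .
qed

lemma cnorm_lslice_le:
  assumes len: "\<And>w. w \<in> keys P \<Longrightarrow> length w \<le> Suc d"
    and f: "\<And>u. length u \<le> d \<Longrightarrow> cmod (f u) \<le> C"
  shows "cnorm (lslice j f P) \<le> real (Suc d) * C * cnorm P"
proof -
  have C: "C \<ge> 0" by (rule order_trans[OF norm_ge_zero f[of "[]"]]) simp
  have inner: "cnorm (\<Sum>(u, v)\<in>facs j w. cst (lookup P w * f u) * word v)
      \<le> real (Suc d) * C * cmod (lookup P w)" if w: "w \<in> keys P" for w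
  proof -
    have "cnorm (\<Sum>(u, v)\<in>facs j w. cst (lookup P w * f u) * word v)
      \<le> (\<Sum>x\<in>facs j w. cmod (lookup P w) * C)"
    proof (rule order_trans[OF cnorm_sum_le], rule sum_mono)
      fix x assume x: "x \<in> facs j w"
      obtain u v where uv: "x = (u, v)" by (cases x)
      have "length u \<le> d" using x len[OF w] by (auto simp: facs_def uv)
      then have "cmod (f u) \<le> C" by (rule f)
      then show "cnorm (case x of (u, v) \<Rightarrow> cst (lookup P w * f u) * word v)
         \<le> cmod (lookup P w) * C"
        by (simp add: uv cst_def single_times cnorm_single norm_mult mult_left_mono)
    qed
    also have "\<dots> = real (card (facs j w)) * (cmod (lookup P w) * C)" by simp
    also have "\<dots> \<le> real (Suc d) * (cmod (lookup P w) * C)"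
      using card_facs[of j w] len[OF w] C by (intro mult_right_mono mult_nonneg_nonneg) auto
    finally show ?thesis by (simp add: ac_simps)
  qed
  have "cnorm (lslice j f P) \<le> (\<Sum>w\<in>keys P. real (Suc d) * C * cmod (lookup P w))"
    unfolding lslice_def by (rule order_trans[OF cnorm_sum_le], rule sum_mono) (rule inner)
  then show ?thesis by (simp add: cnorm_def sum_distrib_left)
qed

lemma lookup_lslice: "lookup (lslice j f P) z =
  (\<Sum>w\<in>keys P. \<Sum>x\<in>facs j w. if snd x = z then lookup P w * f (fst x) else 0)"
  unfolding lslice_def lookup_sum
  by (intro sum.cong refl) (auto simp: lookup_cst_mult lookup_single when_def)

lemma keys_lslice:
  assumes len: "\<And>w. w \<in> keys P \<Longrightarrow> length w \<le> Suc d"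
    and z: "z \<in> keys (lslice j f P)"
  shows "length z \<le> d"
proof (rule ccontr)
  assume z': "\<not> length z \<le> d"
  have "lookup (lslice j f P) z = 0"
    unfolding lookup_lslice
  proof (intro sum.neutral ballI)
    fix w x assume "w \<in> keys P" "x \<in> facs j w"
    then show "(if snd x = z then lookup P w * f (fst x) else 0) = 0"
      using z' len[of w] by (auto simp: facs_def)
  qed
  then show False using z by (simp add: in_keys_iff)
qed

text \<open>In a word of length at most \<open>Suc (length z)\<close>, the tail \<open>z\<close>
  forces an empty left factor. For the functional \<open>F v\<close> the coefficient is thus
  multiplied by the trace of \<open>v\<close>.\<close>

lemma lookup_lslice_top:
  assumes len: "\<And>w. w \<in> keys P \<Longrightarrow> length w \<le> Suc (length z)"
  shows "lookup (lslice j f P) z = lookup P (j # z) * f []"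
proof -
  have "(\<Sum>x\<in>facs j w. if snd x = z then lookup P w * f (fst x) else 0) =
     (if w = j # z then lookup P w * f [] else 0)" if w: "w \<in> keys P" for w
  proof -
    have e: "snd x = z \<longleftrightarrow> w = j # z \<and> x = ([], z)" if "x \<in> facs j w" for x
      using that len[OF w] by (cases x) (auto simp: facs_def)
    have "(\<Sum>x\<in>facs j w. if snd x = z then lookup P w * f (fst x) else 0) =
      (\<Sum>x\<in>facs j w. if x = ([], z) then (if w = j # z then lookup P w * f [] else 0) else 0)"
      by (rule sum.cong) (auto simp: e)
    also have "\<dots> = (if w = j # z then lookup P w * f [] else 0)"
      by (subst sum.delta[OF finite_facs]) (auto simp: facs_def)
    finally show ?thesis .
  qed
  then show ?thesis
    unfolding lookup_lslice by (simp add: in_keys_iff)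
qed

lemma norm_op_prod_le:
  assumes R: "R \<ge> 1" "\<And>i. norm (X i) \<le> R"
  shows "norm (op_prod (map X w)) \<le> R ^ length w"
proof (induction w)
  case Nil
  then show ?case by (simp add: op_prod_Nil norm_blinfun_id_le)
next
  case (Cons i w)
  have "norm (op_prod (map X (i # w))) \<le> norm (X i) * norm (op_prod (map X w))"
    by (simp add: op_prod_Cons norm_blinfun_compose)
  also have "\<dots> \<le> R * R ^ length w" using Cons R by (intro mult_mono) auto
  finally show ?case by simp
qed

lemma op_scale_diff: "op_scale c (S - T) = op_scale c S - op_scale c T"
  using op_scale_add_right[of c "S - T" T] by simp

lemma norm_op_prod_diff_le:
  assumes R: "R \<ge> 1" "\<And>i. norm (X i) \<le> R" "\<And>i. norm (X' i) \<le> R"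
    and s: "\<And>i. norm (X' i - X i) \<le> s"
  shows "norm (op_prod (map X' w) - op_prod (map X w)) \<le> real (length w) * R ^ length w * s"
proof (induction w)
  case (Cons i w)
  have s0: "0 \<le> s" using s[of i] norm_ge_zero[of "X' i - X i"] by linarith
  have "op_prod (map X' (i # w)) - op_prod (map X (i # w)) =
     (X' i o\<^sub>L (op_prod (map X' w) - op_prod (map X w))) + ((X' i - X i) o\<^sub>L op_prod (map X w))"
    by (simp add: op_prod_Cons compose_distribs)
  then have "norm (op_prod (map X' (i # w)) - op_prod (map X (i # w))) \<le>
     norm (X' i) * norm (op_prod (map X' w) - op_prod (map X w)) + norm (X' i - X i) * norm (op_prod (map X w))"
    using norm_triangle_ineq norm_blinfun_compose by (smt (verit))
  also have "\<dots> \<le> R * (real (length w) * R ^ length w * s) + s * (R * R ^ length w)"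
  proof (intro add_mono mult_mono)
    show "norm (op_prod (map X w)) \<le> R * R ^ length w"
      using norm_op_prod_le[of R X w] R mult_mono[of 1 R "norm (op_prod (map X w))" "R ^ length w"] by simp
  qed (use Cons R s s0 in auto)
  also have "\<dots> = real (length (i # w)) * R ^ length (i # w) * s" by (simp add: algebra_simps)
  finally show ?case .
qed (simp add: op_prod_Nil)

lemma norm_nc_eval_diff_le:
  assumes R: "R \<ge> 1" "\<And>i. norm (X i) \<le> R" "\<And>i. norm (X' i) \<le> R"
    and s: "\<And>i. norm (X' i - X i) \<le> s"
    and len: "\<And>w. w \<in> keys P \<Longrightarrow> length w \<le> d"
  shows "norm (nc_eval X' P - nc_eval X P) \<le> cnorm P * (real d * R ^ d * s)"
proof -
  have s0: "0 \<le> s" using s[of undefined] norm_ge_zero[of "X' undefined - X undefined"] by linarith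
  have "nc_eval X' P - nc_eval X P = (\<Sum>w\<in>keys P.
     op_scale (lookup P w) (op_prod (map X' w) - op_prod (map X w)))"
    by (simp add: nc_eval_def sum_subtractf op_scale_diff)
  also have "norm \<dots> \<le> (\<Sum>w\<in>keys P. cmod (lookup P w) * (real d * R ^ d * s))"
  proof (rule sum_norm_le)
    fix w assume w: "w \<in> keys P"
    have "norm (op_prod (map X' w) - op_prod (map X w)) \<le> real (length w) * R ^ length w * s"
      by (rule norm_op_prod_diff_le[OF R s])
    also have "\<dots> \<le> real d * R ^ d * s"
      using len[OF w] R s0 by (intro mult_right_mono mult_mono power_increasing) auto
    finally have "cmod (lookup P w) * norm (op_prod (map X' w) - op_prod (map X w)) \<le>
       cmod (lookup P w) * (real d * R ^ d * s)" by (rule mult_left_mono) simp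
    then show "norm (op_scale (lookup P w) (op_prod (map X' w) - op_prod (map X w))) \<le>
       cmod (lookup P w) * (real d * R ^ d * s)"
      using norm_op_scale_le order_trans by blast
  qed
  finally show ?thesis by (simp add: cnorm_def sum_distrib_right)
qed

lemma norm_nc_eval_le:
  assumes R: "R \<ge> 1" "\<And>i. norm (X i) \<le> R"
    and len: "\<And>w. w \<in> keys P \<Longrightarrow> length w \<le> d"
  shows "norm (nc_eval X P) \<le> cnorm P * R ^ d"
proof -
  have "norm (nc_eval X P) \<le> (\<Sum>w\<in>keys P. cmod (lookup P w) * R ^ d)"
    unfolding nc_eval_def
  proof (rule sum_norm_le)
    fix w assume w: "w \<in> keys P"
    have "norm (op_prod (map X w)) \<le> R ^ length w" by (rule norm_op_prod_le[OF R])
    also have "\<dots> \<le> R ^ d" using len[OF w] R by (intro power_increasing) auto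
    finally have "cmod (lookup P w) * norm (op_prod (map X w)) \<le> cmod (lookup P w) * R ^ d"
      by (rule mult_left_mono) simp
    then show "norm (op_scale (lookup P w) (op_prod (map X w))) \<le> cmod (lookup P w) * R ^ d"
      using norm_op_scale_le order_trans by blast
  qed
  then show ?thesis by (simp add: cnorm_def sum_distrib_right)
qed

section \<open>Near-kernels and the induction on the degree\<close>

context tracial
begin

text \<open>The form in which full free entropy dimension is used: one scale \<open>s\<close> bounds
  the distance of the tuples and also weighs the conjugate variables.\<close>

definition approximable :: "('i \<Rightarrow> 'h op) \<Rightarrow> bool" where
  "approximable X \<longleftrightarrow> (\<forall>e>0. \<exists>X' s. 0 < s \<and> s \<le> e \<and> tracial_tuple N \<tau> X' \<and> (\<forall>i. norm (X' i - X i) \<le> s) \<and>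
     (\<forall>j. \<exists>x \<Xi>. conjugate_variable N \<tau> X' j x \<Xi> \<and> \<Xi> * s \<le> e))"

lemma sum_in_N: "(\<And>x. x \<in> A \<Longrightarrow> f x \<in> N) \<Longrightarrow> sum f A \<in> N"
  by (induction A rule: infinite_finite_induct) (simp_all add: N_intros)

lemma op_prod_in_N: "set as \<subseteq> N \<Longrightarrow> op_prod as \<in> N"
  by (induction as) (simp_all add: op_prod_Nil op_prod_Cons N_intros)

text \<open>Polynomials of degree at most \<open>d\<close>, with bounded coefficients and a coefficient bounded away
  from 0 at the word \<open>w\<close>, that come arbitrarily close to having a kernel of a fixed size at \<open>X\<close>.
  The polynomial may vary with the precision, which spares a compactness argument in the
  induction on the degree.\<close>

definition near_kernel :: "('i \<Rightarrow> 'h op) \<Rightarrow> nat \<Rightarrow> real \<Rightarrow> 'i list \<Rightarrow> real \<Rightarrow> bool" where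
  "near_kernel X d K w a \<longleftrightarrow> (\<forall>e>0. \<exists>Q u. (\<forall>w\<in>keys Q. length w \<le> d) \<and> cnorm Q \<le> K \<and>
     a \<le> cmod (lookup Q w) \<and> u \<in> N \<and> norm u \<le> 1 \<and> a \<le> norm2 \<tau> u \<and>
     norm2 \<tau> (nc_eval X Q o\<^sub>L u) \<le> e)"

lemma near_kernel_0:
  assumes "a > 0"
  shows "\<not> near_kernel X 0 K [] a"
proof
  assume "near_kernel X 0 K [] a"
  then obtain Q u where Q: "\<And>w. w \<in> keys Q \<Longrightarrow> length w \<le> 0" "a \<le> cmod (lookup Q [])"
    and u: "u \<in> N" "a \<le> norm2 \<tau> u" and s: "norm2 \<tau> (nc_eval X Q o\<^sub>L u) \<le> a * a / 2"
    unfolding near_kernel_def using assms by (metis half_gt_zero mult_pos_pos)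
  have "Q = cst (lookup Q [])"
    by (rule poly_mapping_eqI) (use Q(1) in \<open>force simp: cst_def lookup_single when_def in_keys_iff\<close>)
  then have "norm2 \<tau> (nc_eval X Q o\<^sub>L u) = cmod (lookup Q []) * norm2 \<tau> u"
    by (metis (no_types) compose_id(2) nc_eval_cst norm2_scale op_scale_compose_left u(1))
  moreover have "a * a \<le> cmod (lookup Q []) * norm2 \<tau> u"
    using Q u assms by (intro mult_mono) auto
  moreover have "a * a > 0" using assms by simp
  ultimately show False using s by linarith
qed

text \<open>Slicing \<open>Q\<close> by \<open>v\<close> strips the letter \<open>j\<close> from the
  tracked word, and \<open>u = B ^ k\<close> evaluated at \<open>X'\<close> becomes the new vector.
  The old vector \<open>p\<close> serves to show that \<open>u\<close> keeps 2-norm at least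
  \<open>a / 2\<close>.\<close>

lemma near_kernel_step:
  fixes X :: "'i::finite \<Rightarrow> 'h op"
  assumes nk: "near_kernel X (Suc d) K (j # z) a" and a: "a > 0" and z: "length z = d"
    and ap: "approximable X" and X: "\<And>i. X i \<in> N"
  shows "\<exists>K' a'. a' > 0 \<and> near_kernel X d K' z a'"
proof -
  define R where "R = 2 + (\<Sum>i\<in>UNIV. norm (X i))"
  have XR: "norm (X i) + 1 \<le> R" for i
    using member_le_sum[of i UNIV "\<lambda>i. norm (X i)"] by (simp add: R_def)
  have R1: "R \<ge> 1" using sum_nonneg[of UNIV "\<lambda>i. norm (X i)"] by (simp add: R_def)
  have K0: "K \<ge> 0"
    using nk cnorm_nonneg unfolding near_kernel_def by (meson order_trans zero_less_one)
  \<comment> \<open>The constants depend on \<open>K\<close>, \<open>R\<close>, \<open>d\<close> and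
    \<open>a\<close>, not on the precision. \<open>M\<close> bounds \<open>Q(X')\<close> and
    \<open>M'\<close> bounds \<open>V\<close> and \<open>w\<close> in operator norm;
    \<open>C2 * s\<close> and \<open>C4 * s\<close> bound the 2-norms of \<open>T p\<close> and of
    \<open>T B ^ m\<close> for \<open>m \<ge> k\<close>; \<open>D * s\<close> bounds
    \<open>Q'(X') - Q'(X)\<close>.\<close>
  define M where "M = K * R ^ Suc d"
  have M0: "M \<ge> 0" using K0 R1 by (simp add: M_def)
  define c where "c = M\<^sup>2 + 1"
  have c0: "c > 0" by (simp add: c_def add_nonneg_pos)
  define C2 where "C2 = 1 + K * (real (Suc d) * R ^ Suc d)"
  have C2: "C2 \<ge> 1" using K0 R1 by (simp add: C2_def)
  define C4 where "C4 = 2 * C2 / a"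
  have C4: "C4 > 0" using a C2 by (simp add: C4_def)
  define K' where "K' = real (Suc d) * R ^ d * K"
  have K'0: "K' \<ge> 0" using K0 R1 by (simp add: K'_def)
  define M' where "M' = K' * R ^ d + 1"
  have M'1: "M' \<ge> 1" using K'0 R1 by (simp add: M'_def)
  define D where "D = K' * (real d * R ^ d)"
  have D0: "D \<ge> 0" using K'0 R1 by (simp add: D_def)
  \<comment> \<open>The first entry is for the 2-norm of \<open>u\<close>, the second for the
    leading coefficient: \<open>a\<close> times \<open>(a / 2)\<^sup>2\<close>, a lower bound for
    the trace of \<open>v\<close>.\<close>
  define a' where "a' = min (a / 2) (a * (a\<^sup>2 / 4))"
  have a': "a' > 0" using a by (simp add: a'_def)
  have "\<exists>Q u. (\<forall>w\<in>keys Q. length w \<le> d) \<and> cnorm Q \<le> K' \<and>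
     a' \<le> cmod (lookup Q z) \<and> u \<in> N \<and> norm u \<le> 1 \<and> a' \<le> norm2 \<tau> u \<and>
     norm2 \<tau> (nc_eval X Q o\<^sub>L u) \<le> e" if e: "e > 0" for e
  proof -
    \<comment> \<open>The three bounds keep \<open>X'\<close> within distance 1 of \<open>X\<close>,
      absorb the change from \<open>Q'(X')\<close> to \<open>Q'(X)\<close>, and absorb the slice
      bound. The last controls a squared 2-norm, hence \<open>(e/2)\<^sup>2\<close>.\<close>
    define e1 where "e1 = min 1 (min (e / (2 * (D + 1))) ((e/2)\<^sup>2 / (5 * C4 * M')))"
    have e1: "e1 > 0" "e1 \<le> 1" "e1 * (D + 1) \<le> e / 2" "5 * C4 * M' * e1 \<le> (e/2)\<^sup>2"
    proof -
      show "e1 > 0" using e D0 C4 M'1 by (simp add: e1_def)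
      show "e1 \<le> 1" by (simp add: e1_def)
      have "e1 \<le> e / (2 * (D + 1))" by (simp add: e1_def)
      then show "e1 * (D + 1) \<le> e / 2" using D0 by (simp add: field_simps)
      have "e1 \<le> (e/2)\<^sup>2 / (5 * C4 * M')" by (simp add: e1_def)
      moreover have "5 * C4 * M' > 0" using C4 M'1 by simp
      ultimately show "5 * C4 * M' * e1 \<le> (e/2)\<^sup>2" by (simp add: pos_le_divide_eq mult.commute)
    qed
    obtain X' s where s: "0 < s" "s \<le> e1" and tt: "tracial_tuple N \<tau> X'"
      and XX: "\<And>i. norm (X' i - X i) \<le> s"
      and cv: "\<And>j. \<exists>x \<Xi>. conjugate_variable N \<tau> X' j x \<Xi> \<and> \<Xi> * s \<le> e1"
      using ap e1(1) unfolding approximable_def by metis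
    obtain x \<Xi> where cvj: "conjugate_variable N \<tau> X' j x \<Xi>" and Xi: "\<Xi> * s \<le> e1" using cv by blast
    interpret X': conjugate_variable N \<tau> X' j x \<Xi> by (rule cvj)
    have X'R: "norm (X' i) \<le> R" for i
      using norm_triangle_sub[of "X' i" "X i"] XX[of i] XR[of i] s e1 by linarith
    have XR': "norm (X i) \<le> R" for i using XR[of i] by linarith
    \<comment> \<open>The precision is the scale \<open>s\<close> of \<open>X'\<close>, since
      passing from \<open>X\<close> to \<open>X'\<close> costs order \<open>s\<close> anyway; so
      \<open>Q\<close> and \<open>p\<close> are chosen after \<open>X'\<close>.\<close>
    obtain Q p where Q: "\<And>w. w \<in> keys Q \<Longrightarrow> length w \<le> Suc d" "cnorm Q \<le> K"
        "a \<le> cmod (lookup Q (j # z))"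
      and p: "p \<in> N" "norm p \<le> 1" "a \<le> norm2 \<tau> p" "norm2 \<tau> (nc_eval X Q o\<^sub>L p) \<le> s"
      using nk s(1) unfolding near_kernel_def by blast
    let ?T = "X'.ev Q"
    have XQ: "nc_eval X Q \<in> N"
      using X by (auto simp: nc_eval_def intro!: sum_in_N N_scale op_prod_in_N)
    have nT: "norm ?T \<le> M"
    proof -
      have "norm ?T \<le> cnorm Q * R ^ Suc d" using norm_nc_eval_le[of R X' Q "Suc d"] R1 X'R Q(1) by blast
      also have "\<dots> \<le> M" unfolding M_def using Q R1 by (intro mult_right_mono) auto
      finally show ?thesis .
    qed
    then have nTc: "(X'.nm Q)\<^sup>2 \<le> c" using power_mono[of "norm ?T" M 2] by (simp add: X'.nm_def c_def)
    have dT: "norm (?T - nc_eval X Q) \<le> K * (real (Suc d) * R ^ Suc d) * s"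
    proof -
      have "norm (?T - nc_eval X Q) \<le> cnorm Q * (real (Suc d) * R ^ Suc d * s)"
        using norm_nc_eval_diff_le[of R X X' s Q "Suc d"] R1 XR' X'R XX Q(1) by blast
      also have "\<dots> \<le> K * (real (Suc d) * R ^ Suc d * s)"
        using Q R1 s by (intro mult_right_mono) auto
      finally show ?thesis by (simp add: mult.assoc)
    qed
    have Tp: "norm2 \<tau> (?T o\<^sub>L p) \<le> C2 * s"
    proof -
      have "?T o\<^sub>L p = (nc_eval X Q o\<^sub>L p) + ((?T - nc_eval X Q) o\<^sub>L p)"
        by (simp add: compose_distribs)
      then have "norm2 \<tau> (?T o\<^sub>L p) \<le> s + norm (?T - nc_eval X Q) * norm2 \<tau> p"
        using norm2_triangle[of "nc_eval X Q o\<^sub>L p" "(?T - nc_eval X Q) o\<^sub>L p"]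
          norm2_mult_le[of "?T - nc_eval X Q" p] p XQ by (simp add: N_intros)
      also have "norm (?T - nc_eval X Q) * norm2 \<tau> p \<le> (K * (real (Suc d) * R ^ Suc d) * s) * 1"
        using dT norm2_le_norm[OF p(1)] p K0 R1 s by (intro mult_mono) (auto simp: norm2_nonneg)
      finally show ?thesis by (simp add: C2_def algebra_simps)
    qed
    define y where "y = c * a\<^sup>2 / (2 * (C2 * s)\<^sup>2)"
    have y0: "y \<ge> 0" using c0 by (simp add: y_def)
    txt \<open>The power is of order \<open>1 / s\<^sup>2\<close>: small enough for \<open>B\<^sup>k\<close> to retain half of \<open>p\<close>, and large enough
      for \<open>T B\<^sup>k = O(s)\<close>.\<close>
    define k where "k = nat \<lfloor>y\<rfloor>"
    have k1: "real k \<le> y" using y0 by (simp add: k_def)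
    have k2: "y \<le> real (Suc k)" using y0 by (simp add: k_def) linarith
    have Cs: "C2 * s > 0" using C2 s by simp
    define B where "B = X'.gap c Q"
    define u where "u = X'.ev (B ^ k)"
    have u_lower: "a / 2 \<le> norm2 \<tau> u"
    proof -
      have "real k * (norm2 \<tau> (?T o\<^sub>L p))\<^sup>2 \<le> y * (C2 * s)\<^sup>2"
        using k1 Tp p y0 by (intro mult_mono power_mono) (auto simp: norm2_nonneg N_intros)
      also have "\<dots> = c / 2 * a\<^sup>2" using C2 s by (simp add: y_def field_simps)
      also have "\<dots> \<le> c / 2 * (norm2 \<tau> p)\<^sup>2" using c0 p a by (intro mult_left_mono power_mono) auto
      finally have "norm2 \<tau> p / 2 \<le> norm2 \<tau> (op_prod (replicate k (id_blinfun - (1/c) *\<^sub>R (op_adj ?T o\<^sub>L ?T))))"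
        using norm2_gap[of ?T p c k] p c0 nTc by (simp add: X'.nm_def)
      then show ?thesis using p(3) by (simp add: u_def B_def X'.ev_power X'.ev_gap)
    qed
    have TB: "X'.n2 (Q * B ^ m) \<le> C4 * s" if m: "k \<le> m" for m
    proof -
      have n: "real (Suc (2 * m)) * (X'.n2 (Q * B ^ m))\<^sup>2 \<le> c"
        unfolding B_def by (rule X'.n2_gap_power[OF c0 nTc])
      have "y * (X'.n2 (Q * B ^ m))\<^sup>2 \<le> real (Suc (2 * m)) * (X'.n2 (Q * B ^ m))\<^sup>2"
        using k2 m by (intro mult_right_mono) auto
      with n have "y * (X'.n2 (Q * B ^ m))\<^sup>2 \<le> c" by linarith
      moreover have "2 * (C2 * s)\<^sup>2 > 0" using C2 s by simp
      ultimately have "c * (a\<^sup>2 * (X'.n2 (Q * B ^ m))\<^sup>2) \<le> c * (2 * (C2 * s)\<^sup>2)"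
        unfolding y_def by (simp only: times_divide_eq_left pos_divide_le_eq mult.assoc)
      then have "a\<^sup>2 * (X'.n2 (Q * B ^ m))\<^sup>2 \<le> 2 * (C2 * s)\<^sup>2"
        using c0 by (simp only: mult_le_cancel_left_pos)
      also have "\<dots> \<le> (2 * (C2 * s))\<^sup>2" by (simp add: power_mult_distrib)
      finally have "(a * X'.n2 (Q * B ^ m))\<^sup>2 \<le> (2 * (C2 * s))\<^sup>2" by (simp add: power_mult_distrib)
      then have "a * X'.n2 (Q * B ^ m) \<le> 2 * (C2 * s)" by (rule power2_le_imp_le) (use Cs in simp)
      then show ?thesis using a by (simp add: C4_def field_simps)
    qed
    \<comment> \<open>The exponent \<open>2 * k\<close> makes the trace of \<open>v\<close> equal to
      that of \<open>B ^ (2 * k)\<close>, the square of the 2-norm of \<open>u\<close>. Moreover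
      \<open>v * Q = Q * B ^ (2 * k)\<close> is small by \<open>TB\<close>.\<close>
    define v where "v = X'.gap' c Q ^ (2 * k)"
    have nu: "X'.nm (B ^ k) \<le> 1" and nv: "X'.nm v \<le> 1"
      unfolding B_def v_def by (rule X'.nm_gap_power[OF c0 nTc])+
    define Q' where "Q' = lslice j (X'.F v) Q"
    have Fv: "cmod (X'.F v w) \<le> R ^ d" if "length w \<le> d" for w
    proof -
      have "cmod (X'.F v w) \<le> X'.n2 v * X'.n2 (word w)" unfolding X'.F_def by (rule X'.phi_mult_le)
      also have "\<dots> \<le> 1 * R ^ d"
      proof (rule mult_mono)
        show "X'.n2 v \<le> 1" using X'.n2_le_nm[of v] nv by linarith
        have "X'.n2 (word w) \<le> norm (op_prod (map X' w))"
          using X'.n2_le_nm[of "word w"] by (simp add: X'.nm_def nc_eval_single)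
        also have "\<dots> \<le> R ^ length w" by (rule norm_op_prod_le[OF R1 X'R])
        also have "\<dots> \<le> R ^ d" using that R1 by (intro power_increasing) auto
        finally show "X'.n2 (word w) \<le> R ^ d" .
      qed auto
      finally show ?thesis by simp
    qed
    have Q'len: "length w \<le> d" if "w \<in> keys Q'" for w
      using keys_lslice[of Q d w j "X'.F v"] Q(1) that unfolding Q'_def by blast
    have Q'c: "cnorm Q' \<le> K'"
    proof -
      have "cnorm Q' \<le> real (Suc d) * R ^ d * cnorm Q"
        unfolding Q'_def using cnorm_lslice_le[of Q d "X'.F v" "R ^ d" j] Q(1) Fv by blast
      also have "\<dots> \<le> K'" unfolding K'_def using Q R1 by (intro mult_left_mono) auto
      finally show ?thesis .
    qed
    have top: "a' \<le> cmod (lookup Q' z)"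
    proof -
      have "X'.\<phi> v = of_real ((norm2 \<tau> u)\<^sup>2)"
        by (simp only: v_def X'.phi_gap_power X'.phi_gap_power_sq u_def B_def X'.n2_def)
      then have "X'.F v [] = of_real ((norm2 \<tau> u)\<^sup>2)" by (simp add: X'.F_def word_Nil)
      then have "cmod (lookup Q' z) = cmod (lookup Q (j # z)) * (norm2 \<tau> u)\<^sup>2"
        unfolding Q'_def using lookup_lslice_top[of Q z j "X'.F v"] Q(1) z
        by (simp add: norm_mult norm_power)
      also have "\<dots> \<ge> a * (a/2)\<^sup>2"
        using Q(3) u_lower a by (intro mult_mono power_mono) auto
      finally show ?thesis by (simp add: a'_def power_divide)
    qed
    have nQ': "norm (X'.ev Q') \<le> M' - 1"
    proof -
      have "norm (X'.ev Q') \<le> cnorm Q' * R ^ d" using norm_nc_eval_le[of R X' Q' d] R1 X'R Q'len by blast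
      also have "\<dots> \<le> K' * R ^ d" using Q'c R1 by (intro mult_right_mono) auto
      finally show ?thesis by (simp add: M'_def)
    qed
    define V where "V = Q' * B ^ k"
    have nV: "X'.nm V \<le> M'"
    proof -
      have "X'.nm V \<le> X'.nm Q' * X'.nm (B ^ k)" unfolding V_def by (rule X'.nm_mult_le)
      also have "\<dots> \<le> (M' - 1) * 1" using nQ' nu M'1 by (intro mult_mono) (auto simp: X'.nm_def)
      finally show ?thesis by simp
    qed
    \<comment> \<open>With this \<open>w\<close> the pairing in \<open>slice_bound\<close> is the
      trace of \<open>Q' * B ^ k * nc_star V\<close>, that is, the squared 2-norm of
      \<open>V\<close>. The factor \<open>B ^ k\<close> in front makes \<open>Q * w\<close>
      small.\<close>
    define w where "w = B ^ k * nc_star V"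
    have nw: "X'.nm w \<le> M'"
    proof -
      have "X'.nm w \<le> X'.nm (B ^ k) * X'.nm (nc_star V)" unfolding w_def by (rule X'.nm_mult_le)
      also have "\<dots> \<le> 1 * M'" using nu nV by (intro mult_mono) auto
      finally show ?thesis by simp
    qed
    have V2: "(X'.n2 V)\<^sup>2 \<le> \<Xi> * (3 * 1 * X'.n2 (Q * w) + 2 * M' * X'.n2 (v * Q))"
    proof -
      have "dslice j (X'.F v) (X'.G w) Q = X'.\<phi> (V * nc_star V)"
        by (simp add: X'.phi_lslice[symmetric] Q'_def V_def w_def mult.assoc)
      also have "\<dots> = of_real ((X'.n2 V)\<^sup>2)"
        using X'.phi_star_mult[of "nc_star V"] by simp
      finally have "cmod (dslice j (X'.F v) (X'.G w) Q) = (X'.n2 V)\<^sup>2"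
        by (simp add: norm_power)
      then show ?thesis
        using X'.slice_bound[of 1 v M' w Q] nv nw M'1 by simp
    qed
    have Qw: "X'.n2 (Q * w) \<le> C4 * s * M'"
    proof -
      have "X'.n2 (Q * w) \<le> X'.n2 (Q * B ^ k) * X'.nm (nc_star V)"
        unfolding w_def mult.assoc[symmetric] by (rule X'.n2_mult_le')
      also have "\<dots> \<le> C4 * s * M'" using TB[of k] nV C4 s by (intro mult_mono) auto
      finally show ?thesis .
    qed
    have vQ: "X'.n2 (v * Q) \<le> C4 * s"
      using TB[of "2 * k"] by (simp add: v_def B_def X'.intertwine)
    have "(X'.n2 V)\<^sup>2 \<le> (e/2)\<^sup>2"
    proof -
      have "3 * 1 * X'.n2 (Q * w) + 2 * M' * X'.n2 (v * Q) \<le> 3 * (C4 * s * M') + 2 * M' * (C4 * s)"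
        using Qw vQ M'1 by (intro add_mono mult_mono) auto
      then have "\<Xi> * (3 * 1 * X'.n2 (Q * w) + 2 * M' * X'.n2 (v * Q)) \<le> \<Xi> * (3 * (C4 * s * M') + 2 * M' * (C4 * s))"
        using X'.Xi_nonneg by (rule mult_left_mono)
      also have "\<dots> = 5 * C4 * M' * (\<Xi> * s)" by (simp add: algebra_simps)
      also have "\<dots> \<le> 5 * C4 * M' * e1" using Xi C4 M'1 by (intro mult_left_mono) auto
      finally show ?thesis using V2 e1(4) by linarith
    qed
    then have n2V: "X'.n2 V \<le> e / 2" by (rule power2_le_imp_le) (use e in simp)
    have XQ': "nc_eval X Q' \<in> N"
      using X by (auto simp: nc_eval_def intro!: sum_in_N N_scale op_prod_in_N)
    have uN: "u \<in> N" by (simp add: u_def)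
    have nu': "norm u \<le> 1" using nu by (simp add: u_def X'.nm_def)
    have dQ': "norm (X'.ev Q' - nc_eval X Q') \<le> D * s"
    proof -
      have "norm (X'.ev Q' - nc_eval X Q') \<le> cnorm Q' * (real d * R ^ d * s)"
        using norm_nc_eval_diff_le[of R X X' s Q' d] R1 XR' X'R XX Q'len by blast
      also have "\<dots> \<le> K' * (real d * R ^ d * s)"
        using Q'c R1 s by (intro mult_right_mono) auto
      finally show ?thesis by (simp add: D_def mult.assoc)
    qed
    have "nc_eval X Q' o\<^sub>L u = X'.ev V - ((X'.ev Q' - nc_eval X Q') o\<^sub>L u)"
      by (simp add: V_def X'.ev_mult u_def compose_distribs)
    then have "norm2 \<tau> (nc_eval X Q' o\<^sub>L u) \<le> X'.n2 V + norm (X'.ev Q' - nc_eval X Q') * norm2 \<tau> u"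
      using norm2_diff_le[of "X'.ev V" "(X'.ev Q' - nc_eval X Q') o\<^sub>L u"]
        norm2_mult_le[of "X'.ev Q' - nc_eval X Q'" u] XQ' uN by (simp add: N_intros X'.n2_def)
    also have "\<dots> \<le> e / 2 + D * s * 1"
      using n2V dQ' norm2_le_norm[OF uN] nu' D0 s by (intro add_mono mult_mono) (auto simp: norm2_nonneg uN)
    also have "\<dots> \<le> e"
    proof -
      have "D * s \<le> (D + 1) * e1" using D0 s by (intro mult_mono) auto
      then show ?thesis using e1(3) by (simp add: mult.commute)
    qed
    finally have fin: "norm2 \<tau> (nc_eval X Q' o\<^sub>L u) \<le> e" .
    show ?thesis
      using Q'len Q'c top uN nu' u_lower fin by (intro exI[of _ Q'] exI[of _ u]) (auto simp: a'_def)
  qed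
  then show ?thesis using a' unfolding near_kernel_def by blast
qed

theorem no_near_kernel:
  fixes X :: "'i::finite \<Rightarrow> 'h op"
  assumes "approximable X" "\<And>i. X i \<in> N" "a > 0"
  shows "\<not> near_kernel X (length z) K z a"
  using assms(3)
proof (induction z arbitrary: K a)
  case Nil
  then show ?case using near_kernel_0 by simp
next
  case (Cons j z)
  then show ?case using near_kernel_step[of X "length z" K j z a] assms by auto
qed

end

section \<open>Conjugate systems and free Fisher information\<close>

locale finite_tuple = tracial_tuple N \<tau> X
  for N :: "'h::complex_hilbert op set" and \<tau> and X :: "'i::finite \<Rightarrow> 'h op"
begin

text \<open>\<open>L2_norm\<close> and \<open>L2_trace\<close> are defined by \<open>lim\<close>;
  the Cauchy property of the representing sequence turns both into genuine limits.\<close>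

lemma conjugate_variable_ex:
  assumes "conjugate_system \<tau> X \<xi>"
  shows "\<exists>x. conjugate_variable N \<tau> X j x (L2_norm \<tau> (\<xi> j))"
proof -
  have L: "\<xi> j \<in> L2_generated \<tau> X"
    and tr: "\<And>P. nc_trace2 \<tau> X (nc_deriv j P) = L2_trace \<tau> (\<xi> j) (ev P)"
    using assms by (auto simp: conjugate_system_def)
  have "\<exists>P. \<xi> j k = ev P" for k using L by (auto simp: L2_generated_def)
  then obtain x where x: "\<And>k. \<xi> j k = ev (x k)" by metis
  have C: "\<exists>K. \<forall>k\<ge>K. \<forall>l\<ge>K. n2 (x k - x l) < e" if "e > 0" for e
    using L that by (auto simp: L2_generated_def Cauchy2_def x n2_def nc_eval_diff)
  have "Cauchy (\<lambda>k. n2 (x k))"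
  proof (rule metric_CauchyI)
    fix e :: real assume "e > 0"
    then obtain K where "\<And>k l. k \<ge> K \<Longrightarrow> l \<ge> K \<Longrightarrow> n2 (x k - x l) < e" using C by blast
    then show "\<exists>K. \<forall>k\<ge>K. \<forall>l\<ge>K. dist (n2 (x k)) (n2 (x l)) < e"
      by (intro exI[of _ K]) (auto simp: dist_real_def intro: le_less_trans[OF n2_lipschitz])
  qed
  then have norm: "(\<lambda>k. n2 (x k)) \<longlonglongrightarrow> L2_norm \<tau> (\<xi> j)"
    by (simp add: L2_norm_def x n2_def[symmetric] Cauchy_convergent convergent_LIMSEQ_iff[symmetric])
  have "(\<lambda>k. \<phi> (x k * P)) \<longlonglongrightarrow> dslice j (F 1) (G 1) P" for P
  proof -
    have "Cauchy (\<lambda>k. \<phi> (x k * P))"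
    proof (rule metric_CauchyI)
      fix e :: real assume e: "e > 0"
      have pos: "n2 P + 1 > 0" using n2_nonneg[of P] by linarith
      obtain K where K: "\<And>k l. k \<ge> K \<Longrightarrow> l \<ge> K \<Longrightarrow> n2 (x k - x l) < e / (n2 P + 1)"
        using C[of "e / (n2 P + 1)"] e pos by auto
      have "dist (\<phi> (x k * P)) (\<phi> (x l * P)) < e" if "k \<ge> K" "l \<ge> K" for k l
      proof -
        have "dist (\<phi> (x k * P)) (\<phi> (x l * P)) = cmod (\<phi> ((x k - x l) * P))"
          by (simp add: dist_norm phi_diff left_diff_distrib)
        also have "\<dots> \<le> n2 (x k - x l) * n2 P" by (rule phi_mult_le)
        also have "\<dots> \<le> n2 (x k - x l) * (n2 P + 1)" by (rule mult_left_mono) auto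
        also have "\<dots> < e" using K[OF that] pos by (simp add: field_simps)
        finally show ?thesis .
      qed
      then show "\<exists>K. \<forall>k\<ge>K. \<forall>l\<ge>K. dist (\<phi> (x k * P)) (\<phi> (x l * P)) < e" by blast
    qed
    then have "(\<lambda>k. \<phi> (x k * P)) \<longlonglongrightarrow> lim (\<lambda>k. \<phi> (x k * P))"
      by (simp add: Cauchy_convergent convergent_LIMSEQ_iff[symmetric])
    also have "lim (\<lambda>k. \<phi> (x k * P)) = L2_trace \<tau> (\<xi> j) (ev P)"
      by (simp add: L2_trace_def x \<phi>_def ev_mult)
    also have "\<dots> = dslice j (F 1) (G 1) P"
      unfolding tr[symmetric] nc_trace2_deriv
      by (intro arg_cong3[where f = "\<lambda>f g P. dslice j f g P"] ext refl)
        (simp_all add: F_def G_def \<phi>_def nc_eval_single)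
    finally show ?thesis .
  qed
  then have "conjugate_variable N \<tau> X j x (L2_norm \<tau> (\<xi> j))"
    by (intro conjugate_variable.intro conjugate_variable_axioms.intro tracial_tuple_axioms C norm)
  then show ?thesis by blast
qed

end

text \<open>Pair the conjugate variable with its own variable, whose difference quotient is
  \<open>1 \<otimes> 1\<close>.\<close>

lemma (in conjugate_variable) cramer_rao: "1 \<le> \<Xi> * n2 (word [j])"
proof -
  have "(\<lambda>k. cmod (\<phi> (x k * word [j]))) \<longlonglongrightarrow> cmod (T (word [j]))"
    by (intro tendsto_intros x_pairing)
  moreover have "T (word [j]) = 1"
    using dslice_const[of j "\<lambda>u. F 1 (j # u)" "G 1" 1]
    by (simp add: dslice_Cons cst_1 word_Nil) (simp add: F_def G_def word_Nil phi_1)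
  moreover have "(\<lambda>k. n2 (x k) * n2 (word [j])) \<longlonglongrightarrow> \<Xi> * n2 (word [j])"
    by (intro tendsto_intros x_norm)
  ultimately show ?thesis using phi_mult_le by (auto intro: LIMSEQ_le)
qed

lemma (in finite_tuple) fisher_lessD:
  fixes b :: ereal
  assumes "free_Fisher \<tau> X < b"
  shows "\<exists>\<xi>. conjugate_system \<tau> X \<xi> \<and> ereal (\<Sum>j\<in>UNIV. (L2_norm \<tau> (\<xi> j))\<^sup>2) < b"
  using assms someI_ex[of "conjugate_system \<tau> X"]
  by (auto simp: free_Fisher_def split: if_splits)

lemma (in finite_tuple) fisher_lower:
  fixes q :: real
  assumes q: "q > 0" "\<And>j. (norm2 \<tau> (X j))\<^sup>2 \<le> q"
  shows "ereal (real CARD('i) / q) \<le> free_Fisher \<tau> X"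
proof (cases "free_Fisher \<tau> X = \<infinity>")
  case False
  define \<xi> where "\<xi> = (SOME \<xi>. conjugate_system \<tau> X \<xi>)"
  have ex: "\<exists>\<xi>. conjugate_system \<tau> X \<xi>" using False by (rule contrapos_np) (simp add: free_Fisher_def)
  then have cs: "conjugate_system \<tau> X \<xi>" unfolding \<xi>_def by (rule someI_ex)
  have fi: "free_Fisher \<tau> X = ereal (\<Sum>j\<in>UNIV. (L2_norm \<tau> (\<xi> j))\<^sup>2)"
    using ex by (simp add: free_Fisher_def \<xi>_def)
  have "1 / q \<le> (L2_norm \<tau> (\<xi> j))\<^sup>2" for j
  proof -
    obtain x where "conjugate_variable N \<tau> X j x (L2_norm \<tau> (\<xi> j))" using conjugate_variable_ex[OF cs] by blast
    then interpret C: conjugate_variable N \<tau> X j x "L2_norm \<tau> (\<xi> j)" .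
    have "1 \<le> (L2_norm \<tau> (\<xi> j) * n2 (word [j]))\<^sup>2" using C.cramer_rao by (simp add: one_le_power)
    also have "\<dots> = (L2_norm \<tau> (\<xi> j))\<^sup>2 * (norm2 \<tau> (X j))\<^sup>2"
      by (simp add: power_mult_distrib n2_def nc_eval_word)
    also have "\<dots> \<le> (L2_norm \<tau> (\<xi> j))\<^sup>2 * q" using q by (intro mult_left_mono) auto
    finally show ?thesis using q by (simp add: field_simps)
  qed
  then have "(\<Sum>j\<in>(UNIV :: 'i set). 1 / q) \<le> (\<Sum>j\<in>UNIV. (L2_norm \<tau> (\<xi> j))\<^sup>2)" by (rule sum_mono)
  then show ?thesis by (simp add: fi)
qed simp

section \<open>Semicircular perturbations\<close>

definition sc_density :: "real \<Rightarrow> real" where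
  "sc_density t = indicator {-2..2} t * sqrt (4 - t\<^sup>2) / (2 * pi)"

lemma sc_density_nonneg: "0 \<le> sc_density t"
proof (cases "t \<in> {-2..2}")
  case True
  then have "t\<^sup>2 \<le> 2\<^sup>2" by (intro power2_le_iff_abs_le[THEN iffD2]) auto
  then show ?thesis by (simp add: sc_density_def)
qed (simp add: sc_density_def)

lemma sc_density_measurable [measurable]: "sc_density \<in> borel_measurable borel"
  unfolding sc_density_def by measurable

lemma semicircle_integral: "f \<in> borel_measurable borel \<Longrightarrow>
    (\<integral>t. f t \<partial>semicircle_law) = (\<integral>t. sc_density t * f t \<partial>lborel)" for f :: "real \<Rightarrow> real"
  using integral_density[of f lborel sc_density] sc_density_nonneg
  by (simp add: semicircle_law_def sc_density_def)

lemma semicircle_mean: "(\<integral>t. t \<partial>semicircle_law) = 0"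
proof -
  define I where "I = (\<integral>t. sc_density t * t \<partial>lborel)"
  have "I = (\<integral>t. sc_density (0 + (-1) * t) * (0 + (-1) * t) \<partial>lborel)"
    unfolding I_def using lborel_integral_real_affine[of "-1" "\<lambda>t. sc_density t * t" 0] by simp
  also have "\<dots> = (\<integral>t. - (sc_density t * t) \<partial>lborel)"
    by (intro Bochner_Integration.integral_cong refl) (auto simp: sc_density_def indicator_def)
  also have "\<dots> = - I" by (simp add: I_def)
  finally show ?thesis by (simp add: semicircle_integral I_def)
qed

lemma semicircle_variance: "(\<integral>t. t\<^sup>2 \<partial>semicircle_law) = 1"
proof -
  \<comment> \<open>A primitive of \<open>t\<^sup>2\<close> times the density. Its two terms are
    differentiable only in the open interval, and at the endpoints only the arcsine
    contributes.\<close>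
  define F where "F t = (t * (t\<^sup>2 - 2) * sqrt (4 - t\<^sup>2) / 4 + 2 * arcsin (t / 2)) / (2 * pi)" for t :: real
  have hi: "((\<lambda>t. sqrt (4 - t\<^sup>2) / (2 * pi) * t\<^sup>2) has_integral (F 2 - F (-2))) {-2..2}"
  proof (rule fundamental_theorem_of_calculus_interior)
    show "continuous_on {-2..2} F"
      unfolding F_def by (intro continuous_intros) auto
    fix t :: real assume t: "t \<in> {-2<..<2}"
    then have t4: "4 - t\<^sup>2 > 0" using power_strict_mono[of "\<bar>t\<bar>" 2 2] by auto
    define q where "q = sqrt (4 - t\<^sup>2)"
    have q: "q > 0" "q * q = 4 - t\<^sup>2" using t4 by (auto simp: q_def)
    have h: "sqrt (1 - (t/2)\<^sup>2) = q / 2"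
      using q by (intro real_sqrt_unique) (auto simp: power2_eq_square field_simps)
    have "((\<lambda>t. t * (t\<^sup>2 - 2) * sqrt (4 - t\<^sup>2)) has_real_derivative
       (3 * t\<^sup>2 - 2) * q + t * (t\<^sup>2 - 2) * (- t / q)) (at t)"
      using t4 by (auto intro!: derivative_eq_intros simp: q_def power2_eq_square field_simps)
    moreover have "((\<lambda>t. arcsin (t / 2)) has_real_derivative 1 / q) (at t)"
    proof -
      have "(arcsin has_real_derivative inverse (q / 2)) (at (t / 2))"
        using DERIV_arcsin[of "t / 2"] t h by simp
      moreover have "((\<lambda>t::real. t / 2) has_real_derivative 1 / 2) (at t)"
        by (auto intro!: derivative_eq_intros)
      ultimately have "((\<lambda>t. arcsin (t / 2)) has_real_derivative inverse (q / 2) * (1 / 2)) (at t)"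
        by (rule DERIV_chain2[of arcsin "inverse (q / 2)" "\<lambda>t. t / 2" t "1 / 2" UNIV])
      moreover have "inverse (q / 2) * (1 / 2) = 1 / q" using q by (simp add: field_simps)
      ultimately show ?thesis by (simp only:)
    qed
    ultimately have "(F has_real_derivative
      (((3 * t\<^sup>2 - 2) * q + t * (t\<^sup>2 - 2) * (- t / q)) / 4 + 2 * (1 / q)) / (2 * pi)) (at t)"
      unfolding F_def by (intro DERIV_cdivide DERIV_add DERIV_cmult)
    also have "(((3 * t\<^sup>2 - 2) * q + t * (t\<^sup>2 - 2) * (- t / q)) / 4 + 2 * (1 / q)) = q * t\<^sup>2"
    proof -
      have "(((3 * t\<^sup>2 - 2) * q + t * (t\<^sup>2 - 2) * (- t / q)) / 4 + 2 * (1 / q)) * (4 * q) =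
         (3 * t\<^sup>2 - 2) * (q * q) - t\<^sup>2 * (t\<^sup>2 - 2) + 8"
        using q by (simp add: field_simps power2_eq_square)
      also have "\<dots> = 4 * t\<^sup>2 * (q * q)" unfolding q(2) by (simp add: algebra_simps power2_eq_square)
      also have "\<dots> = q * t\<^sup>2 * (4 * q)" by simp
      finally show ?thesis using q by simp
    qed
    finally show "(F has_vector_derivative sqrt (4 - t\<^sup>2) / (2 * pi) * t\<^sup>2) (at t)"
      by (simp add: has_real_derivative_iff_has_vector_derivative q_def)
  qed simp
  have "set_integrable lborel {-2..2} (\<lambda>t::real. sqrt (4 - t\<^sup>2) / (2 * pi) * t\<^sup>2)"
    by (intro borel_integrable_atLeastAtMost' continuous_intros) auto
  then have "(LINT t:{-2..2}|lborel. sqrt (4 - t\<^sup>2) / (2 * pi) * t\<^sup>2) = F 2 - F (-2)"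
    using set_borel_integral_eq_integral(2) integral_unique[OF hi] by metis
  also have "F 2 - F (-2) = 1" by (simp add: F_def)
  finally have "(LINT t:{-2..2}|lborel. sqrt (4 - t\<^sup>2) / (2 * pi) * t\<^sup>2) = 1" .
  moreover have "(\<integral>t. sc_density t * t\<^sup>2 \<partial>lborel) = (LINT t:{-2..2}|lborel. sqrt (4 - t\<^sup>2) / (2 * pi) * t\<^sup>2)"
    unfolding set_lebesgue_integral_def
    by (rule Bochner_Integration.integral_cong) (auto simp: sc_density_def)
  ultimately have "(\<integral>t. sc_density t * t\<^sup>2 \<partial>lborel) = 1" by (simp only:)
  then show ?thesis by (simp add: semicircle_integral)
qed

lemma (in tracial) semicircular_moments:
  assumes "semicircular N \<tau> S"
  shows "S \<in> N" "op_adj S = S" "\<tau> S = 0" "\<tau> (S o\<^sub>L S) = 1"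
proof -
  have h: "\<tau> (op_prod (replicate k S)) = complex_of_real (\<integral>t. t ^ k \<partial>semicircle_law)" for k
    using assms by (auto simp: semicircular_def has_law_def)
  show "S \<in> N" "op_adj S = S" using assms by (auto simp: semicircular_def self_adjoint_in_def)
  show "\<tau> S = 0" using h[of 1] semicircle_mean by (simp add: op_prod_Cons op_prod_Nil)
  show "\<tau> (S o\<^sub>L S) = 1" using h[of 2] semicircle_variance
    by (simp add: numeral_2_eq_2 op_prod_Cons op_prod_Nil)
qed

text \<open>Freeness speaks of centred elements, so \<open>a\<close> is centred first; the
  correction \<open>\<tau> a * \<tau> b\<close> vanishes because \<open>b\<close> is
  centred.\<close>

lemma (in tracial) free_product_zero:
  assumes free: "freely_independent \<tau> A" and ij: "i \<noteq> j"
    and a: "a \<in> A i" "a \<in> N" and b: "b \<in> A j" "b \<in> N" "\<tau> b = 0"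
  shows "\<tau> (a o\<^sub>L b) = 0"
proof -
  define a' where "a' = a + op_scale (- \<tau> a) id_blinfun"
  have "a' \<in> unital_algebra (A i)"
    unfolding a'_def using a by (intro unital_algebra.add unital_algebra.scale unital_algebra.one unital_algebra.gen)
  moreover have "\<tau> a' = 0" using a by (simp add: a'_def tau_add tau_scale N_intros tau_id)
  moreover have "b \<in> unital_algebra (A j)" using b by (intro unital_algebra.gen)
  ultimately have "\<forall>k<length [i, j]. [a', b] ! k \<in> unital_algebra (A ([i, j] ! k)) \<and> \<tau> ([a', b] ! k) = 0"
    using b by (auto simp: less_Suc_eq)
  then have "\<tau> (op_prod [a', b]) = 0"
    using free ij unfolding freely_independent_def
    by (elim allE[of _ "[i, j]"] allE[of _ "[a', b]"]) (auto simp: less_Suc_eq)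
  then have "\<tau> (a' o\<^sub>L b) = 0" by (simp add: op_prod_Cons op_prod_Nil)
  then show ?thesis
    using a b by (simp add: a'_def compose_distribs op_scale_compose_left tau_add tau_scale N_intros)
qed

locale perturbed = finite_tuple N \<tau> X
  for N :: "'h::complex_hilbert op set" and \<tau> and X :: "'i::finite \<Rightarrow> 'h op" +
  fixes S S' :: "'i \<Rightarrow> 'h op"
  assumes free: "free_semicirculars N \<tau> X S S'"
begin

definition Y :: "real \<Rightarrow> real \<Rightarrow> 'i \<Rightarrow> 'h op" where
  "Y \<epsilon> t = perturb (perturb X S \<epsilon>) S' t"

lemma S_props: "S i \<in> N" "op_adj (S i) = S i" "\<tau> (S i) = 0" "\<tau> (S i o\<^sub>L S i) = 1"
  and S'_props: "S' i \<in> N" "op_adj (S' i) = S' i" "\<tau> (S' i) = 0" "\<tau> (S' i o\<^sub>L S' i) = 1"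
  using semicircular_moments free by (auto simp: free_semicirculars_def)

lemma cross: "\<tau> (X i o\<^sub>L S i) = 0" "\<tau> (X i o\<^sub>L S' i) = 0" "\<tau> (S i o\<^sub>L S' i) = 0"
proof -
  define A where "A = (case_option (range X) (case_sum (\<lambda>i. {S i}) (\<lambda>i. {S' i})) :: ('i + 'i) option \<Rightarrow> _)"
  have f: "freely_independent \<tau> A" using free by (simp add: free_semicirculars_def A_def)
  show "\<tau> (X i o\<^sub>L S i) = 0"
    by (rule free_product_zero[OF f, of None "Some (Inl i)"]) (auto simp: A_def X_N S_props)
  show "\<tau> (X i o\<^sub>L S' i) = 0"
    by (rule free_product_zero[OF f, of None "Some (Inr i)"]) (auto simp: A_def X_N S'_props)
  show "\<tau> (S i o\<^sub>L S' i) = 0"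
    by (rule free_product_zero[OF f, of "Some (Inl i)" "Some (Inr i)"]) (auto simp: A_def S_props S'_props)
qed

lemma Y_N: "Y \<epsilon> t i \<in> N" and Y_adj: "op_adj (Y \<epsilon> t i) = Y \<epsilon> t i"
  by (simp_all add: Y_def perturb_def N_intros X_N S_props S'_props adj_add adj_scaleR X_adj)

lemma Y_tuple: "finite_tuple N \<tau> (Y \<epsilon> t)"
  by unfold_locales (simp add: self_adjoint_in_def Y_N Y_adj)

lemma norm2_Y:
  assumes "\<epsilon> \<ge> 0" "t \<ge> 0"
  shows "(norm2 \<tau> (Y \<epsilon> t i))\<^sup>2 = (norm2 \<tau> (X i))\<^sup>2 + \<epsilon> + t"
proof -
  define a b where "a = sqrt \<epsilon>" "b = sqrt t"
  have sym: "\<tau> (S i o\<^sub>L X i) = 0" "\<tau> (S' i o\<^sub>L X i) = 0" "\<tau> (S' i o\<^sub>L S i) = 0"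
    using cross[of i] by (simp_all add: tau_comm X_N S_props S'_props)
  have "\<tau> (Y \<epsilon> t i o\<^sub>L Y \<epsilon> t i) = \<tau> (X i o\<^sub>L X i) + of_real (a * a) + of_real (b * b)"
    unfolding Y_def perturb_def a_b_def[symmetric]
    by (simp add: compose_distribs tau_add tau_scaleR N_intros X_N S_props S'_props cross sym
        bounded_bilinear.scaleR_left[OF bounded_bilinear_blinfun_compose]
        bounded_bilinear.scaleR_right[OF bounded_bilinear_blinfun_compose])
  then show ?thesis
    using assms by (simp add: norm2_sq Y_N Y_adj X_N X_adj a_b_def)
qed

lemma norm_Y_diff: "norm (Y \<epsilon> t i - X i) \<le> \<bar>sqrt \<epsilon>\<bar> * norm (S i) + \<bar>sqrt t\<bar> * norm (S' i)"
proof -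
  have "Y \<epsilon> t i - X i = sqrt \<epsilon> *\<^sub>R S i + sqrt t *\<^sub>R S' i" by (simp add: Y_def perturb_def)
  then show ?thesis using norm_triangle_ineq[of "sqrt \<epsilon> *\<^sub>R S i" "sqrt t *\<^sub>R S' i"] by simp
qed

lemma approximableI:
  assumes small: "\<And>\<kappa> \<eta>. \<kappa> > 0 \<Longrightarrow> \<eta> > 0 \<Longrightarrow>
    \<exists>\<epsilon> t. 0 < \<epsilon> \<and> \<epsilon> < \<eta> \<and> 0 < t \<and> t < \<eta> \<and> free_Fisher \<tau> (Y \<epsilon> t) < ereal (\<kappa> / (\<epsilon> + t))"
  shows "approximable X"
  unfolding approximable_def
proof (intro allI impI)
  fix e :: real assume e: "e > 0"
  define A where "A = 1 + (\<Sum>i\<in>UNIV. norm (S i) + norm (S' i))"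
  have A1: "A \<ge> 1" unfolding A_def by (simp add: sum_nonneg)
  have A: "norm (S i) + norm (S' i) \<le> A" for i
    using member_le_sum[of i UNIV "\<lambda>i. norm (S i) + norm (S' i)"] by (simp add: A_def)
  \<comment> \<open>The scale will be \<open>s = A * sqrt (\<epsilon> + t)\<close>. Both
    \<open>\<epsilon> + t < \<kappa>\<close> and a Fisher information below
    \<open>\<kappa> / (\<epsilon> + t)\<close> then turn into a bound by \<open>e\<close>.\<close>
  define \<kappa> where "\<kappa> = (e / A)\<^sup>2"
  have k: "\<kappa> > 0" using e A1 by (simp add: \<kappa>_def)
  obtain \<epsilon> t where et: "0 < \<epsilon>" "\<epsilon> < \<kappa> / 2" "0 < t" "t < \<kappa> / 2"
    and fi: "free_Fisher \<tau> (Y \<epsilon> t) < ereal (\<kappa> / (\<epsilon> + t))"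
    using small[of \<kappa> "\<kappa> / 2"] k by auto
  define q where "q = sqrt (\<epsilon> + t)"
  have q: "q > 0" "q\<^sup>2 = \<epsilon> + t" using et by (auto simp: q_def)
  interpret Y: finite_tuple N \<tau> "Y \<epsilon> t" by (rule Y_tuple)
  obtain \<xi> where cs: "conjugate_system \<tau> (Y \<epsilon> t) \<xi>" and sm: "(\<Sum>j\<in>UNIV. (L2_norm \<tau> (\<xi> j))\<^sup>2) < \<kappa> / (\<epsilon> + t)"
    using Y.fisher_lessD[OF fi] by auto
  have "norm (Y \<epsilon> t i - X i) \<le> A * q" for i
  proof -
    have "sqrt \<epsilon> \<le> q" "sqrt t \<le> q" using et by (auto simp: q_def)
    then have "\<bar>sqrt \<epsilon>\<bar> * norm (S i) + \<bar>sqrt t\<bar> * norm (S' i) \<le> q * norm (S i) + q * norm (S' i)"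
      using et by (intro add_mono mult_right_mono) auto
    also have "\<dots> \<le> A * q" using A[of i] q by (simp add: distrib_left[symmetric] mult.commute)
    finally show ?thesis using norm_Y_diff[of \<epsilon> t i] by linarith
  qed
  moreover have "A * q \<le> e"
  proof -
    have "q\<^sup>2 \<le> (e / A)\<^sup>2" using et q by (simp add: \<kappa>_def)
    then have "q \<le> e / A" by (rule power2_le_imp_le) (use e A1 in simp)
    then show ?thesis using A1 by (simp add: field_simps)
  qed
  moreover have "\<exists>x \<Xi>. conjugate_variable N \<tau> (Y \<epsilon> t) j x \<Xi> \<and> \<Xi> * (A * q) \<le> e" for j
  proof -
    obtain x where x: "conjugate_variable N \<tau> (Y \<epsilon> t) j x (L2_norm \<tau> (\<xi> j))"
      using Y.conjugate_variable_ex[OF cs] by blast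
    have "(L2_norm \<tau> (\<xi> j))\<^sup>2 \<le> (\<Sum>j\<in>UNIV. (L2_norm \<tau> (\<xi> j))\<^sup>2)"
      by (rule member_le_sum) auto
    with sm have "(L2_norm \<tau> (\<xi> j))\<^sup>2 < \<kappa> / q\<^sup>2" by (simp add: q)
    then have "(L2_norm \<tau> (\<xi> j))\<^sup>2 * q\<^sup>2 < \<kappa>" using q(1) by (simp add: pos_less_divide_eq)
    then have "(L2_norm \<tau> (\<xi> j) * q)\<^sup>2 \<le> (e / A)\<^sup>2" by (simp add: \<kappa>_def power_mult_distrib)
    then have "L2_norm \<tau> (\<xi> j) * q \<le> e / A" by (rule power2_le_imp_le) (use e A1 in simp)
    then have "L2_norm \<tau> (\<xi> j) * (A * q) \<le> e" using A1 by (simp add: field_simps)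
    with x show ?thesis by blast
  qed
  moreover have "A * q > 0" using A1 q by simp
  ultimately show "\<exists>X' s. 0 < s \<and> s \<le> e \<and> tracial_tuple N \<tau> X' \<and> (\<forall>i. norm (X' i - X i) \<le> s) \<and>
     (\<forall>j. \<exists>x \<Xi>. conjugate_variable N \<tau> X' j x \<Xi> \<and> \<Xi> * s \<le> e)"
    using Y.tracial_tuple_axioms by (intro exI[of _ "Y \<epsilon> t"] exI[of _ "A * q"]) auto
qed

text \<open>The Cramer-Rao bound makes the positive part of the entropy integrand integrable at infinity,
  uniformly in \<open>\<epsilon>\<close>. If \<open>(\<epsilon> + t) \<Phi>\<^sup>*\<close> stayed above \<open>\<kappa>\<close>, the negative part would
  diverge like \<open>\<kappa> log (1 / \<epsilon>)\<close> and cost a definite amount of free entropy dimension.\<close>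

lemma chi_star_upper:
  assumes k: "\<kappa> > 0" and eta: "0 < \<eta>" "\<eta> \<le> 1" "\<eta> * (4 * real CARD('i)) \<le> \<kappa>"
    and r: "r \<ge> 1" "\<And>i. (norm2 \<tau> (X i))\<^sup>2 + 1 \<le> r"
    and big: "\<And>\<epsilon> t. 0 < \<epsilon> \<Longrightarrow> \<epsilon> < \<eta> \<Longrightarrow> 0 < t \<Longrightarrow> t < \<eta> \<Longrightarrow> ereal (\<kappa> / (\<epsilon> + t)) \<le> free_Fisher \<tau> (Y \<epsilon> t)"
    and eps: "0 < \<epsilon>" "\<epsilon> < \<eta> / 2"
  shows "chi_star \<tau> (perturb X S \<epsilon>) S' \<le>
     ereal (1/2 * (real CARD('i) * (r - 1) - \<kappa> / 2 * (ln (\<epsilon> + \<eta> / 2) - ln (2 * \<epsilon>))) +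
       real CARD('i) / 2 * ln (2 * pi * exp 1))"
proof -
  let ?n = "real CARD('i)"
  let ?I = "entropy_integrand \<tau> (perturb X S \<epsilon>) S'"
  have I: "?I t = ereal (?n / (1 + t)) - free_Fisher \<tau> (Y \<epsilon> t)" for t
    by (simp add: entropy_integrand_def Y_def)
  have n1: "?n \<ge> 1" by (simp add: Suc_leI)
  \<comment> \<open>By \<open>norm2_Y\<close> and \<open>\<epsilon> < 1\<close> all second moments
    are at most \<open>r + t\<close>, and the difference of \<open>n / (1 + t)\<close> and
    \<open>n / (r + t)\<close> is integrable at infinity.\<close>
  have up: "?I t \<le> ereal (?n * (r - 1) / (1 + t)\<^sup>2)" if t: "t > 0" for t
  proof -
    interpret Y: finite_tuple N \<tau> "Y \<epsilon> t" by (rule Y_tuple)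
    have "ereal (?n / (r + t)) \<le> free_Fisher \<tau> (Y \<epsilon> t)"
    proof (rule Y.fisher_lower)
      show "(norm2 \<tau> (Y \<epsilon> t j))\<^sup>2 \<le> r + t" for j
        using norm2_Y[of \<epsilon> t j] r(2)[of j] t eps eta by simp
    qed (use t r in simp)
    then have "?I t \<le> ereal (?n / (1 + t)) - ereal (?n / (r + t))"
      unfolding I by (intro ereal_minus_mono order_refl)
    also have "\<dots> = ereal (?n * (r - 1) / ((1 + t) * (r + t)))"
      using t r by (simp add: field_simps)
    also have "\<dots> \<le> ereal (?n * (r - 1) / (1 + t)\<^sup>2)"
      using t r by (simp add: power2_eq_square) (intro divide_left_mono mult_left_mono mult_nonneg_nonneg mult_pos_pos; simp)
    finally show ?thesis .
  qed
  \<comment> \<open>On this range \<open>\<epsilon> + t \<le> \<eta>\<close>, and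
    \<open>\<eta>\<close> is so small that half of \<open>\<kappa> / (\<epsilon> + t)\<close>
    outweighs \<open>n / (1 + t)\<close>.\<close>
  have low: "ereal (\<kappa> / 2 / (\<epsilon> + t)) \<le> - ?I t" if t: "\<epsilon> \<le> t" "t \<le> \<eta> / 2" for t
  proof -
    have t0: "0 < t" "t < \<eta>" "\<epsilon> < \<eta>" using t eps eta by auto
    have "?n / (1 + t) \<le> ?n" using t0 by (simp add: field_simps)
    also have "\<dots> \<le> \<kappa> / 2 / (\<epsilon> + t)"
    proof -
      have "(\<epsilon> + t) * (2 * ?n) \<le> \<eta> * (4 * ?n)" using t eps by (intro mult_mono) auto
      then have "(\<epsilon> + t) * (2 * ?n) \<le> \<kappa>" using eta by linarith
      then show ?thesis using t0 eps by (simp add: field_simps)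
    qed
    finally have "?n / (1 + t) \<le> \<kappa> / 2 / (\<epsilon> + t)" .
    moreover have "\<kappa> / (\<epsilon> + t) = \<kappa> / 2 / (\<epsilon> + t) + \<kappa> / 2 / (\<epsilon> + t)"
      by (simp only: add_divide_distrib[symmetric]) simp
    ultimately have "ereal (\<kappa> / 2 / (\<epsilon> + t)) \<le> ereal (\<kappa> / (\<epsilon> + t)) - ereal (?n / (1 + t))"
      by (simp only: ereal_minus ereal_less_eq)
    also have "\<dots> \<le> free_Fisher \<tau> (Y \<epsilon> t) - ereal (?n / (1 + t))"
      by (intro ereal_minus_mono order_refl big t0 eps)
    also have "\<dots> = - ?I t" unfolding I by (cases "free_Fisher \<tau> (Y \<epsilon> t)") auto
    finally show ?thesis .
  qed
  have A: "(\<integral>\<^sup>+t\<in>{0<..}. e2ennreal (?I t) \<partial>lborel) \<le> ennreal (?n * (r - 1))"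
  proof -
    have "(\<integral>\<^sup>+t\<in>{0<..}. e2ennreal (?I t) \<partial>lborel) \<le>
       (\<integral>\<^sup>+t. ennreal (?n * (r - 1) / (1 + t)\<^sup>2) * indicator {0..} t \<partial>lborel)"
      by (intro nn_integral_mono) (auto simp: indicator_def ennreal.abs_eq intro!: order_trans[OF e2ennreal_mono[OF up]])
    also have "\<dots> = ennreal (0 - (- (?n * (r - 1)) / (1 + 0)))"
    proof (rule nn_integral_FTC_atLeast)
      show "DERIV (\<lambda>t. - (?n * (r - 1)) / (1 + t)) t :> ?n * (r - 1) / (1 + t)\<^sup>2" if "0 \<le> t" for t
        using that by (auto intro!: derivative_eq_intros simp: power2_eq_square)
      show "((\<lambda>t. - (?n * (r - 1)) / (1 + t)) \<longlongrightarrow> 0) at_top"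
        by (intro real_tendsto_divide_at_top[OF tendsto_const] filterlim_tendsto_add_at_top[OF tendsto_const] filterlim_ident)
    qed (use r in auto)
    finally show ?thesis by simp
  qed
  have B: "ennreal (\<kappa> / 2 * (ln (\<epsilon> + \<eta> / 2) - ln (2 * \<epsilon>))) \<le> (\<integral>\<^sup>+t\<in>{0<..}. e2ennreal (- ?I t) \<partial>lborel)"
  proof -
    have "(\<integral>\<^sup>+t. ennreal (\<kappa> / 2 / (\<epsilon> + t)) * indicator {\<epsilon>..\<eta>/2} t \<partial>lborel) =
      ennreal (\<kappa> / 2 * ln (\<epsilon> + \<eta> / 2) - \<kappa> / 2 * ln (\<epsilon> + \<epsilon>))"
    proof (rule nn_integral_FTC_Icc[where F = "\<lambda>t. \<kappa> / 2 * ln (\<epsilon> + t)"])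
      fix t assume "t \<in> {\<epsilon>..\<eta> / 2}"
      then have t: "\<epsilon> + t > 0" using eps by auto
      show "DERIV (\<lambda>t. \<kappa> / 2 * ln (\<epsilon> + t)) t :> \<kappa> / 2 / (\<epsilon> + t)"
        using t by (auto intro!: derivative_eq_intros simp: field_simps)
      show "0 \<le> \<kappa> / 2 / (\<epsilon> + t)" using t k by simp
    qed (use eps in auto)
    moreover have "(\<integral>\<^sup>+t. ennreal (\<kappa> / 2 / (\<epsilon> + t)) * indicator {\<epsilon>..\<eta>/2} t \<partial>lborel) \<le>
        (\<integral>\<^sup>+t\<in>{0<..}. e2ennreal (- ?I t) \<partial>lborel)"
      using eps by (intro nn_integral_mono) (auto simp: indicator_def ennreal.abs_eq intro!: order_trans[OF _ e2ennreal_mono[OF low]])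
    ultimately show ?thesis by (simp add: right_diff_distrib mult_2[symmetric])
  qed
  define \<alpha> \<beta> where "\<alpha> = ?n * (r - 1)" "\<beta> = \<kappa> / 2 * (ln (\<epsilon> + \<eta> / 2) - ln (2 * \<epsilon>))"
  have ab: "\<alpha> \<ge> 0" "\<beta> \<ge> 0" using r k eps eta by (auto simp: \<alpha>_\<beta>_def intro!: mult_nonneg_nonneg)
  have "enn2ereal (\<integral>\<^sup>+t\<in>{0<..}. e2ennreal (?I t) \<partial>lborel) - enn2ereal (\<integral>\<^sup>+t\<in>{0<..}. e2ennreal (- ?I t) \<partial>lborel)
     \<le> ereal \<alpha> - ereal \<beta>"
  proof (rule ereal_minus_mono)
    show "enn2ereal (\<integral>\<^sup>+t\<in>{0<..}. e2ennreal (?I t) \<partial>lborel) \<le> ereal \<alpha>"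
      using A[folded \<alpha>_\<beta>_def, unfolded less_eq_ennreal.rep_eq] ab by (simp only: enn2ereal_ennreal)
    show "ereal \<beta> \<le> enn2ereal (\<integral>\<^sup>+t\<in>{0<..}. e2ennreal (- ?I t) \<partial>lborel)"
      using B[folded \<alpha>_\<beta>_def, unfolded less_eq_ennreal.rep_eq] ab by (simp only: enn2ereal_ennreal)
  qed
  then have "chi_star \<tau> (perturb X S \<epsilon>) S' \<le> ereal (1/2) * (ereal \<alpha> - ereal \<beta>) + ereal (?n / 2 * ln (2 * pi * exp 1))"
    unfolding chi_star_def by (intro add_right_mono ereal_mult_left_mono) auto
  then show ?thesis by (simp add: \<alpha>_\<beta>_def)
qed

text \<open>By \<open>chi_star_upper\<close> the free entropy is at most
  \<open>C + \<kappa> / 2 * ln (sqrt \<epsilon>)\<close>. Dividing by the negative logarithm gives a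
  lower bound that tends to \<open>\<kappa> / 2\<close>, of which \<open>\<kappa> / 4\<close> is
  kept.\<close>

lemma delta_star_less:
  assumes k: "\<kappa> > 0" and eta: "0 < \<eta>"
    and big: "\<And>\<epsilon> t. 0 < \<epsilon> \<Longrightarrow> \<epsilon> < \<eta> \<Longrightarrow> 0 < t \<Longrightarrow> t < \<eta> \<Longrightarrow> ereal (\<kappa> / (\<epsilon> + t)) \<le> free_Fisher \<tau> (Y \<epsilon> t)"
  shows "delta_star \<tau> X S S' < ereal (real CARD('i))"
proof -
  let ?n = "real CARD('i)"
  define h where "h = min \<eta> (min 1 (\<kappa> / (4 * ?n)))"
  have n0: "?n > 0" by simp
  have h: "0 < h" "h \<le> 1" "h \<le> \<eta>" using k eta n0 by (auto simp: h_def)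
  have "h \<le> \<kappa> / (4 * ?n)" by (simp add: h_def)
  then have h4: "h * (4 * ?n) \<le> \<kappa>" using n0 by (simp add: pos_le_divide_eq)
  define r where "r = 1 + (\<Sum>i\<in>UNIV. (norm2 \<tau> (X i))\<^sup>2)"
  have r: "r \<ge> 1" by (simp add: r_def sum_nonneg)
  have r2: "(norm2 \<tau> (X i))\<^sup>2 + 1 \<le> r" for i
    using member_le_sum[of i UNIV "\<lambda>i. (norm2 \<tau> (X i))\<^sup>2"] by (simp add: r_def)
  define C where "C = 1/2 * (?n * (r - 1) - \<kappa> / 2 * (ln (h / 2) - ln 2)) + ?n / 2 * ln (2 * pi * exp 1)"
  have ub: "chi_star \<tau> (perturb X S \<epsilon>) S' \<le> ereal (C + \<kappa> / 2 * ln (sqrt \<epsilon>))" if e: "0 < \<epsilon>" "\<epsilon> < h / 2" for \<epsilon>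
  proof -
    have "chi_star \<tau> (perturb X S \<epsilon>) S' \<le>
     ereal (1/2 * (?n * (r - 1) - \<kappa> / 2 * (ln (\<epsilon> + h / 2) - ln (2 * \<epsilon>))) + ?n / 2 * ln (2 * pi * exp 1))"
      using h by (intro chi_star_upper k h4 r r2 e big) auto
    also have "\<dots> \<le> ereal (C + \<kappa> / 2 * ln (sqrt \<epsilon>))"
    proof -
      have "ln (h / 2) \<le> ln (\<epsilon> + h / 2)" using e h by simp
      then have "\<kappa> / 2 * (ln (h / 2) - ln (2 * \<epsilon>)) \<le> \<kappa> / 2 * (ln (\<epsilon> + h / 2) - ln (2 * \<epsilon>))"
        using k by (intro mult_left_mono) auto
      moreover have "ln (2 * \<epsilon>) = ln 2 + 2 * ln (sqrt \<epsilon>)" using e by (simp add: ln_mult ln_sqrt)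
      ultimately show ?thesis by (simp add: C_def algebra_simps)
    qed
    finally show ?thesis .
  qed
  have lim: "((\<lambda>\<epsilon>. C / ln (sqrt \<epsilon>)) \<longlongrightarrow> 0) (at_right 0)"
  proof -
    have "filterlim (\<lambda>\<epsilon>::real. ln (sqrt \<epsilon>)) at_bot (at_right 0)"
    proof (rule filterlim_compose[OF ln_at_0])
      show "filterlim sqrt (at_right 0) (at_right 0)"
        unfolding filterlim_at
        by (auto intro!: tendsto_eq_intros simp: eventually_at_right_less eventually_at_right_field exI[of _ 1])
    qed
    then show ?thesis by (intro tendsto_divide_0[OF tendsto_const] filterlim_at_bot_imp_at_infinity)
  qed
  have "eventually (\<lambda>\<epsilon>. C / ln (sqrt \<epsilon>) > - (\<kappa> / 4)) (at_right 0)"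
    using lim k by (intro order_tendstoD(1)) auto
  moreover have "eventually (\<lambda>\<epsilon>::real. \<epsilon> > 0 \<and> \<epsilon> < h / 2) (at_right 0)"
    using h unfolding eventually_at_right_field by (intro exI[of _ "h/2"]) auto
  ultimately have ev: "eventually (\<lambda>\<epsilon>. ereal (\<kappa> / 4) \<le> chi_star \<tau> (perturb X S \<epsilon>) S' / ereal (ln (sqrt \<epsilon>))) (at_right 0)"
  proof eventually_elim
    case (elim \<epsilon>)
    define l where "l = ln (sqrt \<epsilon>)"
    have l: "l < 0" using elim h by (simp add: l_def)
    have q: "\<kappa> / 4 \<le> y / l" if "y \<le> C + \<kappa> / 2 * l" for y
    proof -
      have "(C + \<kappa> / 2 * l) / l \<le> y / l" using that l by (intro divide_right_mono_neg) auto
      moreover have "(C + \<kappa> / 2 * l) / l = C / l + \<kappa> / 2" using l by (simp add: add_divide_distrib)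
      moreover have "- (\<kappa> / 4) < C / l" using elim by (simp add: l_def)
      ultimately show ?thesis by linarith
    qed
    have u: "chi_star \<tau> (perturb X S \<epsilon>) S' \<le> ereal (C + \<kappa> / 2 * l)" using ub[of \<epsilon>] elim by (simp add: l_def)
    show ?case
    proof (cases "chi_star \<tau> (perturb X S \<epsilon>) S'")
      case (real y)
      then have "\<kappa> / 4 \<le> y / l" using u q by simp
      then show ?thesis using real l by (simp add: l_def[symmetric])
    next
      \<comment> \<open>Free entropy \<open>-\<infinity>\<close> divided by the negative
        \<open>l\<close> is \<open>\<infinity>\<close>.\<close>
      case MInf
      then show ?thesis using l by (simp add: l_def[symmetric] divide_ereal_def)
    qed (use u in auto)
  qed
  have "ereal (\<kappa> / 4) \<le> Liminf (at_right 0) (\<lambda>\<epsilon>. chi_star \<tau> (perturb X S \<epsilon>) S' / ereal (ln (sqrt \<epsilon>)))"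
    by (rule Liminf_bounded) (rule ev)
  then have "delta_star \<tau> X S S' \<le> ereal ?n - ereal (\<kappa> / 4)"
    unfolding delta_star_def by (intro ereal_minus_mono order_refl)
  also have "\<dots> < ereal ?n" using k by simp
  finally show ?thesis .
qed

theorem approximable_of_delta_star:
  assumes "delta_star \<tau> X S S' = ereal (real CARD('i))"
  shows "approximable X"
  using assms delta_star_less by (intro approximableI) (metis less_irrefl not_le)

end

section \<open>Existence and uniqueness of the distribution\<close>

lemma Suc_binomial_step: "Suc j * (k choose Suc j) = (k - j) * (k choose j)"
proof (cases k)
  case (Suc k')
  then show ?thesis using Suc_times_binomial[of j k'] binomial_absorb_comp[of k j] by simp
qed simp

lemma binomial_mono_left: "k \<le> n \<Longrightarrow> k choose j \<le> n choose j"
proof (induction n rule: dec_induct)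
  case (step n)
  then show ?case by (cases j) auto
qed simp

lemma cst_diff: "cst (a - b) = cst a - cst b"
  using cst_add[of a "- b"] by (simp add: cst_minus)

text \<open>The quotient of the binomials is the product of \<open>(k - i) / (n - i)\<close> over
  \<open>i < j\<close>. Each factor differs from \<open>k / n\<close> by at most
  \<open>i / n\<close>, and these errors add up to at most \<open>j\<^sup>2 / n\<close>.\<close>

lemma binomial_ratio:
  assumes kn: "k \<le> n" and jn: "j \<le> n" "n > 0"
  shows "real (k choose j) / real (n choose j) \<le> 1"
    "\<bar>real (k choose j) / real (n choose j) - (real k / real n) ^ j\<bar> \<le> (real j)\<^sup>2 / real n"
proof -
  have le1: "real (k choose j) / real (n choose j) \<le> 1" if "j \<le> n" for j
    using kn binomial_mono_left[of k n j] that zero_less_binomial[of j n] by (simp add: divide_le_eq_1)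
  then show "real (k choose j) / real (n choose j) \<le> 1" using jn by simp
  show "\<bar>real (k choose j) / real (n choose j) - (real k / real n) ^ j\<bar> \<le> (real j)\<^sup>2 / real n"
    using jn(1)
  proof (induction j)
    case (Suc j)
    define \<rho> where "\<rho> = real (k choose j) / real (n choose j)"
    define a where "a = real (k - j) / real (n - j)"
    define b where "b = real k / real n"
    have pos: "real (n - j) > 0" "real (n choose j) > 0" "real (n choose Suc j) > 0"
      using Suc.prems zero_less_binomial[of j n] zero_less_binomial[of "Suc j" n] by auto
    have "real (Suc j) * real (k choose Suc j) = real (k - j) * real (k choose j)"
      "real (Suc j) * real (n choose Suc j) = real (n - j) * real (n choose j)"
      by (simp_all only: of_nat_mult[symmetric] Suc_binomial_step)
    then have "(real (Suc j) * real (k choose Suc j)) / (real (Suc j) * real (n choose Suc j)) =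
      (real (k - j) * real (k choose j)) / (real (n - j) * real (n choose j))" by (simp only:)
    then have r: "real (k choose Suc j) / real (n choose Suc j) = a * \<rho>"
      by (simp only: a_def \<rho>_def times_divide_times_eq) simp
    have b: "0 \<le> b" "b \<le> 1" using kn jn by (auto simp: b_def)
    have \<rho>: "0 \<le> \<rho>" "\<rho> \<le> 1" using le1[of j] Suc.prems by (auto simp: \<rho>_def)
    have ab: "\<bar>a - b\<bar> \<le> real j / real n"
    proof (cases "j \<le> k")
      case True
      define E where "E = real j * real (n - k) / (real n * real (n - j))"
      have "b - a = E"
        using True Suc.prems kn jn(2) by (simp add: E_def a_def b_def of_nat_diff field_simps)
      moreover have "E \<le> real j * real (n - j) / (real n * real (n - j))"
        unfolding E_def using True jn by (intro divide_right_mono mult_left_mono) auto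
      moreover have "real j * real (n - j) / (real n * real (n - j)) = real j / real n" using pos by simp
      moreover have "0 \<le> E" by (simp add: E_def)
      ultimately show ?thesis by (simp add: abs_le_iff)
    next
      \<comment> \<open>Here \<open>k < j\<close>, so \<open>k - j\<close> truncates to 0 and
        \<open>a = 0\<close>.\<close>
      case False
      then have "real k / real n \<le> real j / real n" by (intro divide_right_mono) auto
      then show ?thesis using False b by (simp add: a_def b_def)
    qed
    have "a * \<rho> - b ^ Suc j = (a - b) * \<rho> + b * (\<rho> - b ^ j)" by (simp add: algebra_simps)
    then have "\<bar>a * \<rho> - b ^ Suc j\<bar> \<le> \<bar>a - b\<bar> * \<rho> + b * \<bar>\<rho> - b ^ j\<bar>"
      using b \<rho> abs_triangle_ineq[of "(a - b) * \<rho>" "b * (\<rho> - b ^ j)"] by (simp add: abs_mult)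
    also have "\<dots> \<le> real j / real n * 1 + 1 * ((real j)\<^sup>2 / real n)"
      using ab b \<rho> Suc by (intro add_mono mult_mono) (auto simp: \<rho>_def b_def)
    also have "\<dots> \<le> (real (Suc j))\<^sup>2 / real n"
      by (simp add: add_divide_distrib[symmetric] divide_right_mono power2_eq_square algebra_simps)
    finally show ?case by (simp add: r b_def)
  qed simp
qed

text \<open>In the model, \<open>f k l\<close> is the integral of \<open>x ^ k * (1 - x) ^ l\<close>
  over the unit interval.\<close>

locale hausdorff_moments =
  fixes f :: "nat \<Rightarrow> nat \<Rightarrow> real"
  assumes f_nonneg: "0 \<le> f k l" and f_0: "f 0 0 = 1" and f_step: "f k (Suc l) = f k l - f (Suc k) l"
begin

text \<open>In the model, the binomial expansion of \<open>(x + (1 - x)) ^ n = 1\<close> inside the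
  integral.\<close>

lemma partition: "(\<Sum>k\<le>n. real (n choose k) * f (a + k) (b + (n - k))) = f a b"
proof (induction n arbitrary: a b)
  case (Suc n)
  have "(\<Sum>k\<le>Suc n. real (Suc n choose k) * f (a + k) (b + (Suc n - k))) =
    f a (b + Suc n) + (\<Sum>k\<le>n. real (Suc n choose Suc k) * f (a + Suc k) (b + (n - k)))"
    by (subst sum.atMost_Suc_shift) simp
  also have "\<dots> = (f a (b + Suc n) + (\<Sum>k\<le>n. real (n choose Suc k) * f (a + Suc k) (b + (n - k))))
      + (\<Sum>k\<le>n. real (n choose k) * f (Suc a + k) (b + (n - k)))"
    by (simp add: sum.distrib[symmetric] distrib_right algebra_simps)
  also have "f a (b + Suc n) + (\<Sum>k\<le>n. real (n choose Suc k) * f (a + Suc k) (b + (n - k))) =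
      (\<Sum>k\<le>n. real (n choose k) * f (a + k) (Suc b + (n - k)))"
  proof -
    have "(\<Sum>k\<le>n. real (n choose Suc k) * f (a + Suc k) (b + (n - k))) =
      (\<Sum>k<n. real (n choose Suc k) * f (a + Suc k) (Suc b + (n - Suc k)))"
      by (simp add: lessThan_Suc_atMost[symmetric] binomial_eq_0 Suc_diff_Suc)
    moreover have "(\<Sum>k\<le>n. real (n choose k) * f (a + k) (Suc b + (n - k))) =
       f a (Suc b + n) + (\<Sum>k<n. real (n choose Suc k) * f (a + Suc k) (Suc b + (n - Suc k)))"
      by (simp add: lessThan_Suc_atMost[symmetric] sum.lessThan_Suc_shift del: sum.lessThan_Suc)
    ultimately show ?thesis by simp
  qed
  also have "(\<Sum>k\<le>n. real (n choose k) * f (a + k) (Suc b + (n - k))) = f a (Suc b)" by (rule Suc)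
  also have "(\<Sum>k\<le>n. real (n choose k) * f (Suc a + k) (b + (n - k))) = f (Suc a) b" by (rule Suc)
  finally show ?case by (simp add: f_step)
qed simp

text \<open>Since \<open>(n choose k) * (k choose j) = (n choose j) * ((n - j) choose (k -
  j))\<close>, the rest is summed by \<open>partition\<close>. Factorial moments are thus exact, and
  only the passage to ordinary moments costs the error of \<open>binomial_ratio\<close>.\<close>

lemma factorial_moment:
  assumes "j \<le> n"
  shows "(\<Sum>k\<le>n. real (n choose k) * f k (n - k) * real (k choose j)) = real (n choose j) * f j 0"
proof -
  have "(\<Sum>k\<le>n. real (n choose k) * f k (n - k) * real (k choose j)) =
    (\<Sum>k\<in>{j..n}. real (n choose k) * f k (n - k) * real (k choose j))"
    by (rule sum.mono_neutral_right) (auto simp: not_le)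
  also have "\<dots> = (\<Sum>i\<in>{0..n - j}. real (n choose (i + j)) * f (i + j) (n - (i + j)) * real ((i + j) choose j))"
    using sum.shift_bounds_cl_nat_ivl[of "\<lambda>k. real (n choose k) * f k (n - k) * real (k choose j)" 0 j "n - j"] assms
    by simp
  also have "\<dots> = (\<Sum>i\<le>n - j. real (n choose j) * (real ((n - j) choose i) * f (j + i) (0 + (n - j - i))))"
  proof (rule sum.cong)
    fix i assume i: "i \<in> {..n - j}"
    have "(n choose (i + j)) * ((i + j) choose j) = (n choose j) * ((n - j) choose i)"
      using choose_mult[of j "i + j" n] i assms by simp
    then have "real (n choose (i + j)) * real ((i + j) choose j) = real (n choose j) * real ((n - j) choose i)"
      by (simp only: of_nat_mult[symmetric])
    then have "(real (n choose (i + j)) * real ((i + j) choose j)) * f (i + j) (n - (i + j)) =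
      (real (n choose j) * real ((n - j) choose i)) * f (i + j) (n - (i + j))" by (simp only:)
    moreover have e: "f (j + i) (0 + (n - j - i)) = f (i + j) (n - (i + j))" by (simp add: add.commute)
    ultimately show "real (n choose (i + j)) * f (i + j) (n - (i + j)) * real ((i + j) choose j) =
      real (n choose j) * (real ((n - j) choose i) * f (j + i) (0 + (n - j - i)))"
      unfolding e by (simp only: mult.assoc mult.commute[of "f (i + j) (n - (i + j))"])
  qed auto
  also have "\<dots> = real (n choose j) * f j 0" by (simp only: sum_distrib_left[symmetric] partition)
  finally show ?thesis .
qed

definition wt :: "nat \<Rightarrow> nat \<Rightarrow> real" where "wt n k = real (n choose k) * f k (n - k)"

text \<open>Mass \<open>wt n k\<close> at the Bernstein node \<open>k / n\<close>. For
  \<open>n = 0\<close> the only node is 0, by division by 0, and the measure is still a probability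
  on the unit interval.\<close>

definition bernstein_measure :: "nat \<Rightarrow> real measure" where
  "bernstein_measure n = distr (point_measure {..n} (\<lambda>k. ennreal (wt n k))) borel (\<lambda>k. real k / real n)"

lemma wt_nonneg: "0 \<le> wt n k"
  by (simp add: wt_def f_nonneg)

lemma wt_sum: "(\<Sum>k\<le>n. wt n k) = 1"
  using partition[of n 0 0] by (simp add: wt_def f_0)

lemma real_distribution_bernstein: "real_distribution (bernstein_measure n)"
proof -
  have "prob_space (point_measure {..n} (\<lambda>k. ennreal (wt n k)))"
    by (rule prob_spaceI)
      (simp add: space_point_measure emeasure_point_measure_finite sum_ennreal wt_nonneg wt_sum)
  then interpret p: prob_space "point_measure {..n} (\<lambda>k. ennreal (wt n k))" .
  show ?thesis
    unfolding bernstein_measure_def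
    by (rule p.real_distribution_distr) (simp add: measurable_def space_point_measure sets_point_measure)
qed

lemma integral_bernstein:
  "g \<in> borel_measurable borel \<Longrightarrow> (\<integral>x. g x \<partial>bernstein_measure n) = (\<Sum>k\<le>n. wt n k * g (real k / real n))"
  for g :: "real \<Rightarrow> real"
  unfolding bernstein_measure_def
  by (subst integral_distr)
    (auto simp: measurable_def space_point_measure sets_point_measure lebesgue_integral_point_measure_finite wt_nonneg)

lemma measure_bernstein: "measure (bernstein_measure n) {-1<..2} = 1"
proof -
  interpret real_distribution "bernstein_measure n" by (rule real_distribution_bernstein)
  have "measure (bernstein_measure n) {-1<..2} = (\<integral>x. indicator {-1<..2} x \<partial>bernstein_measure n)" by simp
  also have "\<dots> = (\<Sum>k\<le>n. wt n k * indicator {-1<..2} (real k / real n))"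
    by (rule integral_bernstein) simp
  also have "\<dots> = (\<Sum>k\<le>n. wt n k * 1)"
  proof (intro sum.cong refl arg_cong2[where f = "(*)"])
    fix k assume "k \<in> {..n}"
    then have "0 \<le> real k / real n" "real k / real n \<le> 1" by (auto simp: divide_le_eq_1)
    moreover from this(1) have "- 1 < real k / real n" by linarith
    ultimately show "indicator {-1<..2} (real k / real n) = (1::real)" by (auto simp: indicator_def)
  qed
  finally show ?thesis by (simp add: wt_sum)
qed

lemma bernstein_moment_tendsto: "(\<lambda>n. \<Sum>k\<le>n. wt n k * (real k / real n) ^ j) \<longlonglongrightarrow> f j 0"
proof (rule LIM_zero_cancel, rule Lim_null_comparison)
  show "(\<lambda>n. (real j)\<^sup>2 / real n) \<longlonglongrightarrow> 0" by (rule lim_const_over_n)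
  show "eventually (\<lambda>n. norm ((\<Sum>k\<le>n. wt n k * (real k / real n) ^ j) - f j 0) \<le> (real j)\<^sup>2 / real n) sequentially"
    using eventually_ge_at_top[of "Suc j"]
  proof eventually_elim
    case (elim n)
    then have jn: "j \<le> n" "n > 0" by auto
    have "f j 0 = (\<Sum>k\<le>n. wt n k * (real (k choose j) / real (n choose j)))"
      using factorial_moment[OF jn(1)] zero_less_binomial[OF jn(1)]
      by (simp add: wt_def sum_divide_distrib[symmetric])
    then have "(\<Sum>k\<le>n. wt n k * (real k / real n) ^ j) - f j 0 =
       (\<Sum>k\<le>n. wt n k * ((real k / real n) ^ j - real (k choose j) / real (n choose j)))"
      by (simp add: sum_subtractf right_diff_distrib)
    also have "norm \<dots> \<le> (\<Sum>k\<le>n. wt n k * ((real j)\<^sup>2 / real n))"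
    proof (rule sum_norm_le)
      fix k assume k: "k \<in> {..n}"
      have "\<bar>(real k / real n) ^ j - real (k choose j) / real (n choose j)\<bar> \<le> (real j)\<^sup>2 / real n"
        using binomial_ratio(2)[of k n j] jn k by (simp add: abs_minus_commute)
      from mult_left_mono[OF this wt_nonneg]
      show "norm (wt n k * ((real k / real n) ^ j - real (k choose j) / real (n choose j))) \<le> wt n k * ((real j)\<^sup>2 / real n)"
        by (simp only: real_norm_def abs_mult abs_of_nonneg[OF wt_nonneg])
    qed
    also have "\<dots> = (real j)\<^sup>2 / real n" by (simp only: sum_distrib_right[symmetric] wt_sum mult_1)
    finally show ?case .
  qed
qed

text \<open>A weak limit along a subsequence. Powers are unbounded on the line, so they are composed
  with the truncation \<open>cl\<close>, which fixes all Bernstein nodes; the image of the limit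
  under \<open>cl\<close> has the required moments.\<close>

theorem moment_measure_ex:
  "\<exists>\<nu>. prob_space \<nu> \<and> sets \<nu> = sets borel \<and> (\<forall>j. integrable \<nu> (\<lambda>x. x ^ j) \<and> (\<integral>x. x ^ j \<partial>\<nu>) = f j 0)"
proof -
  have "tight bernstein_measure"
    unfolding tight_def using real_distribution_bernstein
    by (intro conjI allI impI exI[of _ "-1"] exI[of _ 2]) (auto simp: measure_bernstein)
  then obtain r M where r: "strict_mono (r :: nat \<Rightarrow> nat)" and M: "real_distribution M"
      and w: "weak_conv_m (bernstein_measure \<circ> id \<circ> r) M"
    using tight_imp_convergent_subsubsequence[of bernstein_measure id] by (auto simp: strict_mono_id)
  interpret M: real_distribution M by (rule M)
  define cl where "cl x = max 0 (min 1 x)" for x :: real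
  have cl_m [measurable]: "cl \<in> borel_measurable borel" unfolding cl_def by measurable
  have cl: "0 \<le> cl x" "cl x \<le> 1" for x by (auto simp: cl_def)
  have clp: "norm (cl x ^ j) \<le> 1" for x j using cl[of x] by (simp add: power_le_one)
  have mom: "(\<integral>x. cl x ^ j \<partial>M) = f j 0" for j
  proof (rule LIMSEQ_unique)
    show "(\<lambda>n. \<integral>x. cl x ^ j \<partial>(bernstein_measure (r n))) \<longlonglongrightarrow> (\<integral>x. cl x ^ j \<partial>M)"
    proof (rule weak_conv_imp_integral_bdd_continuous_conv[where B = 1])
      show "isCont (\<lambda>x. cl x ^ j) x" for x unfolding cl_def by (intro continuous_intros)
      show "weak_conv_m (\<lambda>n. bernstein_measure (r n)) M" using w by (simp add: o_def)
    qed (auto simp: real_distribution_bernstein M clp[unfolded real_norm_def])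
    have "cl (real k / real n) = real k / real n" if "k \<le> n" for k n
    proof -
      have "real k / real n \<le> 1" "0 \<le> real k / real n" using that by (auto simp: divide_le_eq_1)
      then show ?thesis by (simp only: cl_def min_absorb2 max_absorb2)
    qed
    then have "(\<integral>x. cl x ^ j \<partial>(bernstein_measure n)) = (\<Sum>k\<le>n. wt n k * (real k / real n) ^ j)" for n
      by (subst integral_bernstein) (auto intro!: sum.cong)
    then show "(\<lambda>n. \<integral>x. cl x ^ j \<partial>(bernstein_measure (r n))) \<longlonglongrightarrow> f j 0"
      using LIMSEQ_subseq_LIMSEQ[OF bernstein_moment_tendsto r] by (simp add: o_def)
  qed
  have int: "integrable M (\<lambda>x. cl x ^ j)" for j
    by (rule M.integrable_const_bound[where B = 1]) (auto simp: clp[unfolded real_norm_def])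
  show ?thesis
    by (intro exI[of _ "distr M borel cl"] conjI allI)
      (auto intro!: M.prob_space_distr simp: integrable_distr_eq integral_distr int mom)
qed

end

text \<open>Both characteristic functions have the same Taylor polynomials, with error at most
  \<open>2 * (\<bar>t\<bar> * C) ^ (2 * k) / fact (2 * k)\<close>. At even orders absolute moments
  are moments.\<close>

lemma real_distribution_moments_unique:
  assumes M: "real_distribution M" "real_distribution M'"
    and i: "\<And>k. integrable M (\<lambda>x. x ^ k)" "\<And>k. integrable M' (\<lambda>x. x ^ k)"
    and e: "\<And>k. (\<integral>x. x ^ k \<partial>M) = (\<integral>x. x ^ k \<partial>M')"
    and b: "\<And>k. (\<integral>x. x ^ (2 * k) \<partial>M) \<le> C ^ (2 * k)"
  shows "M = M'"
proof (rule Levy_uniqueness[OF M], rule ext)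
  fix t :: real
  have ev: "\<bar>x\<bar> ^ (2 * k) = x ^ (2 * k)" for x :: real and k by (rule power_even_abs) simp
  have "cmod (char M t - char M' t) \<le> 4 * ((\<bar>t\<bar> * C) ^ (2 * k) / fact (2 * k))" for k
  proof -
    let ?s = "\<Sum>i\<le>2*k. ((\<i> * complex_of_real t) ^ i / fact i) * complex_of_real (\<integral>x. x ^ i \<partial>M)"
    have "2 * \<bar>t\<bar> ^ (2*k) / fact (2*k) * (\<integral>x. x ^ (2*k) \<partial>M) \<le> 2 * \<bar>t\<bar> ^ (2*k) / fact (2*k) * C ^ (2*k)"
      by (intro mult_left_mono b) auto
    then have le: "2 * \<bar>t\<bar> ^ (2*k) / fact (2*k) * (\<integral>x. x ^ (2*k) \<partial>M) \<le> 2 * ((\<bar>t\<bar> * C) ^ (2 * k) / fact (2 * k))"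
      by (simp add: power_mult_distrib)
    have "cmod (char M t - ?s) \<le> 2 * ((\<bar>t\<bar> * C) ^ (2 * k) / fact (2 * k))"
      using real_distribution.char_approx1[where n = "2 * k" and t = t, OF M(1) i(1)] le by (simp only: ev)
    moreover have "cmod (char M' t - ?s) \<le> 2 * ((\<bar>t\<bar> * C) ^ (2 * k) / fact (2 * k))"
      using real_distribution.char_approx1[where n = "2 * k" and t = t, OF M(2) i(2)] le by (simp only: ev e)
    ultimately show ?thesis
      using norm_triangle_ineq4[of "char M t - ?s" "char M' t - ?s"] by simp
  qed
  moreover have "(\<lambda>k. 4 * ((\<bar>t\<bar> * C) ^ (2 * k) / fact (2 * k))) \<longlonglongrightarrow> 4 * 0"
  proof (intro tendsto_intros)
    have "(\<lambda>n. (\<bar>t\<bar> * C) ^ n / fact n) \<longlonglongrightarrow> 0"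
      using summable_LIMSEQ_zero[OF summable_exp[of "\<bar>t\<bar> * C"]] by (simp add: divide_inverse mult.commute)
    from LIMSEQ_subseq_LIMSEQ[OF this, of "\<lambda>k. 2 * k"]
    show "(\<lambda>k. (\<bar>t\<bar> * C) ^ (2 * k) / fact (2 * k)) \<longlonglongrightarrow> 0"
      by (simp add: strict_mono_def o_def)
  qed
  ultimately have "cmod (char M t - char M' t) \<le> 4 * 0" by (intro LIMSEQ_le_const) auto
  then show "char M t = char M' t" by simp
qed

section \<open>The distribution of a self-adjoint polynomial and its atoms\<close>

context tracial_tuple
begin

text \<open>Degree 2 covers both applications: the affine change of variable in
  \<open>has_law_ex\<close>, and \<open>gap c T\<close> for \<open>T = Q - t\<close>. The factor
  \<open>x ^ j\<close> makes the induction on \<open>k\<close> go through.\<close>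

lemma moments_transfer:
  fixes \<alpha> \<beta> \<gamma> :: real
  assumes m: "\<And>j. integrable \<nu> (\<lambda>x. x ^ j)" "\<And>j. (\<integral>x. x ^ j \<partial>\<nu>) = Re (\<phi> (A ^ j))"
  shows "integrable \<nu> (\<lambda>x. x ^ j * (\<alpha> + \<beta> * x + \<gamma> * x\<^sup>2) ^ k) \<and>
    (\<integral>x. x ^ j * (\<alpha> + \<beta> * x + \<gamma> * x\<^sup>2) ^ k \<partial>\<nu>) = Re (\<phi> (A ^ j * (cst \<alpha> + cst \<beta> * A + cst \<gamma> * (A * A)) ^ k))"
proof (induction k arbitrary: j)
  case 0
  then show ?case using m by simp
next
  case (Suc k)
  let ?p = "\<lambda>x. \<alpha> + \<beta> * x + \<gamma> * x\<^sup>2" and ?P = "cst (complex_of_real \<alpha>) + cst \<beta> * A + cst \<gamma> * (A * A)"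
  have eq: "x ^ j * ?p x ^ Suc k = \<alpha> * (x ^ j * ?p x ^ k) + \<beta> * (x ^ Suc j * ?p x ^ k) + \<gamma> * (x ^ Suc (Suc j) * ?p x ^ k)" for x
    by (simp add: algebra_simps power2_eq_square)
  have Eq: "A ^ j * ?P ^ Suc k = cst \<alpha> * (A ^ j * ?P ^ k) + cst \<beta> * (A ^ Suc j * ?P ^ k) + cst \<gamma> * (A ^ Suc (Suc j) * ?P ^ k)"
  proof -
    have "A ^ j * ?P ^ Suc k = A ^ j * ?P * ?P ^ k" by (simp add: mult.assoc)
    also have "A ^ j * ?P = cst \<alpha> * A ^ j + cst \<beta> * A ^ Suc j + cst \<gamma> * A ^ Suc (Suc j)"
      by (simp only: distrib_left cst_left_commute[of "A ^ j"] cst_commute[of "complex_of_real \<alpha>" "A ^ j"]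
          power_Suc2 mult.assoc)
    finally show ?thesis by (simp add: distrib_right mult.assoc)
  qed
  have R: "Re (\<phi> (cst (complex_of_real r) * Q)) = r * Re (\<phi> Q)" for r Q by (simp add: phi_cst)
  show ?case
    unfolding eq Eq using Suc[of j] Suc[of "Suc j"] Suc[of "Suc (Suc j)"]
    by (simp only: phi_add plus_complex.sel R) (simp add: Bochner_Integration.integral_add)
qed

lemma phi_self_adjoint_real: "nc_star P = P \<Longrightarrow> \<phi> P = of_real (Re (\<phi> P))"
  using phi_star[of P] by (simp add: complex_eq_iff)

lemma has_law_ev_iff: "has_law \<tau> (ev Q) \<mu> \<longleftrightarrow> prob_space \<mu> \<and> sets \<mu> = sets borel \<and>
     (\<forall>k. integrable \<mu> (\<lambda>t. t ^ k) \<and> \<phi> (Q ^ k) = complex_of_real (\<integral>t. t ^ k \<partial>\<mu>))"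
  by (simp add: has_law_def ev_power[symmetric] \<phi>_def)

text \<open>The affine image \<open>A\<close> of \<open>Q\<close> has spectrum in the unit interval,
  so the traces of \<open>A ^ k * (1 - A) ^ l\<close> form a Hausdorff family. Its measure is
  carried back by the inverse affine map \<open>h\<close>.\<close>

lemma has_law_ex:
  assumes Q: "nc_star Q = Q"
  shows "\<exists>\<mu>. has_law \<tau> (ev Q) \<mu>"
proof -
  define C where "C = nm Q + 1"
  have C: "C > 0" "nm Q \<le> C" using nm_nonneg[of Q] by (auto simp: C_def add_nonneg_pos)
  define A where "A = cst (of_real (1/2)) + cst (of_real (1 / (2 * C))) * Q"
  define B where "B = 1 - A"
  have B_eq: "B = cst (of_real (1/2)) - cst (of_real (1 / (2 * C))) * Q"
  proof -
    have "cst (of_real (1/2)) + cst (of_real (1/2)) = (1 :: 'i ncpoly)"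
      by (simp add: cst_add[symmetric] cst_1)
    then have "1 - cst (of_real (1/2)) = (cst (of_real (1/2)) :: 'i ncpoly)"
      by (metis add_diff_cancel_right')
    then show ?thesis by (simp only: B_def A_def diff_diff_eq[symmetric])
  qed
  have star: "nc_star A = A" "nc_star B = B"
    by (simp_all add: A_def B_def nc_star_add nc_star_diff nc_star_mult nc_star_cst Q cst_commute)
  have bd: "\<bar>Re (\<phi> (nc_star y * (Q * y)))\<bar> \<le> C * (n2 y)\<^sup>2" for y
  proof -
    have "\<bar>Re (\<phi> (nc_star y * (Q * y)))\<bar> \<le> n2 y * n2 (Q * y)"
      using cauchy_schwarz[of y "Q * y"] abs_Re_le_cmod order_trans by blast
    also have "\<dots> \<le> n2 y * (C * n2 y)"
      using C n2_mult_le[of Q y] mult_right_mono[of "nm Q" C "n2 y"] by (intro mult_left_mono) auto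
    finally show ?thesis by (simp add: power2_eq_square ac_simps)
  qed
  have Re_cst: "Re (\<phi> (nc_star y * (cst (of_real (1/2)) + cst (of_real s) * Q) * y)) =
      (n2 y)\<^sup>2 / 2 + s * Re (\<phi> (nc_star y * (Q * y)))" for y s
  proof -
    have "nc_star y * (cst (of_real (1/2)) + cst (of_real s) * Q) * y =
      cst (of_real (1/2)) * (nc_star y * y) + cst (of_real s) * (nc_star y * (Q * y))"
      by (simp add: distrib_left distrib_right cst_commute[symmetric] cst_left_commute mult.assoc)
    then show ?thesis
      by (simp only: phi_add plus_complex.sel Re_phi_cst phi_star_mult) simp
  qed
  have pA: "0 \<le> Re (\<phi> (nc_star y * A * y))" for y
  proof -
    have "Re (\<phi> (nc_star y * A * y)) = (n2 y)\<^sup>2 / 2 + (1 / (2 * C)) * Re (\<phi> (nc_star y * (Q * y)))"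
      unfolding A_def by (rule Re_cst)
    moreover have "(1 / (2 * C)) * - (C * (n2 y)\<^sup>2) \<le> (1 / (2 * C)) * Re (\<phi> (nc_star y * (Q * y)))"
      using bd[of y] C by (intro mult_left_mono) auto
    moreover have "(1 / (2 * C)) * - (C * (n2 y)\<^sup>2) = - ((n2 y)\<^sup>2 / 2)" using C by simp
    ultimately show ?thesis by linarith
  qed
  have pB: "0 \<le> Re (\<phi> (nc_star y * B * y))" for y
  proof -
    have "B = cst (of_real (1/2)) + cst (of_real (- (1 / (2 * C)))) * Q"
      by (simp add: B_eq cst_minus)
    then have "Re (\<phi> (nc_star y * B * y)) = (n2 y)\<^sup>2 / 2 + (- (1 / (2 * C))) * Re (\<phi> (nc_star y * (Q * y)))"
      by (simp only: Re_cst)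
    moreover have "(1 / (2 * C)) * Re (\<phi> (nc_star y * (Q * y))) \<le> (1 / (2 * C)) * (C * (n2 y)\<^sup>2)"
      using bd[of y] C by (intro mult_left_mono) auto
    moreover have "(1 / (2 * C)) * (C * (n2 y)\<^sup>2) = (n2 y)\<^sup>2 / 2" using C by simp
    ultimately show ?thesis by linarith
  qed
  have AB: "B * A = A * B" by (simp add: B_def algebra_simps)
  have c1: "B ^ j * A ^ i = A ^ i * B ^ j" for i j
    by (metis AB power_commuting_commutes)
  have c2: "B ^ j * (A ^ i * Z) = A ^ i * (B ^ j * Z)" for i j Z
    by (simp add: mult.assoc[symmetric] c1)
  have c3: "A ^ i * (A ^ j * Z) = A ^ (i + j) * Z" "B ^ i * (B ^ j * Z) = B ^ (i + j) * Z" for i j Z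
    by (simp_all add: power_add mult.assoc)
  have E: "0 \<le> Re (\<phi> (nc_star y * (A ^ p * B ^ q) * y))" if pq: "p < 2" "q < 2" for y p q
  proof -
    consider "p = 0" "q = 0" | "p = 1" "q = 0" | "p = 0" "q = 1" | "p = 1" "q = 1" using pq by linarith
    then show ?thesis
    proof cases
      case 4
      \<comment> \<open>Inserting \<open>A + B = 1\<close> writes the product as
        \<open>A * B * A + B * A * B\<close>, so its positivity follows from that of the single
        factors.\<close>
      have "A * B = (A * B) * (A + B)" by (simp add: B_def)
      also have "\<dots> = A * B * A + B * A * B" by (simp add: distrib_left AB mult.assoc[symmetric])
      finally have "nc_star y * (A * B) * y = nc_star y * (A * B * A + B * A * B) * y" by (simp only:)
      also have "\<dots> = nc_star (A * y) * B * (A * y) + nc_star (B * y) * A * (B * y)"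
        by (simp add: nc_star_mult star distrib_left distrib_right mult.assoc)
      finally show ?thesis using 4 pA[of "B * y"] pB[of "A * y"] by (simp add: phi_add)
    qed (use pA pB in \<open>auto simp: phi_star_mult\<close>)
  qed
  define f where "f k l = Re (\<phi> (A ^ k * B ^ l))" for k l
  interpret H: hausdorff_moments f
  proof
    fix k l
    \<comment> \<open>Half of the exponents go to either side, and only their parities remain in the
      middle, which is the case \<open>E\<close>.\<close>
    define y where "y = A ^ (k div 2) * B ^ (l div 2)"
    have sy: "nc_star y = y" by (simp add: y_def nc_star_mult nc_star_power star c1)
    have "nc_star y * (A ^ (k mod 2) * B ^ (l mod 2)) * y =
      A ^ (k div 2 + (k mod 2 + k div 2)) * B ^ (l div 2 + (l mod 2 + l div 2))"
      unfolding sy unfolding y_def by (simp add: mult.assoc c1 c2 c3 power_add[symmetric] add.assoc)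
    also have "k div 2 + (k mod 2 + k div 2) = k" by presburger
    also have "l div 2 + (l mod 2 + l div 2) = l" by presburger
    finally show "0 \<le> f k l" using E[of "k mod 2" "l mod 2" y] by (simp add: f_def)
    have "A ^ k * B ^ Suc l = A ^ k * B ^ l - A ^ k * (B ^ l * A ^ 1)"
      by (simp only: power_Suc2 B_def right_diff_distrib mult.assoc) (simp add: B_def)
    also have "A ^ k * (B ^ l * A ^ 1) = A ^ Suc k * B ^ l"
      by (simp only: c1 c3) simp
    finally show "f k (Suc l) = f k l - f (Suc k) l" by (simp add: f_def phi_diff)
  qed (simp add: f_def phi_1)
  obtain \<nu> where \<nu>: "prob_space \<nu>" "sets \<nu> = sets borel" "\<And>j. integrable \<nu> (\<lambda>x. x ^ j)"
     "\<And>j. (\<integral>x. x ^ j \<partial>\<nu>) = Re (\<phi> (A ^ j))"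
    using H.moment_measure_ex by (auto simp: f_def)
  have QA: "Q = cst (of_real (- C)) + cst (of_real (2 * C)) * A + cst (of_real 0) * (A * A)"
  proof -
    have "cst (of_real (2 * C)) * A = cst (of_real C) + Q"
      using C by (simp add: A_def distrib_left cst_mult mult.assoc[symmetric] cst_1)
    then show ?thesis by (simp only: of_real_minus cst_minus of_real_0 cst_0) simp
  qed
  define h where "h x = - C + 2 * C * x" for x :: real
  have hb: "h \<in> borel_measurable borel" unfolding h_def by measurable
  have [measurable]: "h \<in> borel_measurable \<nu>"
    using hb by (simp only: measurable_cong_sets[OF \<nu>(2) refl])
  have hm: "integrable \<nu> (\<lambda>x. h x ^ k)" "(\<integral>x. h x ^ k \<partial>\<nu>) = Re (\<phi> (Q ^ k))" for k
    using moments_transfer[OF \<nu>(3,4), of 0 "- C" "2 * C" 0 k] unfolding QA[symmetric] by (simp_all add: h_def)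
  interpret \<nu>: prob_space \<nu> by fact
  have "has_law \<tau> (ev Q) (distr \<nu> borel h)"
    unfolding has_law_ev_iff
  proof (intro conjI allI)
    fix k
    show "integrable (distr \<nu> borel h) (\<lambda>t. t ^ k)" by (simp add: integrable_distr_eq hm)
    show "\<phi> (Q ^ k) = complex_of_real (\<integral>t. t ^ k \<partial>distr \<nu> borel h)"
      using phi_self_adjoint_real[of "Q ^ k"] by (simp add: integral_distr hm nc_star_power Q)
  qed (auto intro: \<nu>.prob_space_distr)
  then show ?thesis by blast
qed

lemma has_law_unique:
  assumes "has_law \<tau> (ev Q) \<mu>" "has_law \<tau> (ev Q) \<mu>'"
  shows "\<mu> = \<mu>'"
proof (rule real_distribution_moments_unique[where C = "nm Q"])
  show "real_distribution \<mu>" "real_distribution \<mu>'"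
    using assms by (auto simp: has_law_def real_distribution_def real_distribution_axioms_def)
  show "integrable \<mu> (\<lambda>x. x ^ k)" "integrable \<mu>' (\<lambda>x. x ^ k)" for k
    using assms by (auto simp: has_law_def)
  have m: "complex_of_real (\<integral>x. x ^ k \<partial>\<mu>) = \<phi> (Q ^ k)" "complex_of_real (\<integral>x. x ^ k \<partial>\<mu>') = \<phi> (Q ^ k)" for k
    using assms by (auto simp: has_law_ev_iff)
  show "(\<integral>x. x ^ k \<partial>\<mu>) = (\<integral>x. x ^ k \<partial>\<mu>')" for k using m[of k] by (metis of_real_eq_iff)
  show "(\<integral>x. x ^ (2 * k) \<partial>\<mu>) \<le> nm Q ^ (2 * k)" for k
  proof -
    have "\<bar>\<integral>x. x ^ (2 * k) \<partial>\<mu>\<bar> = cmod (\<phi> (Q ^ (2 * k)))" using m(1)[of "2 * k"] norm_of_real by metis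
    also have "\<dots> \<le> nm (Q ^ (2 * k))" using phi_le_n2 n2_le_nm order_trans by blast
    also have "\<dots> \<le> nm Q ^ (2 * k)" by (rule nm_power_le)
    finally show ?thesis by simp
  qed
qed

text \<open>An atom at \<open>t\<close> yields approximate kernel elements \<open>(1 - (Q - t)\<^sup>2 / c)\<^sup>k\<close> of \<open>Q - t\<close>.\<close>

lemma atom_imp_near_kernel:
  assumes Q: "nc_star Q = Q" and law: "has_law \<tau> (ev Q) \<mu>" and atom: "measure \<mu> {t} > 0"
    and z: "lookup (Q - cst (of_real t)) z \<noteq> 0"
    and len: "\<And>w. w \<in> keys (Q - cst (of_real t)) \<Longrightarrow> length w \<le> d"
  shows "\<exists>K a. a > 0 \<and> near_kernel X d K z a"
proof -
  define T where "T = Q - cst (of_real t)"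
  have sT: "nc_star T = T" by (simp add: T_def nc_star_diff nc_star_cst Q)
  define c where "c = (nm T)\<^sup>2 + 1"
  have c: "c > 0" "(nm T)\<^sup>2 \<le> c" by (auto simp: c_def add_nonneg_pos)
  interpret \<mu>: prob_space \<mu> using law by (simp add: has_law_def)
  have sets: "sets \<mu> = sets borel" using law by (simp add: has_law_def)
  then have sp: "space \<mu> = UNIV" using sets_eq_imp_space_eq[of \<mu> borel] by simp
  have m: "integrable \<mu> (\<lambda>x. x ^ j)" "(\<integral>x. x ^ j \<partial>\<mu>) = Re (\<phi> (Q ^ j))" for j
    using law by (auto simp: has_law_ev_iff)
  have gap: "gap c T = cst (of_real (1 - t\<^sup>2 / c)) + cst (of_real (2 * t / c)) * Q + cst (of_real (- (1 / c))) * (Q * Q)"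
  proof -
    have "T * T = Q * Q - (cst (of_real t) * Q + cst (of_real t) * Q) + cst (of_real (t * t))"
      by (simp add: T_def left_diff_distrib right_diff_distrib cst_commute[of _ Q, symmetric] cst_mult)
    also have "cst (of_real t) * Q + cst (of_real t) * Q = cst (of_real (t + t)) * Q"
      by (simp only: of_real_add cst_add distrib_right)
    finally have TT: "T * T = Q * Q - cst (of_real (t + t)) * Q + cst (of_real (t * t))" .
    have "gap c T = 1 - (cst (of_real (1/c)) * (Q * Q) - cst (of_real (1/c) * of_real (t + t)) * Q
        + cst (of_real (1/c) * of_real (t * t)))"
      by (simp only: gap_def sT TT right_diff_distrib[of "cst _"] distrib_left[of "cst _"]
          mult.assoc[of "cst _" "cst _" Q, symmetric] cst_mult)
    then have g: "gap c T = 1 - (cst (of_real (1/c)) * (Q * Q) - cst (of_real (1/c * (t + t))) * Q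
        + cst (of_real (1/c * (t * t))))"
      by (simp only: of_real_mult)
    have c0: "cst (of_real (1 - t\<^sup>2 / c)) = 1 - cst (of_real (1/c * (t * t)))"
      by (simp add: cst_diff cst_1 power2_eq_square)
    have c1: "1/c * (t + t) = 2 * t / c" by simp
    have c2: "cst (of_real (- (1 / c))) * (Q * Q) = - (cst (of_real (1 / c)) * (Q * Q))"
      by (simp add: cst_minus)
    show ?thesis unfolding g c0 c1 c2 by (simp add: algebra_simps)
  qed
  \<comment> \<open>The polynomial \<open>1 - (x - t)\<^sup>2 / c\<close> is 1 at \<open>t\<close>,
    and its even powers are non-negative on the whole line; so they dominate the indicator of
    \<open>t\<close> wherever \<open>\<mu>\<close> lives.\<close>
  have low: "measure \<mu> {t} \<le> (n2 (gap c T ^ k))\<^sup>2" for k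
  proof -
    let ?p = "\<lambda>x. (1 - t\<^sup>2 / c) + (2 * t / c) * x + (- (1 / c)) * x\<^sup>2"
    have p: "?p t = 1" using c by (simp add: field_simps power2_eq_square)
    have i: "integrable \<mu> (\<lambda>x. ?p x ^ (2 * k))" "(\<integral>x. ?p x ^ (2 * k) \<partial>\<mu>) = Re (\<phi> (gap c T ^ (2 * k)))"
      using moments_transfer[OF m, of 0 "1 - t\<^sup>2 / c" "2 * t / c" "- (1 / c)" "2 * k"] unfolding gap by simp_all
    have "measure \<mu> {t} = (\<integral>x. indicator {t} x \<partial>\<mu>)" using sets by (simp add: sp)
    also have "\<dots> \<le> (\<integral>x. ?p x ^ (2 * k) \<partial>\<mu>)"
    proof (rule integral_mono)
      show "integrable \<mu> (indicator {t} :: real \<Rightarrow> real)"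
        by (rule integrable_real_indicator) (auto simp: sets \<mu>.emeasure_eq_measure)
      show "indicator {t} x \<le> ?p x ^ (2 * k)" for x
      proof (cases "x = t")
        case True
        then have "?p x = 1" using p by (simp only:)
        then show ?thesis using True by (simp only: power_one) simp
      next
        case False
        have "0 \<le> ?p x ^ (2 * k)" by (simp only: power_mult) (rule zero_le_power, rule zero_le_power2)
        then show ?thesis using False by simp
      qed
    qed (rule i)
    also have "\<dots> = (n2 (gap c T ^ k))\<^sup>2"
      unfolding i(2) phi_gap_power_sq by simp
    finally show ?thesis .
  qed
  define a where "a = min (sqrt (measure \<mu> {t})) (cmod (lookup T z))"
  have a: "a > 0" using atom z by (simp add: a_def T_def)
  have "near_kernel X d (cnorm T) z a"
    unfolding near_kernel_def
  proof (intro allI impI)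
    fix e :: real assume e: "e > 0"
    obtain k :: nat where k: "c / e\<^sup>2 < real k" using reals_Archimedean2 by blast
    have "real (Suc (2 * k)) * (n2 (T * gap c T ^ k))\<^sup>2 \<le> c" by (rule n2_gap_power[OF c])
    also have "c \<le> real (Suc (2 * k)) * e\<^sup>2"
    proof -
      have "c < real k * e\<^sup>2" using k e by (simp add: field_simps)
      also have "\<dots> \<le> real (Suc (2 * k)) * e\<^sup>2" by (rule mult_right_mono) auto
      finally show ?thesis by simp
    qed
    finally have "(n2 (T * gap c T ^ k))\<^sup>2 \<le> e\<^sup>2"
      by (simp only: mult_le_cancel_left_pos[of "real (Suc (2 * k))"] of_nat_0_less_iff zero_less_Suc)
    then have small: "n2 (T * gap c T ^ k) \<le> e" by (rule power2_le_imp_le) (use e in simp)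
    have "sqrt (measure \<mu> {t}) \<le> n2 (gap c T ^ k)" using low[of k] by (simp add: real_le_lsqrt)
    then show "\<exists>R u. (\<forall>w\<in>keys R. length w \<le> d) \<and> cnorm R \<le> cnorm T \<and>
       a \<le> cmod (lookup R z) \<and> u \<in> N \<and> norm u \<le> 1 \<and> a \<le> norm2 \<tau> u \<and>
       norm2 \<tau> (nc_eval X R o\<^sub>L u) \<le> e"
      using len nm_gap_power(1)[OF c, of k] small
      by (intro exI[of _ T] exI[of _ "ev (gap c T ^ k)"])
        (auto simp: T_def[symmetric] a_def nm_def n2_def ev_mult)
  qed
  then show ?thesis using a by blast
qed

end

section \<open>Transfer to the enlargement and conclusion\<close>

lemma lookup_minus_cst: "w \<noteq> [] \<Longrightarrow> lookup (P - cst c) w = lookup P w"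
  by (simp add: lookup_minus cst_def lookup_single when_def)

lemma nonconstant_top_word:
  assumes "\<not> nc_constant P"
  shows "\<exists>z. z \<noteq> [] \<and> z \<in> keys P \<and> (\<forall>w\<in>keys P. length w \<le> length z)"
proof -
  have "P \<noteq> 0" using assms by (metis nc_constant_def single_zero)
  then have ne: "keys P \<noteq> {}" by simp
  then have "Max (length ` keys P) \<in> length ` keys P" by (intro Max_in) auto
  then obtain z where z0: "z \<in> keys P" "length z = Max (length ` keys P)" by auto
  have z: "z \<in> keys P" "\<And>w. w \<in> keys P \<Longrightarrow> length w \<le> length z"
    using z0 by auto
  have "z \<noteq> []"
  proof
    assume "z = []"
    then have "P = single [] (lookup P [])"
      using z(2) by (intro poly_mapping_eqI) (force simp: lookup_single when_def in_keys_iff)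
    then show False using assms by (auto simp: nc_constant_def)
  qed
  then show ?thesis using z by blast
qed

lemma enlargement_op_prod:
  assumes "tracial M \<tau>" "enlargement M \<tau> N \<sigma> \<iota>" "set as \<subseteq> M"
  shows "\<iota> (op_prod as) = op_prod (map \<iota> as)"
proof -
  interpret tracial M \<tau> by fact
  show ?thesis
    using assms(2,3)
    by (induction as) (auto simp: enlargement_def op_prod_Nil op_prod_Cons op_prod_in_N)
qed

lemma enlargement_nc_eval:
  assumes M: "tracial M \<tau>" and i: "enlargement M \<tau> N \<sigma> \<iota>" and X: "\<And>i. X i \<in> M"
  shows "\<iota> (nc_eval X P) = nc_eval (\<lambda>i. \<iota> (X i)) P"
proof -
  interpret tracial M \<tau> by fact
  have w: "op_prod (map X w) \<in> M" for w using X by (intro op_prod_in_N) auto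
  have mem: "nc_eval X P \<in> M" for P
    unfolding nc_eval_def by (intro sum_in_N N_scale w)
  show ?thesis
  proof (induction P rule: poly_mapping_induct)
    case (single v c)
    have "\<iota> (op_prod (map X v)) = op_prod (map (\<lambda>i. \<iota> (X i)) v)"
      using enlargement_op_prod[OF M i, of "map X v"] X by (auto simp: o_def)
    then show ?case using i w by (simp add: nc_eval_single enlargement_def)
  next
    case (add P P')
    then show ?case using i mem by (simp add: nc_eval_add enlargement_def)
  qed
qed

theorem corollary3p2:
  fixes M :: "'h::complex_hilbert op set" and \<tau> :: "'h op \<Rightarrow> complex"
    and N :: "'k::complex_hilbert op set" and \<sigma> :: "'k op \<Rightarrow> complex"
    and \<iota> :: "'h op \<Rightarrow> 'k op"
    and X :: "'i::finite \<Rightarrow> 'h op"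
    and S S' :: "'i \<Rightarrow> 'k op"
    and P :: "'i ncpoly"
  assumes "tracial_W_space M \<tau>"
    and "\<And>i. self_adjoint_in M (X i)"
    and "tracial_W_space N \<sigma>"
    and "enlargement M \<tau> N \<sigma> \<iota>"
    and "free_semicirculars N \<sigma> (\<lambda>i. \<iota> (X i)) S S'"
    and "delta_star \<sigma> (\<lambda>i. \<iota> (X i)) S S' = ereal (real CARD('i))"
    and "nc_star P = P"
    and "\<not> nc_constant P"
  shows "\<forall>t. emeasure (law \<tau> (nc_eval X P)) {t} = 0"
proof
  fix t :: real
  interpret M: tracial_tuple M \<tau> X
    using assms(1,2) by unfold_locales
  have sa: "self_adjoint_in N (\<iota> (X i))" for i
    using assms(4) M.X_N[of i] M.X_adj[of i] by (auto simp: enlargement_def self_adjoint_in_def)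
  interpret N: perturbed N \<sigma> "\<lambda>i. \<iota> (X i)" S S'
    using assms(3,5) sa by unfold_locales
  let ?Y = "nc_eval X P"
  obtain \<mu> where \<mu>: "has_law \<tau> ?Y \<mu>" using M.has_law_ex[OF assms(7)] by blast
  then have law: "law \<tau> ?Y = \<mu>"
    unfolding law_def by (rule the_equality) (use \<mu> M.has_law_unique in blast)
  \<comment> \<open>The distribution is defined in \<open>M\<close>, the semicirculars live in
    \<open>N\<close>; equal moments make \<open>\<mu>\<close> the distribution in both.\<close>
  have "\<sigma> (op_prod (replicate k (N.ev P))) = \<tau> (op_prod (replicate k ?Y))" for k
  proof -
    have "\<iota> ?Y = N.ev P" by (rule enlargement_nc_eval[OF M.tracial_axioms assms(4) M.X_N])
    moreover have "set (replicate k ?Y) \<subseteq> M" by auto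
    ultimately have "op_prod (replicate k (N.ev P)) = \<iota> (op_prod (replicate k ?Y))"
      using enlargement_op_prod[OF M.tracial_axioms assms(4), of "replicate k ?Y"] by simp
    moreover have "op_prod (replicate k ?Y) \<in> M" by (rule M.op_prod_in_N) auto
    ultimately show ?thesis using assms(4) by (simp add: enlargement_def)
  qed
  then have lawN: "has_law \<sigma> (N.ev P) \<mu>" using \<mu> by (simp add: has_law_def)
  interpret \<mu>: prob_space \<mu> using \<mu> by (simp add: has_law_def)
  \<comment> \<open>A longest word; being non-empty, it keeps its coefficient when the constant
    \<open>t\<close> is subtracted.\<close>
  obtain z where z: "z \<noteq> []" "z \<in> keys P" "\<And>w. w \<in> keys P \<Longrightarrow> length w \<le> length z"
    using nonconstant_top_word[OF assms(8)] by blast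
  have "\<not> measure \<mu> {t} > 0"
  proof
    assume atom: "measure \<mu> {t} > 0"
    have "\<exists>K a. a > 0 \<and> N.near_kernel (\<lambda>i. \<iota> (X i)) (length z) K z a"
    proof (rule N.atom_imp_near_kernel[OF assms(7) lawN atom])
      show "lookup (P - cst (of_real t)) z \<noteq> 0"
        using z(1,2) by (simp add: lookup_minus_cst in_keys_iff)
      show "length w \<le> length z" if "w \<in> keys (P - cst (of_real t))" for w
        using that z(3)[of w] by (cases "w = []") (auto simp: lookup_minus_cst in_keys_iff)
    qed
    moreover have "N.approximable (\<lambda>i. \<iota> (X i))" by (rule N.approximable_of_delta_star) (rule assms(6))
    ultimately show False using N.no_near_kernel N.X_N by blast
  qed
  then have "measure \<mu> {t} = 0" using measure_nonneg[of \<mu> "{t}"] by linarith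
  then show "emeasure (law \<tau> ?Y) {t} = 0" by (simp add: law \<mu>.emeasure_eq_measure)
qed

end
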